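(* Let $0<\alpha<\pi$. The domain $\Omega_\alpha$ has Szegő–Widom asymptotics; that is, there exists $\phi\in\mathbb{R}$ such that, uniformly on compact subsets of $\Omega_\alpha$ (in the variable $u$, with $u^*=1/\overline{u}$ and $z=z(u)$), $$\lim_{n\to\infty}\overline{b_{\Omega_\alpha}(u^*,\infty)^nP_{n,\infty}(u^* )}=e^{i\phi}\,\frac{1+s(z)}{2s(z)}\,\frac{b_{\Omega_0}(z,0)}{b_{\Omega_0}(z,\overline{z_0})},$$ where $$s(z)=\sqrt{\frac{z_0^2-1}{z_0^2}\,\frac{z^2}{z^2-1}},\qquad s(z_0)=1.$$
   Context: $A_\alpha=\{u\in\mathbb{C}: |u|=1,\ -\alpha\le\arg u\le\alpha\}$, $\Omega_\alpha=\overline{\mathbb{C}}\setminus A_\alpha$, and $\Omega_0=(\mathbb{C}\setminus\mathbb{R})\cup(-1,1)$. Put $z_0=i\tan(\alpha/2)$. The Möbius map $u(z)=\frac{z-z_0}{z-\overline{z_0}}$ maps $\Omega_0$ conformally onto $\Omega_\alpha$; $z(u)$ denotes its inverse. The function $s$ is the analytic branch of the square root on $\Omega_0$ with $s(z_0)=1$. For a domain $\Omega$ with Green's function $g_\Omega(z,z_1)$ with pole at $z_1$, the complex Green's function is $b_\Omega(z,z_1)=e^{-(g_\Omega(z,z_1)+i*g_\Omega(z,z_1))}$, where $*g_\Omega$ is a harmonic conjugate of $g_\Omega$ (so $b_\Omega$ is determined up to a unimodular constant). The function $b_{\Omega_\alpha}(u,\infty)$ is normalized by $\lim_{u\to\infty}u\,b_{\Omega_\alpha}(u,\infty)>0$.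 $\mathcal{P}_{n,\alpha}$ is the set of complex polynomials $P$ of degree at most $n$ with $\sup_{u\in A_\alpha}|P(u)|\le1$. $P_{n,\infty}\in\mathcal{P}_{n,\alpha}$ is the polynomial whose coefficient of $u^n$ is maximal in modulus among all elements of $\mathcal{P}_{n,\alpha}$, normalized so that this coefficient is positive; equivalently $P_{n,\infty}=T_n/\|T_n\|_{A_\alpha}$, with $T_n$ the $n$-th (monic) Chebyshev polynomial of $A_\alpha$. Functions are understood as extended over removable singularities (including the function $b_{\Omega_\alpha}(\cdot,\infty)^nP_{n,\infty}$ at $\infty$). *)

theory Defs
  imports "HOL-Complex_Analysis.Complex_Analysis" "HOL-Library.Landau_Symbols"
begin

text \<open>
  The Riemann sphere is the one-point compactification of the plane: \<open>Some w\<close> is the finite point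
  \<open>w\<close> and \<open>None\<close> is the point at infinity.
\<close>

type_synonym sphere = "complex option"

definition riemann_sphere :: "sphere topology" where
  "riemann_sphere = Alexandroff_compactification euclidean"

text \<open>The local parametrization \<open>w \<mapsto> 1/w\<close> at infinity; the other chart is \<open>Some\<close>.\<close>

definition inv_chart :: "complex \<Rightarrow> sphere" where
  "inv_chart w = (if w = 0 then None else Some (inverse w))"

definition holomorphic_on_sphere :: "(sphere \<Rightarrow> complex) \<Rightarrow> sphere set \<Rightarrow> bool" where
  "holomorphic_on_sphere f U \<longleftrightarrow>
     (f \<circ> Some) holomorphic_on (Some -` U) \<and> (f \<circ> inv_chart) holomorphic_on (inv_chart -` U)"

text \<open>Real harmonic functions on plane open sets: twice continuously differentiable with
  vanishing Laplacian.  Here \<open>gx, gy, gxx, gxy, gyy\<close> are the partial derivatives.\<close>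

definition harmonic_on_plane :: "(complex \<Rightarrow> real) \<Rightarrow> complex set \<Rightarrow> bool" where
  "harmonic_on_plane g U \<longleftrightarrow>
     (\<exists>gx gy gxx gxy gyy.
        continuous_on U gxx \<and> continuous_on U gxy \<and> continuous_on U gyy \<and>
        (\<forall>z\<in>U.
           (g  has_derivative (\<lambda>h. gx z * Re h + gy z * Im h)) (at z) \<and>
           (gx has_derivative (\<lambda>h. gxx z * Re h + gxy z * Im h)) (at z) \<and>
           (gy has_derivative (\<lambda>h. gxy z * Re h + gyy z * Im h)) (at z) \<and>
           gxx z + gyy z = 0))"

definition harmonic_on_sphere :: "(sphere \<Rightarrow> real) \<Rightarrow> sphere set \<Rightarrow> bool" where
  "harmonic_on_sphere g U \<longleftrightarrow>
     harmonic_on_plane (g \<circ> Some) (Some -` U) \<and>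
     harmonic_on_plane (g \<circ> inv_chart) (inv_chart -` U)"

text \<open>\<open>g + log |w - a|\<close> is bounded near a finite pole \<open>a\<close>, and \<open>g - log |w|\<close> is bounded near
  infinity if the pole is there.\<close>

definition log_pole_at :: "sphere \<Rightarrow> (sphere \<Rightarrow> real) \<Rightarrow> bool" where
  "log_pole_at p g =
     (case p of
        Some a \<Rightarrow> (\<lambda>w. g (Some w) + ln (cmod (w - a))) \<in> O[at a](\<lambda>_. 1)
      | None \<Rightarrow> (\<lambda>w. g (Some w) - ln (cmod w)) \<in> O[at_infinity](\<lambda>_. 1))"

definition pos_harmonic_log_pole :: "sphere set \<Rightarrow> sphere \<Rightarrow> (sphere \<Rightarrow> real) \<Rightarrow> bool" where
  "pos_harmonic_log_pole \<Omega> p g \<longleftrightarrow>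
     harmonic_on_sphere g (\<Omega> - {p}) \<and> (\<forall>q\<in>\<Omega> - {p}. 0 < g q) \<and> log_pole_at p g"

text \<open>Green's function with pole \<open>p\<close> is the least positive harmonic function with a logarithmic
  pole at \<open>p\<close>.  The value of \<open>g\<close> at the pole itself is irrelevant.\<close>

definition is_Green_function :: "sphere set \<Rightarrow> sphere \<Rightarrow> (sphere \<Rightarrow> real) \<Rightarrow> bool" where
  "is_Green_function \<Omega> p g \<longleftrightarrow>
     openin riemann_sphere \<Omega> \<and> connectedin riemann_sphere \<Omega> \<and> p \<in> \<Omega> \<and>
     pos_harmonic_log_pole \<Omega> p g \<and>
     (\<forall>h. pos_harmonic_log_pole \<Omega> p h \<longrightarrow> (\<forall>q\<in>\<Omega> - {p}. g q \<le> h q))"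

text \<open>
  \<open>b = exp (- (g + i *g))\<close>, where the harmonic conjugate \<open>h = *g\<close> exists only locally on
  \<open>\<Omega> - {p}\<close> (it is multivalued around the pole).  The removable singularity of \<open>b\<close> at the pole
  is filled in by the value 0.  This determines \<open>b\<close> on \<open>\<Omega>\<close> up to a unimodular constant.  The function
  is required to be single-valued, as it can be on the simply connected domains considered here.
\<close>

definition is_complex_Green_function :: "sphere set \<Rightarrow> sphere \<Rightarrow> (sphere \<Rightarrow> complex) \<Rightarrow> bool" where
  "is_complex_Green_function \<Omega> p b \<longleftrightarrow>
     (\<exists>g. is_Green_function \<Omega> p g \<and> b p = 0 \<and>
        (\<forall>q\<in>\<Omega> - {p}. \<exists>U h. openin riemann_sphere U \<and> q \<in> U \<and> U \<subseteq> \<Omega> - {p} \<and>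
           holomorphic_on_sphere (\<lambda>x. Complex (g x) (h x)) U \<and>
           (\<forall>x\<in>U. b x = exp (- Complex (g x) (h x)))))"

definition arc :: "real \<Rightarrow> complex set" where
  "arc \<alpha> = {u. cmod u = 1 \<and> - \<alpha> \<le> Arg u \<and> Arg u \<le> \<alpha>}"

definition \<Omega>_arc :: "real \<Rightarrow> sphere set" where
  "\<Omega>_arc \<alpha> = UNIV - Some ` arc \<alpha>"

definition \<Omega>\<^sub>0 :: "complex set" where
  "\<Omega>\<^sub>0 = (UNIV - \<real>) \<union> of_real ` {-1<..<1}"

definition z\<^sub>0 :: "real \<Rightarrow> complex" where
  "z\<^sub>0 \<alpha> = \<i> * of_real (tan (\<alpha> / 2))"

definition u_map :: "real \<Rightarrow> complex \<Rightarrow> sphere" where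
  "u_map \<alpha> z = (if z = cnj (z\<^sub>0 \<alpha>) then None else Some ((z - z\<^sub>0 \<alpha>) / (z - cnj (z\<^sub>0 \<alpha>))))"

definition z_map :: "real \<Rightarrow> sphere \<Rightarrow> complex" where
  "z_map \<alpha> = the_inv_into \<Omega>\<^sub>0 (u_map \<alpha>)"

text \<open>The reflection \<open>u\<^sup>* = 1 / cnj u\<close> in the unit circle, exchanging 0 and infinity.\<close>

definition reflect :: "sphere \<Rightarrow> sphere" where
  "reflect p = (case p of None \<Rightarrow> Some 0
                | Some u \<Rightarrow> (if u = 0 then None else Some (1 / cnj u)))"

definition is_s_branch :: "real \<Rightarrow> (complex \<Rightarrow> complex) \<Rightarrow> bool" where
  "is_s_branch \<alpha> s \<longleftrightarrow>
     s holomorphic_on \<Omega>\<^sub>0 \<and>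
     (\<forall>z\<in>\<Omega>\<^sub>0. (s z)\<^sup>2 = ((z\<^sub>0 \<alpha>)\<^sup>2 - 1) / (z\<^sub>0 \<alpha>)\<^sup>2 * (z\<^sup>2 / (z\<^sup>2 - 1))) \<and>
     s (z\<^sub>0 \<alpha>) = 1"

definition extend_to_infinity :: "(complex \<Rightarrow> complex) \<Rightarrow> sphere \<Rightarrow> complex" where
  "extend_to_infinity f p = (case p of Some w \<Rightarrow> f w | None \<Rightarrow> Lim at_infinity f)"

definition poly_class :: "nat \<Rightarrow> real \<Rightarrow> complex poly set" where
  "poly_class n \<alpha> = {P. degree P \<le> n \<and> (\<forall>u\<in>arc \<alpha>. cmod (poly P u) \<le> 1)}"

definition is_extremal_at_infinity :: "nat \<Rightarrow> real \<Rightarrow> complex poly \<Rightarrow> bool" where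
  "is_extremal_at_infinity n \<alpha> P \<longleftrightarrow>
     P \<in> poly_class n \<alpha> \<and>
     (\<forall>Q\<in>poly_class n \<alpha>. cmod (coeff Q n) \<le> cmod (coeff P n)) \<and>
     (\<exists>c>0. coeff P n = of_real c)"

end

theory Submission
  imports Defs
begin

text \<open>
  Put \<open>T = tan (\<alpha> / 4)\<close>.  In the disc coordinate \<open>w\<close> with \<open>z = - 2 \<i> w / (1 - w\<^sup>2)\<close> the complex Green
  functions of \<open>\<Omega>_arc\<close> with poles \<open>0\<close> and \<open>\<infinity>\<close> are the Blaschke factors \<open>A = (w + T) / (1 + T w)\<close> and
  \<open>B = (w - T) / (1 - T w)\<close>, and \<open>u = A / B\<close>.  Hence \<open>G = B\<^sup>n P(u)\<close> is a form of degree \<open>n\<close> in \<open>A\<close> and \<open>B\<close>: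
  it is analytic, bounded by \<open>1\<close> on the closed disc, satisfies \<open>G(w) = (- A B)\<^sup>n G(- 1 / w)\<close>, and its
  value at \<open>w = T\<close> is the leading coefficient of \<open>P\<close> up to a factor.  The claim becomes
  \<open>G \<rightarrow> f = (1 + T w)\<^sup>2 / (2 (1 + T\<^sup>2))\<close> for the extremal \<open>P\<close>.

  The limit function satisfies \<open>|f(w)| + |f(- 1 / w)| = 1\<close> on the circle, so truncations of its
  expansion in \<open>A\<close>, symmetrized, are almost admissible trial polynomials; this bounds \<open>G(T)\<close> from below.
  For the upper bound \<open>G\<close> is integrated over the circle against \<open>e p \<Phi>\<close>, where \<open>e = A / w\<close> (\<open>phase\<close>
  below) is the conjugate of the phase of \<open>f\<close>, \<open>p\<close> (\<open>weight\<close>) is positive and \<open>\<Phi>\<close> is the Poisson kernel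
  of \<open>\<psi> = (- 1)\<^sup>n (A B)\<^bsup>n+1\<^esup> / w\<^sup>2\<close>.  The kernel concentrates where \<open>f\<close> and its symmetrization partner
  have equal phase; by the symmetry of \<open>G\<close> only two of its Fourier modes survive, and the integral
  reproduces a multiple of \<open>G(T)\<close>.  Since the two bounds agree, \<open>G e\<close> is close to \<open>1\<close> in the mean with
  respect to \<open>p \<Phi>\<close>.  Inserting a further symmetric factor with a pole at \<open>\<zeta>\<close> turns the same integral
  into \<open>G(\<zeta>) - f(\<zeta>)\<close>, which is therefore small.
\<close>

section \<open>Uniqueness of complex Green functions\<close>

text \<open>Boundedness by 1 alone allows G = 1, whereas f(T) = (1 + T^2) / 2 < 1; the deficit is
  caused by the symmetry. On the circle it says (G e)(w) = \<psi>(w) (G e)(- 1 / w), so G e can be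
  near 1 at both w and - 1 / w only where \<psi> is near 1, and the test measure must live there. A
  Poisson kernel with parameter r < 1 replaces point masses at \<psi> = 1: all integrands stay
  continuous, and r = 1 - \<open>decay n\<close> costs only an exponentially small error. Modes 0
  and -1 of \<Phi> both reproduce the mean of G e p, but only mode 0 sees p itself; this factor 2 is
  the 1/2 in f. On the circle p = 1 / |1 - T^2 w^2|^2, which is invariant under w -> - 1 / w. The
  zero of A at - T cancels one of the two poles of p in the disc, so e p has a single simple pole
  there, at T, and Cauchy's formula reads off G(T). Extremality is used only through G(T); the
  stability estimate holds for every admissible G.\<close>

lemma second_derivative_nonneg_at_min:
  fixes f f' :: "real \<Rightarrow> real"
  assumes "d > 0" and der: "\<And>t. \<bar>t\<bar> < d \<Longrightarrow> (f has_real_derivative f' t) (at t)"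
    and der2: "(f' has_real_derivative c) (at 0)"
    and min: "\<And>t. \<bar>t\<bar> < d \<Longrightarrow> f 0 \<le> f t"
  shows "0 \<le> c"
proof (rule ccontr)
  assume "\<not> 0 \<le> c"
  have "f' 0 = 0"
    using DERIV_local_min[OF der \<open>d > 0\<close>] min \<open>d > 0\<close> by auto
  moreover obtain e where e: "e > 0" "\<And>h. 0 < h \<Longrightarrow> h < e \<Longrightarrow> f' 0 > f' (0 + h)"
    using DERIV_neg_dec_right[OF der2] \<open>\<not> 0 \<le> c\<close> by (meson not_le)
  ultimately have neg: "f' h < 0" if "0 < h" "h < e" for h
    using that by auto
  define t where "t = min d e / 2"
  have t: "0 < t" "t < d" "t < e"
    using e \<open>d > 0\<close> by (auto simp: t_def min_def)
  have "\<exists>z. 0 < z \<and> z < t \<and> f t - f 0 = (t - 0) * f' z"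
    using t by (intro MVT2 der) auto
  then obtain z where "0 < z" "z < t" "f t - f 0 = t * f' z"
    by auto
  moreover have "t * f' z < 0"
    using neg[of z] t \<open>0 < z\<close> \<open>z < t\<close> by (simp add: mult_less_0_iff)
  ultimately show False
    using min[of t] t by auto
qed

lemma has_real_derivative_along_line:
  fixes f :: "complex \<Rightarrow> real" and v :: complex
  assumes "(f has_derivative (\<lambda>h. a * Re h + b * Im h)) (at (z + of_real t * v))"
  shows "((\<lambda>t. f (z + of_real t * v)) has_real_derivative a * Re v + b * Im v) (at t)"
proof -
  have "((\<lambda>t. z + of_real t * v) has_derivative (\<lambda>h. of_real h * v)) (at t)"
    by (auto intro!: derivative_eq_intros)
  from has_derivative_compose[OF this assms] show ?thesis
    unfolding has_field_derivative_def
    by (rule has_derivative_eq_rhs) (simp add: fun_eq_iff algebra_simps)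
qed

text \<open>Subtracting a small multiple of \<open>|z|\<^sup>2\<close> makes the Laplacian negative, which is impossible at a
  minimum.\<close>

lemma harmonic_minimum_principle:
  assumes "harmonic_on_plane f V" and "open V" and K: "compact {z \<in> V. f z \<le> - d}"
  shows "\<forall>z\<in>V. - d \<le> f z"
proof (rule ccontr)
  assume "\<not> (\<forall>z\<in>V. - d \<le> f z)"
  then obtain z1 where z1: "z1 \<in> V" "f z1 < - d"
    by force
  obtain gx gy gxx gxy gyy where
    der: "\<And>z. z \<in> V \<Longrightarrow> (f has_derivative (\<lambda>h. gx z * Re h + gy z * Im h)) (at z)"
         "\<And>z. z \<in> V \<Longrightarrow> (gx has_derivative (\<lambda>h. gxx z * Re h + gxy z * Im h)) (at z)"
         "\<And>z. z \<in> V \<Longrightarrow> (gy has_derivative (\<lambda>h. gxy z * Re h + gyy z * Im h)) (at z)"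
         "\<And>z. z \<in> V \<Longrightarrow> gxx z + gyy z = 0"
    using assms(1) unfolding harmonic_on_plane_def by blast
  define K where "K = {z \<in> V. f z \<le> - d}"
  have contV: "continuous_on V f"
    using der(1) \<open>open V\<close> by (meson continuous_at_imp_continuous_on has_derivative_continuous)
  then have contK: "continuous_on K f"
    by (rule continuous_on_subset) (auto simp: K_def)
  obtain M where M: "M > 0" "\<And>z. z \<in> K \<Longrightarrow> norm z \<le> M"
    using compact_imp_bounded[OF K] unfolding K_def bounded_pos by auto
  \<comment> \<open>Half of the available gap, divided by M^2: on K the perturbation changes f by
    less than - d - f z1, so the minimiser z0 of k still has f z0 < - d and is an interior point of
    K.\<close>
  define \<eta> where "\<eta> = (- d - f z1) / (2 * M\<^sup>2)"
  have \<eta>: "\<eta> > 0" "\<eta> * M\<^sup>2 < - d - f z1"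
    using z1 M by (auto simp: \<eta>_def)
  define k where "k z = f z - \<eta> * ((Re z)\<^sup>2 + (Im z)\<^sup>2)" for z
  have "continuous_on K k"
    unfolding k_def by (intro continuous_intros contK)
  then obtain z0 where z0: "z0 \<in> K" "\<And>z. z \<in> K \<Longrightarrow> k z0 \<le> k z"
    using continuous_attains_inf[of K k] K z1 unfolding K_def by force
  have "f z0 \<le> k z0 + \<eta> * M\<^sup>2"
    using M(2)[OF z0(1)] \<eta>(1) by (auto simp: k_def cmod_power2[symmetric] intro!: mult_left_mono power_mono)
  also have "k z0 \<le> k z1"
    using z0(2) z1 by (auto simp: K_def)
  also have "k z1 \<le> f z1"
    using \<eta> by (auto simp: k_def)
  finally have "f z0 < - d"
    using \<eta> by auto
  have "open {z \<in> V. f z < - d}"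
    using open_Collect_less_Int[of V] continuous_open_preimage[OF contV \<open>open V\<close>, of "{..<- d}"]
    by (auto simp: vimage_def Int_def)
  moreover have "z0 \<in> {z \<in> V. f z < - d}"
    using z0 \<open>f z0 < - d\<close> by (auto simp: K_def)
  ultimately obtain e where e: "e > 0" "ball z0 e \<subseteq> {z \<in> V. f z < - d}"
    by (meson open_contains_ball)
  have nonneg: "0 \<le> c"
    if v: "norm v = 1"
      and d1: "\<And>t. \<bar>t\<bar> < e \<Longrightarrow> ((\<lambda>t. k (z0 + of_real t * v)) has_real_derivative l t) (at t)"
      and d2: "(l has_real_derivative c) (at 0)" for v l c
  proof (rule second_derivative_nonneg_at_min[OF e(1) d1 d2])
    fix t :: real assume "\<bar>t\<bar> < e"
    then have "z0 + of_real t * v \<in> ball z0 e"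
      using v by (auto simp: dist_norm norm_mult)
    then show "k (z0 + complex_of_real 0 * v) \<le> k (z0 + complex_of_real t * v)"
      using z0(2) e by (auto simp: K_def less_imp_le subset_iff)
  qed auto
  have inV: "z0 + of_real t * v \<in> V" if "\<bar>t\<bar> < e" "norm v = 1" for t v
    using that e by (auto simp: dist_norm norm_mult subset_iff)
  have "0 \<le> gxx z0 - 2 * \<eta>"
  proof (rule nonneg[of 1 "\<lambda>t. gx (z0 + of_real t * 1) - 2 * \<eta> * (Re z0 + t)"])
    fix t :: real assume "\<bar>t\<bar> < e"
    show "((\<lambda>t. k (z0 + of_real t * 1)) has_real_derivative
        gx (z0 + of_real t * 1) - 2 * \<eta> * (Re z0 + t)) (at t)"
      unfolding k_def
      using has_real_derivative_along_line[OF der(1)[OF inV[OF \<open>\<bar>t\<bar> < e\<close>, of 1]]]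
      by (auto intro!: derivative_eq_intros simp: algebra_simps)
  next
    show "((\<lambda>t. gx (z0 + of_real t * 1) - 2 * \<eta> * (Re z0 + t)) has_real_derivative gxx z0 - 2 * \<eta>) (at 0)"
      using has_real_derivative_along_line[of gx "gxx z0" "gxy z0" z0 0 1] der(2)[of z0] z0(1)
      by (auto intro!: derivative_eq_intros simp: algebra_simps K_def)
  qed auto
  moreover have "0 \<le> gyy z0 - 2 * \<eta>"
  proof (rule nonneg[of \<i> "\<lambda>t. gy (z0 + of_real t * \<i>) - 2 * \<eta> * (Im z0 + t)"])
    fix t :: real assume "\<bar>t\<bar> < e"
    show "((\<lambda>t. k (z0 + of_real t * \<i>)) has_real_derivative
        gy (z0 + of_real t * \<i>) - 2 * \<eta> * (Im z0 + t)) (at t)"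
      unfolding k_def
      using has_real_derivative_along_line[OF der(1)[OF inV[OF \<open>\<bar>t\<bar> < e\<close>, of \<i>]]]
      by (auto intro!: derivative_eq_intros simp: algebra_simps)
  next
    show "((\<lambda>t. gy (z0 + of_real t * \<i>) - 2 * \<eta> * (Im z0 + t)) has_real_derivative gyy z0 - 2 * \<eta>) (at 0)"
      using has_real_derivative_along_line[of gy "gxy z0" "gyy z0" z0 0 \<i>] der(3)[of z0] z0(1)
      by (auto intro!: derivative_eq_intros simp: algebra_simps K_def)
  qed auto
  ultimately show False
    using der(4)[of z0] z0(1) \<eta>(1) by (auto simp: K_def)
qed

text \<open>With L = f' / f the gradient of ln |f| is (Re L, - Im L), so all second partials come
  from the holomorphic L' and their trace cancels. The factor c is carried along because the
  comparison below uses 1 - \<epsilon> and the Green function uses - 1.\<close>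

lemma harmonic_on_plane_ln_norm:
  assumes hol: "f holomorphic_on V" and V: "open V" and nz: "\<And>z. z \<in> V \<Longrightarrow> f z \<noteq> 0"
  shows "harmonic_on_plane (\<lambda>z. c * ln (cmod (f z))) V"
proof -
  define L where "L = (\<lambda>z. deriv f z / f z)"
  have holL: "L holomorphic_on V"
    unfolding L_def by (intro holomorphic_intros hol holomorphic_deriv V) (use nz in auto)
  have dL: "(L has_field_derivative deriv L z) (at z)" if "z \<in> V" for z
    using holL V that by (rule holomorphic_derivI)
  have contL: "continuous_on V (deriv L)"
    using holL V by (intro holomorphic_on_imp_continuous_on holomorphic_deriv)
  have d_ln: "((\<lambda>z. ln (cmod (f z))) has_derivative (\<lambda>h. Re (L z * h))) (at z)" if "z \<in> V" for z
  proof -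
    have df: "(f has_derivative (\<lambda>h. deriv f z * h)) (at z)"
      using holomorphic_derivI[OF hol V that] by (simp add: has_field_derivative_def)
    have "((\<lambda>z. cmod (f z)) has_derivative (\<lambda>h. (deriv f z * h) \<bullet> sgn (f z))) (at z)"
      by (rule has_derivative_compose[OF df has_derivative_norm[OF nz[OF that]]])
    then have "((\<lambda>z. ln (cmod (f z))) has_derivative (\<lambda>h. 1 / cmod (f z) * ((deriv f z * h) \<bullet> sgn (f z)))) (at z)"
      using nz[OF that] by (auto intro!: derivative_eq_intros simp: divide_inverse mult.commute)
    moreover have "1 / cmod (f z) * ((deriv f z * h) \<bullet> sgn (f z)) = Re (L z * h)" for h
    proof -
      have "1 / cmod (f z) * ((deriv f z * h) \<bullet> sgn (f z)) = ((deriv f z * h) \<bullet> f z) / (cmod (f z))\<^sup>2"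
        by (simp add: sgn_div_norm power2_eq_square divide_inverse)
      also have "\<dots> = Re ((deriv f z * h) / f z)"
        unfolding Re_divide cmod_power2 inner_complex_def by (simp add: add_divide_distrib)
      finally show ?thesis
        by (simp add: L_def)
    qed
    ultimately show ?thesis
      by (simp add: fun_eq_iff)
  qed
  have d_Re: "((\<lambda>z. c * Re (L z)) has_derivative (\<lambda>h. c * Re (deriv L z * h))) (at z)"
   and d_Im: "((\<lambda>z. - c * Im (L z)) has_derivative (\<lambda>h. - c * Im (deriv L z * h))) (at z)"
    if "z \<in> V" for z
    using dL[OF that] unfolding has_field_derivative_def
    by (auto intro!: derivative_eq_intros)
  show ?thesis
    unfolding harmonic_on_plane_def
  proof (intro exI conjI ballI)
    show "continuous_on V (\<lambda>z. c * Re (deriv L z))" "continuous_on V (\<lambda>z. - c * Im (deriv L z))"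
         "continuous_on V (\<lambda>z. - c * Re (deriv L z))"
      by (intro continuous_intros contL)+
    fix z assume "z \<in> V"
    show "((\<lambda>z. c * ln (cmod (f z))) has_derivative (\<lambda>h. c * Re (L z) * Re h + (- c * Im (L z)) * Im h)) (at z)"
      using has_derivative_mult_right[OF d_ln[OF \<open>z \<in> V\<close>], of c] by (simp add: algebra_simps)
    show "((\<lambda>z. c * Re (L z)) has_derivative (\<lambda>h. c * Re (deriv L z) * Re h + - c * Im (deriv L z) * Im h)) (at z)"
      using d_Re[OF \<open>z \<in> V\<close>] by (simp add: algebra_simps)
    show "((\<lambda>z. - c * Im (L z)) has_derivative (\<lambda>h. - c * Im (deriv L z) * Re h + - c * Re (deriv L z) * Im h)) (at z)"
      using d_Im[OF \<open>z \<in> V\<close>] by (simp add: algebra_simps)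
  qed auto
qed

lemma harmonic_on_plane_add:
  assumes "harmonic_on_plane f V" and "harmonic_on_plane g V"
  shows "harmonic_on_plane (\<lambda>z. f z + g z) V"
proof -
  obtain fx fy fxx fxy fyy where
    f: "continuous_on V fxx" "continuous_on V fxy" "continuous_on V fyy"
      "\<And>z. z \<in> V \<Longrightarrow> (f has_derivative (\<lambda>h. fx z * Re h + fy z * Im h)) (at z)"
      "\<And>z. z \<in> V \<Longrightarrow> (fx has_derivative (\<lambda>h. fxx z * Re h + fxy z * Im h)) (at z)"
      "\<And>z. z \<in> V \<Longrightarrow> (fy has_derivative (\<lambda>h. fxy z * Re h + fyy z * Im h)) (at z)"
      "\<And>z. z \<in> V \<Longrightarrow> fxx z + fyy z = 0"
    using assms(1) unfolding harmonic_on_plane_def by blast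
  obtain gx gy gxx gxy gyy where
    g: "continuous_on V gxx" "continuous_on V gxy" "continuous_on V gyy"
      "\<And>z. z \<in> V \<Longrightarrow> (g has_derivative (\<lambda>h. gx z * Re h + gy z * Im h)) (at z)"
      "\<And>z. z \<in> V \<Longrightarrow> (gx has_derivative (\<lambda>h. gxx z * Re h + gxy z * Im h)) (at z)"
      "\<And>z. z \<in> V \<Longrightarrow> (gy has_derivative (\<lambda>h. gxy z * Re h + gyy z * Im h)) (at z)"
      "\<And>z. z \<in> V \<Longrightarrow> gxx z + gyy z = 0"
    using assms(2) unfolding harmonic_on_plane_def by blast
  show ?thesis
    unfolding harmonic_on_plane_def
  proof (intro exI conjI ballI)
    show "continuous_on V (\<lambda>z. fxx z + gxx z)" "continuous_on V (\<lambda>z. fxy z + gxy z)"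
      "continuous_on V (\<lambda>z. fyy z + gyy z)"
      by (intro continuous_intros f g)+
    fix z assume z: "z \<in> V"
    show "((\<lambda>z. f z + g z) has_derivative (\<lambda>h. (fx z + gx z) * Re h + (fy z + gy z) * Im h)) (at z)"
      using has_derivative_add[OF f(4)[OF z] g(4)[OF z]] by (simp add: algebra_simps)
    show "((\<lambda>z. fx z + gx z) has_derivative (\<lambda>h. (fxx z + gxx z) * Re h + (fxy z + gxy z) * Im h)) (at z)"
      using has_derivative_add[OF f(5)[OF z] g(5)[OF z]] by (simp add: algebra_simps)
    show "((\<lambda>z. fy z + gy z) has_derivative (\<lambda>h. (fxy z + gxy z) * Re h + (fyy z + gyy z) * Im h)) (at z)"
      using has_derivative_add[OF f(6)[OF z] g(6)[OF z]] by (simp add: algebra_simps)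
    show "fxx z + gxx z + (fyy z + gyy z) = 0"
      using f(7)[OF z] g(7)[OF z] by simp
  qed
qed

text \<open>Minimum principle for h + (1 - \<epsilon>) ln |\<beta>|: near the pole the surplus -
  \<epsilon> ln |\<beta>| outweighs the bound M, and towards the boundary, where |\<beta>| tends to
  1, positivity of h suffices. It supplies the inequality opposite to leastness of the Green
  function.\<close>

lemma positive_harmonic_ge_minus_ln:
  assumes harm: "harmonic_on_plane h V" and V: "open V"
    and hol: "\<beta> holomorphic_on V"
    and \<beta>: "\<And>z. z \<in> V \<Longrightarrow> 0 < cmod (\<beta> z)"
    and pos: "\<And>z. z \<in> V \<Longrightarrow> 0 < h z"
    and comp: "\<And>c c'. 0 < c \<Longrightarrow> c' < 1 \<Longrightarrow> compact {z \<in> V. c \<le> cmod (\<beta> z) \<and> cmod (\<beta> z) \<le> c'}"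
    and near: "0 < c0" "\<And>z. z \<in> V \<Longrightarrow> cmod (\<beta> z) < c0 \<Longrightarrow> - M \<le> h z + ln (cmod (\<beta> z))"
    and z: "z \<in> V"
  shows "- ln (cmod (\<beta> z)) \<le> h z"
proof -
  have key: "- d \<le> h z + (1 - \<epsilon>) * ln (cmod (\<beta> z))" if \<epsilon>: "0 < \<epsilon>" "\<epsilon> < 1" and d: "0 < d" for \<epsilon> d
  proof -
    define f where "f z = h z + (1 - \<epsilon>) * ln (cmod (\<beta> z))" for z
    have harm_f: "harmonic_on_plane f V"
      unfolding f_def using \<beta> by (intro harmonic_on_plane_add harm harmonic_on_plane_ln_norm hol V) auto
    have cont: "continuous_on V f"
      using harm_f V unfolding harmonic_on_plane_def
      by (meson continuous_at_imp_continuous_on has_derivative_continuous)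
    \<comment> \<open>Below exp (- max M 0 / \<epsilon>) the surplus - \<epsilon> ln |\<beta>|
      exceeds M, and below c0 the bound at the pole applies, so f > 0 where |\<beta>| < c. Where
      |\<beta>| > exp (- d), the logarithmic term alone is above - d.\<close>
    define c where "c = min c0 (exp (- (max M 0 / \<epsilon>)))"
    define K where "K = {z \<in> V. c \<le> cmod (\<beta> z) \<and> cmod (\<beta> z) \<le> exp (- d)}"
    have K: "compact K"
      unfolding K_def using d near(1) by (intro comp) (auto simp: c_def)
    have sub: "z \<in> K" if z: "z \<in> V" "f z \<le> - d" for z
    proof -
      have "cmod (\<beta> z) \<le> exp (- d)"
      proof (rule ccontr)
        assume "\<not> cmod (\<beta> z) \<le> exp (- d)"
        then have "- d < ln (cmod (\<beta> z))"
          by (metis \<beta> z(1) exp_less_cancel_iff exp_ln not_le)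
        moreover have "(1 - \<epsilon>) * (- d) \<ge> - d"
          using \<epsilon> d by (simp add: algebra_simps)
        moreover have "(1 - \<epsilon>) * (- d) \<le> (1 - \<epsilon>) * ln (cmod (\<beta> z))"
          using \<epsilon> \<open>- d < ln (cmod (\<beta> z))\<close> by (intro mult_left_mono) auto
        ultimately show False
          using z(2) pos[OF z(1)] unfolding f_def by linarith
      qed
      moreover have "c \<le> cmod (\<beta> z)"
      proof (rule ccontr)
        assume "\<not> c \<le> cmod (\<beta> z)"
        then have "cmod (\<beta> z) < c0" and less: "cmod (\<beta> z) < exp (- (max M 0 / \<epsilon>))"
          by (auto simp: c_def)
        then have "- M \<le> h z + ln (cmod (\<beta> z))"
          using near z by auto
        moreover have "ln (cmod (\<beta> z)) < - (max M 0 / \<epsilon>)"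
          using less \<beta>[OF z(1)] by (metis exp_less_cancel_iff exp_ln)
        then have "\<epsilon> * ln (cmod (\<beta> z)) < \<epsilon> * (- (max M 0 / \<epsilon>))"
          using \<epsilon>(1) by (intro mult_strict_left_mono) auto
        then have "\<epsilon> * ln (cmod (\<beta> z)) < - max M 0"
          using \<epsilon> by simp
        ultimately have "f z > 0"
          by (simp add: f_def algebra_simps max_def split: if_splits)
        then show False
          using z d by auto
      qed
      ultimately show ?thesis
        using z by (auto simp: K_def)
    qed
    have "{z \<in> V. f z \<le> - d} = {z \<in> K. f z \<le> - d}"
      using sub by (auto simp: K_def)
    moreover have "compact (K \<inter> f -` {.. - d})"
    proof -
      have "closed (K \<inter> f -` {.. - d})"
        using K cont by (intro continuous_closed_preimage compact_imp_closed closed_atMost)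
          (auto simp: K_def elim!: continuous_on_subset)
      then show ?thesis
        using K compact_Int_closed[OF K] by (metis Int_left_absorb)
    qed
    ultimately have "compact {z \<in> V. f z \<le> - d}"
      by (simp add: vimage_def Int_def)
    from harmonic_minimum_principle[OF harm_f V this] z show ?thesis
      by (auto simp: f_def)
  qed
  \<comment> \<open>Both \<epsilon> and d are set to t, which tends to 0 from the right.\<close>
  have "((\<lambda>t. h z + (1 - t) * ln (cmod (\<beta> z)) + t) \<longlongrightarrow> h z + (1 - 0) * ln (cmod (\<beta> z)) + 0) (at_right (0::real))"
    by (intro tendsto_intros)
  moreover have "\<forall>\<^sub>F t in at_right (0::real). 0 \<le> h z + (1 - t) * ln (cmod (\<beta> z)) + t"
    using eventually_at_right_real[of 0 1]
  proof (rule eventually_mono)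
    fix t :: real assume "t \<in> {0<..<1}"
    then show "0 \<le> h z + (1 - t) * ln (cmod (\<beta> z)) + t"
      using key[of t t] by simp
  qed simp
  ultimately have "0 \<le> h z + (1 - 0) * ln (cmod (\<beta> z)) + 0"
    by (intro tendsto_lowerbound) auto
  then show ?thesis
    by simp
qed

lemma harmonic_on_plane_cong:
  assumes "harmonic_on_plane f V" and "open V" and eq: "\<And>w. w \<in> V \<Longrightarrow> f' w = f w"
  shows "harmonic_on_plane f' V"
proof -
  have "(f' has_derivative D) (at z)" if "z \<in> V" "(f has_derivative D) (at z)" for z D
    using has_derivative_transform_within_open[OF that(2) \<open>open V\<close> that(1)] eq by metis
  then show ?thesis
    using assms(1) unfolding harmonic_on_plane_def by blast
qed

definition pole_filter :: "sphere \<Rightarrow> complex filter" where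
  "pole_filter p = (case p of Some a \<Rightarrow> at a | None \<Rightarrow> at_infinity)"

lemma log_pole_at_diff_bounded:
  assumes "log_pole_at p g" and "log_pole_at p h"
  shows "\<exists>M. eventually (\<lambda>w. \<bar>g (Some w) - h (Some w)\<bar> \<le> M) (pole_filter p)"
proof -
  have "(\<lambda>w. g (Some w) - h (Some w)) \<in> O[pole_filter p](\<lambda>_. 1)"
  proof (cases p)
    case None
    with assms sum_in_bigo(2)[of "\<lambda>w. g (Some w) - ln (cmod w)" _ _ "\<lambda>w. h (Some w) - ln (cmod w)"]
    show ?thesis by (simp add: log_pole_at_def pole_filter_def)
  next
    case (Some a)
    with assms sum_in_bigo(2)[of "\<lambda>w. g (Some w) + ln (cmod (w - a))" _ _ "\<lambda>w. h (Some w) + ln (cmod (w - a))"]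
    show ?thesis by (simp add: log_pole_at_def pole_filter_def)
  qed
  then show ?thesis
    by (elim landau_o.bigE) auto
qed

text \<open>Leastness gives g <= - ln |\<beta>| and the comparison lemma the reverse, so |b| =
  |\<beta>|; then b / \<beta> is holomorphic of modulus 1, hence constant on the connected set V.
  The hypothesis \<open>comp\<close> expresses that |\<beta>| tends to 1 at the boundary, and
  \<open>near\<close> that \<beta> is small only close to the pole.\<close>

lemma complex_Green_function_eq:
  fixes \<beta> :: "complex \<Rightarrow> complex"
  assumes b: "is_complex_Green_function \<Omega> p b"
    and V_def: "V = {z. Some z \<in> \<Omega> - {p}}" and None: "None \<notin> \<Omega> - {p}"
    and V: "open V" "connected V"
    and hol: "\<beta> holomorphic_on V"
    and \<beta>: "\<And>z. z \<in> V \<Longrightarrow> \<beta> z \<noteq> 0" "\<And>z. z \<in> V \<Longrightarrow> cmod (\<beta> z) < 1"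
    and comp: "\<And>c c'. 0 < c \<Longrightarrow> c' < 1 \<Longrightarrow> compact {z \<in> V. c \<le> cmod (\<beta> z) \<and> cmod (\<beta> z) \<le> c'}"
    and pole: "log_pole_at p (\<lambda>q. case q of Some z \<Rightarrow> - ln (cmod (\<beta> z)) | None \<Rightarrow> 0)"
    and near: "\<And>N. eventually N (pole_filter p) \<Longrightarrow> \<exists>c>0. \<forall>z\<in>V. cmod (\<beta> z) < c \<longrightarrow> N z"
  obtains c where "cmod c = 1" "\<And>z. z \<in> V \<Longrightarrow> b (Some z) = c * \<beta> z"
proof -
  obtain g where g: "is_Green_function \<Omega> p g" and
    loc: "\<And>q. q \<in> \<Omega> - {p} \<Longrightarrow> \<exists>U h. openin riemann_sphere U \<and> q \<in> U \<and> U \<subseteq> \<Omega> - {p} \<and>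
           holomorphic_on_sphere (\<lambda>x. Complex (g x) (h x)) U \<and>
           (\<forall>x\<in>U. b x = exp (- Complex (g x) (h x)))"
    using b unfolding is_complex_Green_function_def by blast
  define g0 :: "sphere \<Rightarrow> real" where "g0 = (\<lambda>q. case q of Some z \<Rightarrow> - ln (cmod (\<beta> z)) | None \<Rightarrow> 0)"
  have "harmonic_on_plane (g0 \<circ> inv_chart) (inv_chart -` (\<Omega> - {p}))"
  proof -
    define V' where "V' = inv_chart -` (\<Omega> - {p})"
    \<comment> \<open>The centre 0 of the chart at infinity is missing from V', because infinity is
      not in \<Omega> - {p}; on V' the chart is plain inversion.\<close>
    have V': "w \<noteq> 0 \<and> inverse w \<in> V" if "w \<in> V'" for w
      using that None by (auto simp: V'_def V_def inv_chart_def split: if_splits)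
    have V'': "V' = (- {0}) \<inter> inverse -` V"
      using None by (auto simp: V'_def V_def inv_chart_def split: if_splits)
    have "open V'"
      unfolding V'' by (intro continuous_open_preimage continuous_intros) (auto simp: V)
    have "(\<beta> \<circ> inverse) holomorphic_on V'"
      by (rule holomorphic_on_compose[OF _ holomorphic_on_subset[OF hol]])
         (use V' in \<open>auto intro!: holomorphic_intros\<close>)
    moreover have "(\<beta> \<circ> inverse) w \<noteq> 0" if "w \<in> V'" for w
      using V'[OF that] \<beta>(1) by simp
    ultimately have "harmonic_on_plane (\<lambda>w. (-1) * ln (cmod ((\<beta> \<circ> inverse) w))) V'"
      using harmonic_on_plane_ln_norm[OF _ \<open>open V'\<close>] by blast
    moreover have "(g0 \<circ> inv_chart) w = (-1) * ln (cmod ((\<beta> \<circ> inverse) w))" if "w \<in> V'" for w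
      using V'[OF that] by (simp add: g0_def inv_chart_def)
    ultimately show ?thesis
      unfolding V'_def[symmetric] using harmonic_on_plane_cong[OF _ \<open>open V'\<close>] by blast
  qed
  moreover have "harmonic_on_plane (g0 \<circ> Some) V"
    using harmonic_on_plane_ln_norm[OF hol V(1) \<beta>(1), of "-1"] by (simp add: g0_def o_def)
  moreover have "0 < g0 q" if "q \<in> \<Omega> - {p}" for q
  proof -
    obtain z where "q = Some z" "z \<in> V"
      by (metis V_def None mem_Collect_eq not_Some_eq \<open>q \<in> \<Omega> - {p}\<close>)
    then show ?thesis
      using \<beta>[of z] by (simp add: g0_def)
  qed
  ultimately have "pos_harmonic_log_pole \<Omega> p g0"
    using pole by (auto simp: pos_harmonic_log_pole_def harmonic_on_sphere_def V_def g0_def vimage_def)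
  with g have le: "g q \<le> g0 q" if "q \<in> \<Omega> - {p}" for q
    using that unfolding is_Green_function_def by blast
  have "pos_harmonic_log_pole \<Omega> p g"
    using g by (simp add: is_Green_function_def)
  then have harm: "harmonic_on_plane (\<lambda>z. g (Some z)) V" and pos: "\<And>z. z \<in> V \<Longrightarrow> 0 < g (Some z)"
    and lp: "log_pole_at p g"
    by (auto simp: pos_harmonic_log_pole_def harmonic_on_sphere_def V_def o_def vimage_def)
  obtain M where "eventually (\<lambda>w. \<bar>g (Some w) - g0 (Some w)\<bar> \<le> M) (pole_filter p)"
    using log_pole_at_diff_bounded[OF lp pole] by (auto simp: g0_def)
  from near[OF this] obtain c0 where c0: "c0 > 0"
    "\<And>z. z \<in> V \<Longrightarrow> cmod (\<beta> z) < c0 \<Longrightarrow> - M \<le> g (Some z) + ln (cmod (\<beta> z))"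
    by (fastforce simp: g0_def)
  have "- ln (cmod (\<beta> z)) \<le> g (Some z)" if "z \<in> V" for z
    using positive_harmonic_ge_minus_ln[OF harm V(1) hol _ pos comp c0 that] \<beta> by simp
  with le have g_eq: "g (Some z) = - ln (cmod (\<beta> z))" if "z \<in> V" for z
    using that by (force simp: V_def g0_def)
  define f where "f z = b (Some z) / \<beta> z" for z
  have norm_f: "cmod (f z) = 1" if "z \<in> V" for z
  proof -
    obtain h where "b (Some z) = exp (- Complex (g (Some z)) h)"
      using loc[of "Some z"] \<open>z \<in> V\<close> by (auto simp: V_def)
    then show ?thesis
      using \<beta>[OF that] by (simp add: f_def norm_divide g_eq[OF that])
  qed
  have "f holomorphic_on V"
  proof -
    have "f field_differentiable at z" if z: "z \<in> V" for z
    proof -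
      obtain U h where U: "openin riemann_sphere U" "Some z \<in> U" "U \<subseteq> \<Omega> - {p}"
        "holomorphic_on_sphere (\<lambda>x. Complex (g x) (h x)) U"
        "\<And>x. x \<in> U \<Longrightarrow> b x = exp (- Complex (g x) (h x))"
        using loc[of "Some z"] z by (auto simp: V_def)
      define U' where "U' = {w. Some w \<in> U}"
      have "open U'"
        using openin_continuous_map_preimage[OF continuous_map_Some U(1)[unfolded riemann_sphere_def]]
        by (simp add: U'_def)
      have "U' \<subseteq> V"
        using U(3) by (auto simp: U'_def V_def)
      have "(\<lambda>w. Complex (g (Some w)) (h (Some w))) holomorphic_on U'"
        using U(4) by (simp add: holomorphic_on_sphere_def U'_def o_def vimage_def)
      then have "(\<lambda>w. exp (- Complex (g (Some w)) (h (Some w))) / \<beta> w) holomorphic_on U'"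
        using \<beta> \<open>U' \<subseteq> V\<close> by (intro holomorphic_intros holomorphic_on_subset[OF hol]) auto
      then have "f holomorphic_on U'"
        by (rule holomorphic_transform) (auto simp: f_def U'_def U(5))
      then show ?thesis
        using \<open>open U'\<close> U(2) by (auto simp: U'_def intro: holomorphic_on_imp_differentiable_at)
    qed
    then show ?thesis
      unfolding holomorphic_on_def by (blast intro: field_differentiable_at_within)
  qed
  have "f constant_on V"
  proof (cases "V = {}")
    case False
    then obtain z where "z \<in> V" by auto
    then show ?thesis
      using maximum_modulus_principle[OF \<open>f holomorphic_on V\<close> V V(1) order_refl \<open>z \<in> V\<close>] norm_f by auto
  qed (auto simp: constant_on_def)
  then obtain c where c: "\<And>z. z \<in> V \<Longrightarrow> f z = c"
    by (auto simp: constant_on_def)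
  show ?thesis
  proof (cases "V = {}")
    case True
    then show ?thesis using that[of 1] by auto
  next
    case False
    then have "cmod c = 1"
      using norm_f c by auto
    with c \<beta>(1) show ?thesis
      by (intro that[of c]) (auto simp: f_def field_simps)
  qed
qed

section \<open>Mean values over the unit circle\<close>

text \<open>Starting the parametrization at \<open>\<i>\<close> turns the reflection
  \<open>w \<mapsto> - 1 / w\<close> of the circle into \<open>t \<mapsto> 1 - t\<close>.\<close>

definition circle_mean :: "(complex \<Rightarrow> complex) \<Rightarrow> complex" where
  "circle_mean f = integral {0..1} (\<lambda>t. f (\<i> * circlepath 0 1 t))"

lemma circlepath_on_circle: "cmod (\<i> * circlepath 0 1 t) = 1"
  by (simp add: circlepath norm_mult)

lemma continuous_on_circle_compose:
  assumes "continuous_on (sphere 0 1) f"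
  shows "continuous_on {0..1} (\<lambda>t. f (\<i> * circlepath 0 1 t))"
proof (rule continuous_on_compose2[OF assms])
  show "continuous_on {0..1} (\<lambda>t. \<i> * circlepath 0 1 t)"
    by (auto simp: circlepath intro!: continuous_intros)
qed (simp add: circlepath_on_circle image_subset_iff)

lemma integrable_on_circle:
  fixes f :: "complex \<Rightarrow> 'a::banach"
  assumes "continuous_on (sphere 0 1) f"
  shows "(\<lambda>t. f (\<i> * circlepath 0 1 t)) integrable_on {0..1}"
  using continuous_on_circle_compose[OF assms] by (rule integrable_continuous_real)

lemma circle_mean_cong:
  assumes "\<And>w. cmod w = 1 \<Longrightarrow> f w = g w"
  shows "circle_mean f = circle_mean g"
  unfolding circle_mean_def using assms circlepath_on_circle by (metis (mono_tags))

lemma circle_mean_add: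
  assumes "continuous_on (sphere 0 1) f" and "continuous_on (sphere 0 1) g"
  shows "circle_mean (\<lambda>w. f w + g w) = circle_mean f + circle_mean g"
  unfolding circle_mean_def by (intro Henstock_Kurzweil_Integration.integral_add integrable_on_circle assms)

lemma circle_mean_diff:
  assumes "continuous_on (sphere 0 1) f" and "continuous_on (sphere 0 1) g"
  shows "circle_mean (\<lambda>w. f w - g w) = circle_mean f - circle_mean g"
  unfolding circle_mean_def by (intro Henstock_Kurzweil_Integration.integral_diff integrable_on_circle assms)

lemma circle_mean_cmult: "circle_mean (\<lambda>w. c * f w) = c * circle_mean f"
  unfolding circle_mean_def by simp

lemma circle_mean_norm_le:
  assumes "continuous_on (sphere 0 1) f" and "continuous_on (sphere 0 1) g"
    and "\<And>w. cmod w = 1 \<Longrightarrow> cmod (f w) \<le> Re (g w)"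
  shows "cmod (circle_mean f) \<le> Re (circle_mean g)"
proof -
  have "cmod (circle_mean f) \<le> integral {0..1} (\<lambda>t. Re (g (\<i> * circlepath 0 1 t)))"
    unfolding circle_mean_def
    by (intro integral_norm_bound_integral integrable_on_circle continuous_intros assms circlepath_on_circle)
  also have "\<dots> = Re (circle_mean g)"
    unfolding circle_mean_def
    using integral_linear[OF integrable_on_circle[OF assms(2)] bounded_linear_Re] by (simp add: o_def)
  finally show ?thesis .
qed

lemma circle_mean_minus_inverse:
  assumes "continuous_on (sphere 0 1) f"
  shows "circle_mean (\<lambda>w. f (- 1 / w)) = circle_mean f"
proof -
  have "- 1 / (\<i> * circlepath 0 1 t) = \<i> * circlepath 0 1 (1 - t)" for t
  proof -
    have "circlepath 0 1 (1 - t) = inverse (circlepath 0 1 t)"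
      by (simp add: circlepath algebra_simps exp_diff exp_minus divide_inverse)
    then show ?thesis
      by (simp add: divide_inverse)
  qed
  then have "circle_mean (\<lambda>w. f (- 1 / w)) = integral {0..1} (\<lambda>t. f (\<i> * circlepath 0 1 (1 - t)))"
    unfolding circle_mean_def by simp
  also have "\<dots> = integral {0..1} (\<lambda>t. f (\<i> * circlepath 0 1 t))"
    using has_integral_affinity[of "\<lambda>t. f (\<i> * circlepath 0 1 t)" _ 0 1 "-1" 1]
      integrable_integral[OF integrable_on_circle[OF assms]]
    by (intro integral_unique) simp
  finally show ?thesis
    by (simp add: circle_mean_def)
qed

text \<open>The argument \<i> * z reflects the starting point \<i> of the parametrization; the
  factor 1 / z turns dz into a constant multiple of dt.\<close>

lemma circle_mean_eq_contour_integral: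
  "circle_mean f = contour_integral (circlepath 0 1) (\<lambda>z. f (\<i> * z) / z) / (2 * of_real pi * \<i>)"
proof -
  have "contour_integral (circlepath 0 1) (\<lambda>z. f (\<i> * z) / z) =
      integral {0..1} (\<lambda>t. (2 * of_real pi * \<i>) * f (\<i> * circlepath 0 1 t))"
    unfolding contour_integral_integral
    by (intro integral_cong) (auto simp: vector_derivative_circlepath, simp add: circlepath)
  then show ?thesis
    by (simp add: circle_mean_def)
qed

text \<open>Since dw = 2 pi \<i> w dt, the Cauchy kernel relative to normalised arc length is w / (w
  - \<zeta>).\<close>

lemma circle_mean_Cauchy:
  assumes "continuous_on (cball 0 1) f" and "f holomorphic_on ball 0 1" and \<zeta>: "cmod \<zeta> < 1"
  shows "circle_mean (\<lambda>w. f w * (w / (w - \<zeta>))) = f \<zeta>"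
proof -
  have "((\<lambda>u. f (\<i> * u) / (u - (- \<i> * \<zeta>))) has_contour_integral
      (2 * of_real pi * \<i> * f (\<i> * (- \<i> * \<zeta>)))) (circlepath 0 1)"
  proof (rule Cauchy_integral_circlepath)
    show "continuous_on (cball 0 1) (\<lambda>u. f (\<i> * u))"
      by (rule continuous_on_compose2[OF assms(1)]) (auto intro!: continuous_intros simp: norm_mult)
    show "(\<lambda>u. f (\<i> * u)) holomorphic_on ball 0 1"
      by (rule holomorphic_on_compose_gen[of "\<lambda>u. \<i> * u" _ f "ball 0 1", unfolded o_def])
         (auto intro!: holomorphic_intros assms simp: norm_mult)
  qed (use \<zeta> in \<open>simp add: norm_mult\<close>)
  moreover have "f (\<i> * u) * (\<i> * u / (\<i> * u - \<zeta>)) / u = f (\<i> * u) / (u - (- \<i> * \<zeta>))"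
    if "u \<in> path_image (circlepath 0 1)" for u
  proof -
    have "cmod u = 1"
      using that by simp
    then have "u \<noteq> 0" "u \<noteq> - \<i> * \<zeta>"
      using \<zeta> by (auto simp: norm_mult)
    moreover have "\<i> * u - \<zeta> = \<i> * (u - (- \<i> * \<zeta>))"
      by (simp add: algebra_simps)
    ultimately show ?thesis
      by (simp add: divide_simps)
  qed
  ultimately show ?thesis
    unfolding circle_mean_eq_contour_integral
    by (subst contour_integral_cong[OF refl]) (auto simp: contour_integral_unique)
qed

text \<open>The linear homotopy moves each point along its radius and so stays in the
  annulus.\<close>

lemma contour_integral_concentric_circlepaths:
  assumes "f holomorphic_on S" and "open S" and "0 < \<rho>" "\<rho> \<le> 1"
    and S: "\<And>w. \<rho> \<le> cmod w \<Longrightarrow> cmod w \<le> 1 \<Longrightarrow> w \<in> S"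
  shows "contour_integral (circlepath 0 \<rho>) f = contour_integral (circlepath 0 1) f"
proof (rule Cauchy_theorem_homotopic_loops[OF _ assms(2,1)])
  show "homotopic_loops S (circlepath 0 \<rho>) (circlepath 0 1)"
  proof (rule homotopic_loops_linear)
    fix t :: real assume "t \<in> {0..1}"
    show "closed_segment (circlepath 0 \<rho> t) (circlepath 0 1 t) \<subseteq> S"
    proof
      fix x assume "x \<in> closed_segment (circlepath 0 \<rho> t) (circlepath 0 1 t)"
      then obtain u where u: "0 \<le> u" "u \<le> 1"
        "x = (1 - u) *\<^sub>R circlepath 0 \<rho> t + u *\<^sub>R circlepath 0 1 t"
        by (auto simp: closed_segment_def)
      then have "x = of_real ((1 - u) * \<rho> + u) * exp (2 * of_real pi * \<i> * of_real t)"
        by (simp add: circlepath scaleR_conv_of_real algebra_simps)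
      moreover have "0 \<le> (1 - u) * \<rho> + u"
        using u \<open>0 < \<rho>\<close> by simp
      ultimately have "cmod x = (1 - u) * \<rho> + u"
        by (simp add: norm_mult del: of_real_add of_real_mult of_real_diff)
      moreover have "\<rho> \<le> (1 - u) * \<rho> + u" "(1 - u) * \<rho> + u \<le> 1"
        using mult_nonneg_nonneg[of u "1 - \<rho>"] mult_nonneg_nonneg[of "1 - u" "1 - \<rho>"] u assms(4)
        by (auto simp: algebra_simps)
      ultimately have "\<rho> \<le> cmod x \<and> cmod x \<le> 1"
        by argo
      then show "x \<in> S"
        using S by blast
    qed
  qed auto
qed auto

text \<open>The mean over a circle about 0 does not depend on the radius as long as f is holomorphic
  in between. It is used for integrands that are of moderate size on the unit circle but
  exponentially small on the inner one.\<close>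

lemma circle_mean_contour_shift:
  assumes "f holomorphic_on S" and "open S" and \<rho>: "0 < \<rho>" "\<rho> \<le> 1"
    and S: "\<And>w. \<rho> \<le> cmod w \<Longrightarrow> cmod w \<le> 1 \<Longrightarrow> w \<in> S"
    and M: "\<And>w. cmod w = \<rho> \<Longrightarrow> cmod (f w) \<le> M"
  shows "cmod (circle_mean f) \<le> M"
proof -
  define S' where "S' = (\<lambda>z. \<i> * z) -` S \<inter> - {0}"
  have "open S'"
    unfolding S'_def by (intro open_Int open_vimage assms continuous_intros)
  have hol: "(\<lambda>z. f (\<i> * z) / z) holomorphic_on S'"
    by (intro holomorphic_intros holomorphic_on_compose_gen[of "\<lambda>u. \<i> * u" _ f S, unfolded o_def] assms)
       (auto simp: S'_def)
  have "cmod (f (\<i> * of_real \<rho>)) \<le> M"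
    using \<rho> by (intro M) (simp add: norm_mult)
  then have "0 \<le> M"
    using norm_ge_zero order_trans by blast
  have eq: "contour_integral (circlepath 0 \<rho>) (\<lambda>z. f (\<i> * z) / z) =
      contour_integral (circlepath 0 1) (\<lambda>z. f (\<i> * z) / z)"
    using \<rho> by (intro contour_integral_concentric_circlepaths[OF hol \<open>open S'\<close>])
      (auto simp: S'_def norm_mult intro!: S)
  have "cmod (contour_integral (circlepath 0 \<rho>) (\<lambda>z. f (\<i> * z) / z)) \<le> (M / \<rho>) * (2 * pi * \<rho>)"
  proof (rule has_contour_integral_bound_circlepath[OF has_contour_integral_integral])
    have "path_image (circlepath 0 \<rho>) \<subseteq> S'"
      using \<rho> by (auto simp: S'_def norm_mult intro!: S)
    then show "(\<lambda>z. f (\<i> * z) / z) contour_integrable_on circlepath 0 \<rho>"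
      using hol \<open>open S'\<close> by (intro contour_integrable_holomorphic_simple) auto
    show "cmod (f (\<i> * x) / x) \<le> M / \<rho>" if "cmod (x - 0) = \<rho>" for x
      using that \<rho> M[of "\<i> * x"] by (simp add: norm_divide norm_mult divide_right_mono)
  qed (use \<rho> \<open>0 \<le> M\<close> in auto)
  then have "cmod (contour_integral (circlepath 0 1) (\<lambda>z. f (\<i> * z) / z)) \<le> 2 * pi * M"
    using \<rho> unfolding eq by (simp add: mult.commute)
  then show ?thesis
    unfolding circle_mean_eq_contour_integral by (simp add: norm_divide norm_mult field_simps)
qed

section \<open>The disc coordinate\<close>

definition blaschke :: "complex \<Rightarrow> complex \<Rightarrow> complex" where
  "blaschke a w = (w - a) / (1 - cnj a * w)"

lemma blaschke_denominator_nonzero: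
  assumes "cmod a * cmod w < 1"
  shows "1 - cnj a * w \<noteq> 0"
proof
  assume "1 - cnj a * w = 0"
  then have "cmod (cnj a * w) = 1"
    by simp
  with assms show False
    by (simp add: norm_mult)
qed

lemma blaschke_norm_identity:
  "(cmod (1 - cnj a * w))\<^sup>2 - (cmod (w - a))\<^sup>2 = (1 - (cmod a)\<^sup>2) * (1 - (cmod w)\<^sup>2)"
  unfolding cmod_power2 by (simp add: power2_eq_square algebra_simps)

lemma norm_blaschke_less_1:
  assumes "cmod a < 1" and "cmod w < 1"
  shows "cmod (blaschke a w) < 1"
proof -
  have "0 < (1 - (cmod a)\<^sup>2) * (1 - (cmod w)\<^sup>2)"
    using assms by (intro mult_pos_pos) (auto simp: power_less_one_iff abs_square_less_1)
  then have "(cmod (w - a))\<^sup>2 < (cmod (1 - cnj a * w))\<^sup>2"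
    using blaschke_norm_identity[of a w] by linarith
  then have "cmod (w - a) < cmod (1 - cnj a * w)"
    by (rule power2_less_imp_less) simp
  then show ?thesis
    by (simp add: blaschke_def norm_divide divide_less_eq_1)
qed

lemma norm_blaschke_eq_1:
  assumes "cmod a < 1" and "cmod w = 1"
  shows "cmod (blaschke a w) = 1"
proof -
  have "1 - cnj a * w \<noteq> 0"
    using assms by (intro blaschke_denominator_nonzero) simp
  moreover have "cmod (w - a) = cmod (1 - cnj a * w)"
    using blaschke_norm_identity[of a w] assms by (simp add: power2_eq_iff_nonneg)
  ultimately show ?thesis
    by (simp add: blaschke_def norm_divide)
qed

lemma norm_blaschke_le_1:
  assumes "cmod a < 1" and "cmod w \<le> 1"
  shows "cmod (blaschke a w) \<le> 1"
  using norm_blaschke_less_1[OF assms(1)] norm_blaschke_eq_1[OF assms(1)] assms(2)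
  by (metis less_eq_real_def)

text \<open>The two fractions are the sums of r^k x^k and of r^k x^(-k) over k >= 1. They are kept
  apart because, for x = \<psi>, the first continues holomorphically to where |\<psi>| <= 1 and the
  second is its image under w -> - 1 / w.\<close>

lemma Poisson_kernel_expansion:
  assumes "cmod x = 1" and "0 \<le> r" and "r < 1"
  shows "1 + of_real r * x / (1 - of_real r * x) + of_real r / (x - of_real r)
    = complex_of_real ((1 - r\<^sup>2) / (cmod (1 - of_real r * x))\<^sup>2)"
    and "1 - of_real r * x \<noteq> 0" and "x - of_real r \<noteq> 0"
proof -
  have "cmod (of_real r * x) \<noteq> cmod 1" "cmod x \<noteq> cmod (of_real r)"
    using assms by (auto simp: norm_mult)
  then show nz: "1 - of_real r * x \<noteq> 0" "x - of_real r \<noteq> 0"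
    by auto
  have x: "x * cnj x = 1"
    using assms by (metis complex_norm_square of_real_1 power_one)
  then have "x \<noteq> 0"
    by auto
  have "complex_of_real ((cmod (1 - of_real r * x))\<^sup>2) = (1 - of_real r * x) * (1 - of_real r * cnj x)"
    by (subst complex_norm_square) simp
  also have "1 - of_real r * cnj x = (x - of_real r) / x"
    using x \<open>x \<noteq> 0\<close> by (simp add: field_simps)
  finally have "complex_of_real ((1 - r\<^sup>2) / (cmod (1 - of_real r * x))\<^sup>2)
      = (1 - (of_real r)\<^sup>2) * x / ((1 - of_real r * x) * (x - of_real r))"
    by simp
  also have "\<dots> = 1 + of_real r * x / (1 - of_real r * x) + of_real r / (x - of_real r)"
    using nz by (simp add: divide_simps) (simp add: algebra_simps power2_eq_square)
  finally show "1 + of_real r * x / (1 - of_real r * x) + of_real r / (x - of_real r)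
    = complex_of_real ((1 - r\<^sup>2) / (cmod (1 - of_real r * x))\<^sup>2)" ..
qed

text \<open>|x - 1|^2 <= 2 (1 - Re x), followed by the inequality of arithmetic and geometric means.
  The right side is affine in Re x, so it can be integrated: a small mean of 1 - Re x controls the
  mean of |x - 1|.\<close>

lemma norm_diff_1_le:
  assumes "cmod x \<le> 1" and "0 < \<epsilon>"
  shows "cmod (x - 1) \<le> \<epsilon> / 2 + (1 - Re x) / \<epsilon>"
proof -
  have "(cmod x)\<^sup>2 \<le> 1"
    using assms by (simp add: power_le_one)
  then have "(cmod (x - 1))\<^sup>2 \<le> 2 * (1 - Re x)"
    unfolding cmod_power2 by (simp add: power2_eq_square algebra_simps)
  moreover have "0 \<le> (cmod (x - 1) - \<epsilon>)\<^sup>2"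
    by simp
  ultimately have "2 * cmod (x - 1) * \<epsilon> \<le> \<epsilon>\<^sup>2 + 2 * (1 - Re x)"
    by (simp add: power2_eq_square algebra_simps)
  then show ?thesis
    using assms by (simp add: field_simps power2_eq_square)
qed

locale disc_param =
  fixes T :: real
  assumes T: "0 < T" "T < 1"
begin

abbreviation "\<tau> \<equiv> complex_of_real T"

definition bA :: "complex \<Rightarrow> complex" where
  "bA w = (w + \<tau>) / (1 + \<tau> * w)"

definition bB :: "complex \<Rightarrow> complex" where
  "bB w = (w - \<tau>) / (1 - \<tau> * w)"

definition lim_fun :: "complex \<Rightarrow> complex" where
  "lim_fun w = (1 + \<tau> * w)\<^sup>2 / (2 * (1 + \<tau>\<^sup>2))"

text \<open>Equal to 1 / |1 - \<tau>^2 w^2|^2 on the circle, but written as a rational function so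
  that contours can be moved inwards.\<close>

definition weight :: "complex \<Rightarrow> complex" where
  "weight w = w\<^sup>2 / ((w\<^sup>2 - \<tau>\<^sup>2) * (1 - \<tau>\<^sup>2 * w\<^sup>2))"

definition phase :: "complex \<Rightarrow> complex" where
  "phase w = bA w / w"

text \<open>For admissible G this is the quotient of G \<open>phase\<close> at w and at - 1 / w on
  the circle. The reflection law of G contributes (- A B)^n, the two phases contribute A B /
  w^2.\<close>

definition \<psi> :: "nat \<Rightarrow> complex \<Rightarrow> complex" where
  "\<psi> n w = (-1) ^ n * (bA w * bB w) ^ Suc n / w\<^sup>2"

lemma bA_blaschke: "bA = blaschke (- \<tau>)" and bB_blaschke: "bB = blaschke \<tau>"
  by (auto simp: bA_def bB_def blaschke_def fun_eq_iff)

lemma denominators: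
  assumes "cmod w < 1 / T"
  shows "1 + \<tau> * w \<noteq> 0" "1 - \<tau> * w \<noteq> 0" "1 - \<tau>\<^sup>2 * w\<^sup>2 \<noteq> 0"
proof -
  have "T * cmod w < 1"
    using assms T by (simp add: field_simps)
  then show *: "1 + \<tau> * w \<noteq> 0" "1 - \<tau> * w \<noteq> 0"
    using blaschke_denominator_nonzero[of "- \<tau>" w] blaschke_denominator_nonzero[of "\<tau>" w] T by auto
  have "1 - \<tau>\<^sup>2 * w\<^sup>2 = (1 + \<tau> * w) * (1 - \<tau> * w)"
    by (simp add: power2_eq_square algebra_simps)
  with * show "1 - \<tau>\<^sup>2 * w\<^sup>2 \<noteq> 0"
    by auto
qed

lemma less_inverse_T: "cmod w \<le> 1 \<Longrightarrow> cmod w < 1 / T"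
  by (rule le_less_trans[of _ 1]) (use T in simp_all)

lemmas denominators_disc = denominators[OF less_inverse_T]

lemma T_power_bounds: "0 < 1 + T\<^sup>2" "0 < 1 - T\<^sup>2" "0 < 1 - T ^ 4" "0 < (1 + T\<^sup>2) * (1 - T ^ 4)"
proof -
  show *: "0 < 1 + T\<^sup>2" "0 < 1 - T\<^sup>2" "0 < 1 - T ^ 4"
    using T power_less_one_iff[of T 2] power_less_one_iff[of T 4] by (auto intro: add_pos_nonneg)
  then show "0 < (1 + T\<^sup>2) * (1 - T ^ 4)"
    by simp
qed

lemma one_plus_T_square_nonzero: "1 + \<tau>\<^sup>2 \<noteq> 0" "1 - \<tau>\<^sup>2 \<noteq> 0" "1 - \<tau> ^ 4 \<noteq> 0"
proof -
  have "1 + \<tau>\<^sup>2 = of_real (1 + T\<^sup>2)" "1 - \<tau>\<^sup>2 = of_real (1 - T\<^sup>2)" "1 - \<tau> ^ 4 = of_real (1 - T ^ 4)"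
    by simp_all
  then show "1 + \<tau>\<^sup>2 \<noteq> 0" "1 - \<tau>\<^sup>2 \<noteq> 0" "1 - \<tau> ^ 4 \<noteq> 0"
    using T_power_bounds(1-3) by (metis less_numeral_extra(3) of_real_eq_0_iff)+
qed

lemma lim_fun_\<tau>: "2 * lim_fun \<tau> = 1 + \<tau>\<^sup>2"
  using one_plus_T_square_nonzero(1)
  by (simp add: lim_fun_def power2_eq_square[of \<tau>] power2_eq_square[of "_ + _"] del: distrib_left_numeral distrib_right_numeral)

lemma norm_b_circle:
  assumes "cmod w = 1"
  shows "cmod (bA w) = 1" "cmod (bB w) = 1"
  using assms T by (auto simp: bA_blaschke bB_blaschke norm_blaschke_eq_1)

lemma norm_b_disc:
  assumes "cmod w \<le> 1"
  shows "cmod (bA w) \<le> 1" "cmod (bB w) \<le> 1"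
  using assms T by (auto simp: bA_blaschke bB_blaschke norm_blaschke_le_1)

lemma circle_nonzero:
  assumes "cmod w = 1"
  shows "w \<noteq> 0" "w - \<tau> \<noteq> 0" "w + \<tau> \<noteq> 0" "w\<^sup>2 - \<tau>\<^sup>2 \<noteq> 0"
proof -
  have "w \<noteq> 0"
    using assms by auto
  moreover have "bA w \<noteq> 0" "bB w \<noteq> 0"
    using norm_b_circle[OF assms] by auto
  moreover have "w\<^sup>2 - \<tau>\<^sup>2 = (w - \<tau>) * (w + \<tau>)"
    by (simp add: power2_eq_square algebra_simps)
  ultimately show "w \<noteq> 0" "w - \<tau> \<noteq> 0" "w + \<tau> \<noteq> 0" "w\<^sup>2 - \<tau>\<^sup>2 \<noteq> 0"
    by (auto simp: bA_def bB_def)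
qed

lemma reflection_b:
  assumes "w \<noteq> 0"
  shows "bA (- 1 / w) = - 1 / bB w" "bB (- 1 / w) = - 1 / bA w"
proof -
  have 1: "- 1 / w + \<tau> = - (1 - \<tau> * w) / w" "1 + \<tau> * (- 1 / w) = (w - \<tau>) / w"
       "- 1 / w - \<tau> = - (1 + \<tau> * w) / w" "1 - \<tau> * (- 1 / w) = (w + \<tau>) / w"
    using assms by (simp_all add: field_simps)
  show "bA (- 1 / w) = - 1 / bB w" "bB (- 1 / w) = - 1 / bA w"
    unfolding bA_def bB_def 1 using assms by (simp_all add: minus_divide_left)
qed

lemma reflection_\<psi>:
  assumes "w \<noteq> 0"
  shows "\<psi> n (- 1 / w) = 1 / \<psi> n w"
proof -
  have "bA (- 1 / w) * bB (- 1 / w) = 1 / (bA w * bB w)"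
    unfolding reflection_b[OF assms] by simp
  then show ?thesis
    using assms by (cases "even n") (simp_all add: \<psi>_def power_divide power2_eq_square)
qed

lemma reflection_weight:
  assumes "w \<noteq> 0"
  shows "weight (- 1 / w) = weight w"
proof -
  have "(- 1 / w)\<^sup>2 - \<tau>\<^sup>2 = (1 - \<tau>\<^sup>2 * w\<^sup>2) / w\<^sup>2" "1 - \<tau>\<^sup>2 * (- 1 / w)\<^sup>2 = (w\<^sup>2 - \<tau>\<^sup>2) / w\<^sup>2"
    using assms by (simp_all add: field_simps)
  then show ?thesis
    unfolding weight_def using assms by (simp add: power2_eq_square mult.commute)
qed

lemma weight_circle:
  assumes "cmod w = 1"
  shows "weight w = of_real (1 / (cmod (1 - \<tau>\<^sup>2 * w\<^sup>2))\<^sup>2)"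
proof -
  have w: "w * cnj w = 1"
    using assms by (metis complex_norm_square of_real_1 power_one)
  then have w2: "w\<^sup>2 * (cnj w)\<^sup>2 = 1"
    by (metis power_mult_distrib power_one)
  have "complex_of_real ((cmod (1 - \<tau>\<^sup>2 * w\<^sup>2))\<^sup>2) = (1 - \<tau>\<^sup>2 * w\<^sup>2) * (1 - \<tau>\<^sup>2 * (cnj w)\<^sup>2)"
    by (subst complex_norm_square) simp
  also have "1 - \<tau>\<^sup>2 * (cnj w)\<^sup>2 = (w\<^sup>2 - \<tau>\<^sup>2) / w\<^sup>2"
    using circle_nonzero[OF assms] w2 by (simp add: field_simps)
  finally show ?thesis
    by (simp add: weight_def mult.commute)
qed

lemma norm_\<psi>_circle: "cmod w = 1 \<Longrightarrow> cmod (\<psi> n w) = 1"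
  by (simp add: \<psi>_def norm_mult norm_divide norm_power norm_b_circle)

lemma norm_phase_circle: "cmod w = 1 \<Longrightarrow> cmod (phase w) = 1"
  by (simp add: phase_def norm_divide norm_b_circle)

lemma holomorphic_b:
  "bA holomorphic_on ball 0 (1 / T)" "bB holomorphic_on ball 0 (1 / T)"
  unfolding bA_def bB_def by (intro holomorphic_intros; use denominators in auto)+

lemma continuous_on_circle:
  "continuous_on (sphere 0 1) bA" "continuous_on (sphere 0 1) bB" "continuous_on (sphere 0 1) weight"
  "continuous_on (sphere 0 1) phase" "continuous_on (sphere 0 1) (\<psi> n)"
proof -
  show *: "continuous_on (sphere 0 1) bA" "continuous_on (sphere 0 1) bB"
    unfolding bA_def bB_def by (intro continuous_intros; use denominators_disc in auto)+
  show "continuous_on (sphere 0 1) weight" "continuous_on (sphere 0 1) phase" "continuous_on (sphere 0 1) (\<psi> n)"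
    unfolding weight_def phase_def \<psi>_def
    by (intro continuous_intros *; use denominators_disc circle_nonzero in auto)+
qed

text \<open>What the dual argument retains of B^n P(A / B); the degree of P survives only as the
  exponent in the reflection law. The radius 1 / T is the modulus of the poles of A and B.\<close>

definition admissible :: "nat \<Rightarrow> (complex \<Rightarrow> complex) \<Rightarrow> bool" where
  "admissible n G \<longleftrightarrow> G holomorphic_on ball 0 (1 / T) \<and> (\<forall>w. cmod w \<le> 1 \<longrightarrow> cmod (G w) \<le> 1) \<and>
     (\<forall>w. cmod w = 1 \<longrightarrow> G w = (-1) ^ n * (bA w * bB w) ^ n * G (- 1 / w))"

end

section \<open>The dual extremal kernel\<close>

text \<open>Contours are moved to |w| = \<rho>, which lies between the poles T and - T of
  \<open>weight\<close> and the unit circle. In the application q < 1, so that \<open>decay\<close>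
  tends to 0.\<close>

locale disc_annulus = disc_param +
  fixes \<rho> q :: real
  assumes \<rho>: "T < \<rho>" "\<rho> < 1"
    and q: "0 < q" "\<And>w. cmod w = \<rho> \<Longrightarrow> cmod (bA w * bB w) \<le> q"
begin

definition decay :: "nat \<Rightarrow> real" where
  "decay n = q ^ Suc n / \<rho>\<^sup>2"

lemma \<rho>_pos: "0 < \<rho>"
  using \<rho> T by simp

lemma decay_pos: "0 < decay n"
  using q \<rho> T by (simp add: decay_def)

lemma norm_\<psi>_inner:
  assumes "cmod w = \<rho>"
  shows "cmod (\<psi> n w) \<le> decay n"
proof -
  have "cmod (bA w * bB w) ^ Suc n \<le> q ^ Suc n"
    using q(2)[OF assms] by (intro power_mono) auto
  then show ?thesis
    unfolding \<psi>_def decay_def norm_divide norm_mult[of "(-1) ^ n"] norm_power assms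
    by (simp add: divide_right_mono)
qed

lemma holomorphic_\<psi>: "\<psi> n holomorphic_on ball 0 (1 / T) - {0}"
  unfolding \<psi>_def
  by (intro holomorphic_intros holomorphic_on_subset[OF holomorphic_b(1)]
      holomorphic_on_subset[OF holomorphic_b(2)]) auto

text \<open>The pole of \<psi> at 0 rules out the disc, so the maximum principle is applied on the
  annulus, with boundary values of modulus 1 outside and at most \<open>decay n\<close>
  inside.\<close>

lemma norm_\<psi>_annulus:
  assumes "decay n \<le> 1" and "\<rho> \<le> cmod w" "cmod w \<le> 1"
  shows "cmod (\<psi> n w) \<le> 1"
proof (rule maximum_modulus_frontier[where f = "\<psi> n"])
  let ?S = "cball 0 1 - ball 0 \<rho> :: complex set"
  have sub: "?S \<subseteq> ball 0 (1 / T) - {0}"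
    using \<rho>_pos less_inverse_T by auto
  have closed: "closed ?S"
    by (intro closed_Diff) auto
  show "\<psi> n holomorphic_on interior ?S"
    using sub interior_subset by (blast intro: holomorphic_on_subset[OF holomorphic_\<psi>])
  show "continuous_on (closure ?S) (\<psi> n)"
    using sub closed
    by (auto intro!: continuous_on_subset[OF holomorphic_on_imp_continuous_on[OF holomorphic_\<psi>]])
  show "cmod (\<psi> n z) \<le> 1" if "z \<in> frontier ?S" for z
  proof -
    have z: "z \<in> ?S" "z \<notin> interior ?S"
      using that closed by (auto simp: frontier_def)
    have "ball 0 1 - cball 0 \<rho> \<subseteq> interior ?S"
      by (intro interior_maximal) (auto intro!: open_Diff)
    with z(2) have "z \<notin> ball 0 1 - cball 0 \<rho>"
      by blast
    with z(1) have "cmod z = 1 \<or> cmod z = \<rho>"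
      by auto
    then show ?thesis
      using norm_\<psi>_inner[of z n] norm_\<psi>_circle[of z n] assms(1) by auto
  qed
  show "bounded ?S"
    by (rule bounded_subset[OF bounded_cball]) auto
  show "w \<in> ?S"
    using assms by auto
qed

text \<open>As |r \<psi>| < 1 on the whole closed annulus, the contour can be moved to |w| = \<rho>,
  where all positive powers of \<psi> are small. The factor 2 comes from |1 - r \<psi>| >= 1 / 2
  there.\<close>

lemma circle_mean_tail:
  assumes hol: "f holomorphic_on S" "open S"
    and S: "\<And>w. \<rho> \<le> cmod w \<Longrightarrow> cmod w \<le> 1 \<Longrightarrow> w \<in> S"
    and M: "\<And>w. cmod w = \<rho> \<Longrightarrow> cmod (f w) \<le> M"
    and r: "0 \<le> r" "r < 1" and decay: "decay n \<le> 1 / 2"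
  shows "cmod (circle_mean (\<lambda>w. f w * (of_real r * \<psi> n w / (1 - of_real r * \<psi> n w)))) \<le> 2 * M * decay n"
proof -
  define D where "D = ball (0::complex) (1 / T) - {0}"
  define S' where "S' = S \<inter> (D \<inter> (\<lambda>w. of_real r * \<psi> n w) -` ball 0 1)"
  have contD: "continuous_on D (\<lambda>w. of_real r * \<psi> n w)"
    unfolding D_def by (intro continuous_intros holomorphic_on_imp_continuous_on holomorphic_\<psi>)
  have "open D"
    unfolding D_def by (intro open_Diff) auto
  then have "open S'"
    unfolding S'_def using hol(2) contD by (intro open_Int continuous_open_preimage) auto
  have lt: "cmod (of_real r * \<psi> n w) < 1" if "\<rho> \<le> cmod w" "cmod w \<le> 1" for w
  proof -
    have "cmod (of_real r * \<psi> n w) \<le> r * 1"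
      unfolding norm_mult using norm_\<psi>_annulus[of n, OF _ that] decay r by (intro mult_mono) auto
    with r show ?thesis by simp
  qed
  show ?thesis
  proof (rule circle_mean_contour_shift[OF _ \<open>open S'\<close> \<rho>_pos])
    have "1 - of_real r * \<psi> n w \<noteq> 0" if "w \<in> S'" for w
      using that by (auto simp: S'_def)
    then show "(\<lambda>w. f w * (of_real r * \<psi> n w / (1 - of_real r * \<psi> n w))) holomorphic_on S'"
      by (intro holomorphic_intros holomorphic_on_subset[OF hol(1)] holomorphic_on_subset[OF holomorphic_\<psi>])
         (auto simp: S'_def D_def)
    show "w \<in> S'" if "\<rho> \<le> cmod w" "cmod w \<le> 1" for w
      using that S[OF that] lt[OF that] \<rho>_pos less_inverse_T by (auto simp: S'_def D_def)
    fix w assume w: "cmod w = \<rho>"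
    have "cmod (of_real r * \<psi> n w) \<le> 1 * decay n"
      unfolding norm_mult using norm_\<psi>_inner[OF w] r by (intro mult_mono) auto
    then have 1: "cmod (of_real r * \<psi> n w) \<le> decay n"
      by simp
    have "1 - decay n \<le> cmod (1 - of_real r * \<psi> n w)"
      using norm_triangle_ineq2[of 1 "of_real r * \<psi> n w"] 1 by simp
    then have 2: "1 / 2 \<le> cmod (1 - of_real r * \<psi> n w)"
      using decay by simp
    have "cmod (of_real r * \<psi> n w / (1 - of_real r * \<psi> n w)) \<le> decay n / (1 / 2)"
      unfolding norm_divide using 1 2 less_imp_le[OF decay_pos] by (intro frac_le) auto
    moreover have "0 \<le> M"
      using M[OF w] norm_ge_zero order_trans by blast
    ultimately have "cmod (f w) * cmod (of_real r * \<psi> n w / (1 - of_real r * \<psi> n w)) \<le> M * (decay n / (1 / 2))"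
      using M[OF w] by (intro mult_mono) auto
    then show "cmod (f w * (of_real r * \<psi> n w / (1 - of_real r * \<psi> n w))) \<le> 2 * M * decay n"
      unfolding norm_mult[of "f w"] by (simp only: mult.assoc mult.commute mult.left_commute) simp
  qed (use \<rho> in auto)
qed

section \<open>Means against the Poisson kernel of \<psi>\<close>

definition \<Phi> :: "nat \<Rightarrow> real \<Rightarrow> complex \<Rightarrow> complex" where
  "\<Phi> n r w = 1 + of_real r * \<psi> n w / (1 - of_real r * \<psi> n w) + of_real r / (\<psi> n w - of_real r)"

lemma \<Phi>_circle:
  assumes "cmod w = 1" "0 \<le> r" "r < 1"
  shows "\<Phi> n r w = of_real ((1 - r\<^sup>2) / (cmod (1 - of_real r * \<psi> n w))\<^sup>2)"
    "1 - of_real r * \<psi> n w \<noteq> 0" "\<psi> n w - of_real r \<noteq> 0"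
  using Poisson_kernel_expansion[OF norm_\<psi>_circle[OF assms(1)] assms(2,3)] by (auto simp: \<Phi>_def)

lemma continuous_on_kernels:
  assumes "0 \<le> r" "r < 1"
  shows "continuous_on (sphere 0 1) (\<lambda>w. of_real r * \<psi> n w / (1 - of_real r * \<psi> n w))"
    and "continuous_on (sphere 0 1) (\<lambda>w. of_real r / (\<psi> n w - of_real r))"
    and "continuous_on (sphere 0 1) (\<Phi> n r)"
proof -
  show *: "continuous_on (sphere 0 1) (\<lambda>w. of_real r * \<psi> n w / (1 - of_real r * \<psi> n w))"
    "continuous_on (sphere 0 1) (\<lambda>w. of_real r / (\<psi> n w - of_real r))"
    using \<Phi>_circle(2,3)[OF _ assms] by (auto intro!: continuous_intros continuous_on_circle)
  show "continuous_on (sphere 0 1) (\<Phi> n r)"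
    unfolding \<Phi>_def by (intro continuous_intros *)
qed

text \<open>Since \<psi>(- 1 / w) = 1 / \<psi>(w), reflection exchanges positive and negative modes.
  In the second identity the modes k >= 0, with a factor r, become \<psi> times the negative modes;
  this is the shift by one that the reflection law of G compensates.\<close>

lemma reflection_kernel:
  assumes "cmod w = 1" "0 \<le> r" "r < 1"
  shows "of_real r * \<psi> n (- 1 / w) / (1 - of_real r * \<psi> n (- 1 / w)) = of_real r / (\<psi> n w - of_real r)"
    and "of_real r / (1 - of_real r * \<psi> n (- 1 / w)) = of_real r * \<psi> n w / (\<psi> n w - of_real r)"
proof -
  have *: "\<psi> n (- 1 / w) = 1 / \<psi> n w" "\<psi> n w \<noteq> 0"
    using reflection_\<psi>[of w n] circle_nonzero[OF assms(1)] norm_\<psi>_circle[OF assms(1), of n] by auto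
  have "1 - of_real r * (1 / \<psi> n w) = (\<psi> n w - of_real r) / \<psi> n w"
    using *(2) by (simp add: field_simps)
  then show "of_real r * \<psi> n (- 1 / w) / (1 - of_real r * \<psi> n (- 1 / w)) = of_real r / (\<psi> n w - of_real r)"
    "of_real r / (1 - of_real r * \<psi> n (- 1 / w)) = of_real r * \<psi> n w / (\<psi> n w - of_real r)"
    unfolding *(1) using *(2) \<Phi>_circle(3)[OF assms, of n] by simp_all
qed

text \<open>The numerator is \<rho> and not \<rho>^2 so that the bound also covers
  \<open>phase\<close> times \<open>weight\<close>, where |\<open>phase\<close>| <= 1 /
  \<rho>.\<close>

definition weight_bound :: real where
  "weight_bound = \<rho> / ((\<rho>\<^sup>2 - T\<^sup>2) * (1 - T\<^sup>2))"

lemma \<rho>_T_bounds: "0 < \<rho>\<^sup>2 - T\<^sup>2" "0 < 1 - T\<^sup>2" "0 < weight_bound"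
proof -
  show *: "0 < \<rho>\<^sup>2 - T\<^sup>2" "0 < 1 - T\<^sup>2"
    using \<rho> T power_strict_mono[of T \<rho> 2] power_less_one_iff[of T 2] by auto
  then show "0 < weight_bound"
    using \<rho>_pos by (simp add: weight_bound_def)
qed

lemma norm_weight_inner:
  assumes "cmod w = \<rho>"
  shows "cmod (weight w) \<le> weight_bound" "cmod (phase w * weight w) \<le> weight_bound"
proof -
  have "\<rho>\<^sup>2 - T\<^sup>2 \<le> cmod (w\<^sup>2 - \<tau>\<^sup>2)"
    using norm_triangle_ineq2[of "w\<^sup>2" "\<tau>\<^sup>2"] assms T by (simp add: norm_power)
  moreover have "1 - T\<^sup>2 \<le> cmod (1 - \<tau>\<^sup>2 * w\<^sup>2)"
  proof -
    have "cmod (\<tau>\<^sup>2 * w\<^sup>2) \<le> T\<^sup>2 * 1"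
      unfolding norm_mult norm_power assms using \<rho> \<rho>_pos T by (intro mult_mono) (auto simp: power_le_one)
    then show ?thesis
      using norm_triangle_ineq2[of 1 "\<tau>\<^sup>2 * w\<^sup>2"] by simp
  qed
  ultimately have "(\<rho>\<^sup>2 - T\<^sup>2) * (1 - T\<^sup>2) \<le> cmod ((w\<^sup>2 - \<tau>\<^sup>2) * (1 - \<tau>\<^sup>2 * w\<^sup>2))"
    unfolding norm_mult[of "w\<^sup>2 - \<tau>\<^sup>2"] using \<rho>_T_bounds by (intro mult_mono) auto
  then have "cmod (weight w) \<le> \<rho>\<^sup>2 / ((\<rho>\<^sup>2 - T\<^sup>2) * (1 - T\<^sup>2))"
    unfolding weight_def norm_divide norm_power assms
    by (intro frac_le mult_pos_pos \<rho>_T_bounds) simp_all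
  also have "\<dots> = \<rho> * weight_bound"
    by (simp add: weight_bound_def power2_eq_square)
  finally have *: "cmod (weight w) \<le> \<rho> * weight_bound" .
  also have "\<rho> * weight_bound \<le> 1 * weight_bound"
    using \<rho> \<rho>_T_bounds by (intro mult_right_mono) auto
  finally show "cmod (weight w) \<le> weight_bound"
    by simp
  have "cmod (phase w) \<le> 1 / \<rho>"
    unfolding phase_def norm_divide assms using norm_b_disc[of w] assms \<rho> \<rho>_pos by (intro divide_right_mono) auto
  then have "cmod (phase w) * cmod (weight w) \<le> 1 / \<rho> * (\<rho> * weight_bound)"
    using * \<rho>_pos by (intro mult_mono) auto
  then show "cmod (phase w * weight w) \<le> weight_bound"
    using \<rho>_pos by (simp add: norm_mult)
qed

definition weight_domain :: "complex set" where
  "weight_domain = ball (0::complex) (1 / T) - cball 0 T"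

lemma open_weight_domain: "open weight_domain"
  unfolding weight_domain_def by (intro open_Diff) auto

lemma annulus_subset_weight_domain: "\<rho> \<le> cmod w \<Longrightarrow> cmod w \<le> 1 \<Longrightarrow> w \<in> weight_domain"
  unfolding weight_domain_def using \<rho> less_inverse_T by auto

lemma holomorphic_weight_phase:
  "weight holomorphic_on weight_domain" "phase holomorphic_on weight_domain"
proof -
  have nz: "w \<noteq> 0" "w\<^sup>2 - \<tau>\<^sup>2 \<noteq> 0" if "w \<in> weight_domain" for w
  proof -
    have "T < cmod w"
      using that by (auto simp: weight_domain_def)
    then have "w \<noteq> \<tau>" "w \<noteq> - \<tau>" "w \<noteq> 0"
      using T by auto
    moreover have "w\<^sup>2 - \<tau>\<^sup>2 = (w - \<tau>) * (w + \<tau>)"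
      by (simp add: power2_eq_square algebra_simps)
    ultimately show "w \<noteq> 0" "w\<^sup>2 - \<tau>\<^sup>2 \<noteq> 0"
      by (auto simp: add_eq_0_iff2)
  qed
  have den: "1 - \<tau>\<^sup>2 * w\<^sup>2 \<noteq> 0" if "w \<in> weight_domain" for w
    using that denominators by (auto simp: weight_domain_def)
  show "weight holomorphic_on weight_domain"
    unfolding weight_def using nz den by (intro holomorphic_intros) auto
  show "phase holomorphic_on weight_domain"
    unfolding phase_def using nz
    by (intro holomorphic_intros holomorphic_on_subset[OF holomorphic_b(1)]) (auto simp: weight_domain_def)
qed


text \<open>Extra factors that keep the method intact: holomorphy near the closed annulus for moving
  the contour, invariance under w -> - 1 / w for exchanging the modes. The constant 1 tests
  G(\<tau>), a factor with a pole at \<zeta> tests G(\<zeta>).\<close>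

definition symmetric_weight :: "real \<Rightarrow> (complex \<Rightarrow> complex) \<Rightarrow> bool" where
  "symmetric_weight Y y \<longleftrightarrow>
  (\<exists>S. open S \<and> y holomorphic_on S \<and> (\<forall>w. \<rho> \<le> cmod w \<longrightarrow> cmod w \<le> 1 \<longrightarrow> w \<in> S)) \<and>
  (\<forall>w. cmod w = 1 \<longrightarrow> y (- 1 / w) = y w) \<and>
  (\<forall>w. \<rho> \<le> cmod w \<longrightarrow> cmod w \<le> 1 \<longrightarrow> cmod (y w) \<le> Y)"

lemma continuous_on_symmetric_weight:
  assumes "symmetric_weight Y y"
  shows "continuous_on (sphere 0 1) y"
proof -
  obtain S where "y holomorphic_on S" "\<And>w. \<rho> \<le> cmod w \<Longrightarrow> cmod w \<le> 1 \<Longrightarrow> w \<in> S"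
    using assms unfolding symmetric_weight_def by blast
  then show ?thesis
    using \<rho> by (intro continuous_on_subset[OF holomorphic_on_imp_continuous_on]) auto
qed

text \<open>Mode 0 is the mean without \<Phi>. Reflection makes the two tails equal, and each is
  bounded by \<open>circle_mean_tail\<close>, whence 4 = 2 * 2.\<close>

lemma circle_mean_weight_\<Phi>:
  assumes y: "symmetric_weight Y y" and r: "0 \<le> r" "r < 1" and decay: "decay n \<le> 1 / 2"
  shows "cmod (circle_mean (\<lambda>w. weight w * y w * \<Phi> n r w) - circle_mean (\<lambda>w. weight w * y w)) \<le> 4 * (weight_bound * Y) * decay n"
proof -
  obtain S where S: "open S" "y holomorphic_on S" "\<And>w. \<rho> \<le> cmod w \<Longrightarrow> cmod w \<le> 1 \<Longrightarrow> w \<in> S"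
    using y unfolding symmetric_weight_def by blast
  have sym: "y (- 1 / w) = y w" if "cmod w = 1" for w
    using y that unfolding symmetric_weight_def by blast
  have yb: "cmod (y w) \<le> Y" if "cmod w = \<rho>" for w
    using y that \<rho> unfolding symmetric_weight_def by force
  note conts = continuous_on_symmetric_weight[OF y] continuous_on_circle continuous_on_kernels[OF r]
  define H where "H = (\<lambda>w. of_real r * \<psi> n w / (1 - of_real r * \<psi> n w))"
  define H' where "H' = (\<lambda>w. of_real r / (\<psi> n w - of_real r))"
  have cH: "continuous_on (sphere 0 1) H" "continuous_on (sphere 0 1) H'"
    unfolding H_def H'_def by (intro conts)+
  have "circle_mean (\<lambda>w. weight w * y w * \<Phi> n r w)
      = circle_mean (\<lambda>w. (weight w * y w + weight w * y w * H w) + weight w * y w * H' w)"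
    unfolding \<Phi>_def H_def H'_def by (simp add: algebra_simps)
  also have "\<dots> = circle_mean (\<lambda>w. weight w * y w) + circle_mean (\<lambda>w. weight w * y w * H w)
      + circle_mean (\<lambda>w. weight w * y w * H' w)"
    by (subst circle_mean_add circle_mean_add; (intro continuous_intros conts cH)?)+ simp
  also have "circle_mean (\<lambda>w. weight w * y w * H' w) = circle_mean (\<lambda>w. (\<lambda>w. weight w * y w * H w) (- 1 / w))"
  proof (rule circle_mean_cong)
    fix w :: complex assume w: "cmod w = 1"
    show "weight w * y w * H' w = weight (- 1 / w) * y (- 1 / w) * H (- 1 / w)"
      unfolding H_def H'_def reflection_kernel(1)[OF w r] sym[OF w] reflection_weight[OF circle_nonzero(1)[OF w]] ..
  qed
  also have "\<dots> = circle_mean (\<lambda>w. weight w * y w * H w)"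
    by (intro circle_mean_minus_inverse continuous_intros conts cH)
  finally have "cmod (circle_mean (\<lambda>w. weight w * y w * \<Phi> n r w) - circle_mean (\<lambda>w. weight w * y w))
      = 2 * cmod (circle_mean (\<lambda>w. weight w * y w * H w))"
    by (simp add: norm_mult flip: mult_2)
  also have "cmod (circle_mean (\<lambda>w. weight w * y w * H w)) \<le> 2 * (weight_bound * Y) * decay n"
    unfolding H_def
  proof (rule circle_mean_tail[where S = "S \<inter> weight_domain", OF _ _ _ _ r decay])
    show "(\<lambda>w. weight w * y w) holomorphic_on S \<inter> weight_domain"
      by (intro holomorphic_intros holomorphic_on_subset[OF S(2)] holomorphic_on_subset[OF holomorphic_weight_phase(1)]) auto
    show "cmod (weight w * y w) \<le> weight_bound * Y" if "cmod w = \<rho>" for w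
      unfolding norm_mult using norm_weight_inner[OF that] yb[OF that] \<rho>_T_bounds by (intro mult_mono) auto
  qed (use S open_weight_domain annulus_subset_weight_domain in auto)
  finally show ?thesis
    by simp
qed

lemma admissible_reflection:
  assumes G: "admissible n G" and w: "cmod w = 1"
  shows "G (- 1 / w) * phase (- 1 / w) * \<psi> n w = G w * phase w"
proof -
  have nz: "w \<noteq> 0" "bA w \<noteq> 0" "bB w \<noteq> 0"
    using circle_nonzero[OF w] norm_b_circle[OF w] by auto
  have "phase (- 1 / w) = w / bB w"
    unfolding phase_def reflection_b[OF nz(1)] using nz by simp
  then have "G (- 1 / w) * phase (- 1 / w) * \<psi> n w = ((-1) ^ n * (bA w * bB w) ^ n * G (- 1 / w)) * (bA w / w)"
    using nz by (simp add: \<psi>_def power2_eq_square)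
  also have "\<dots> = G w * (bA w / w)"
    using G w unfolding admissible_def by metis
  finally show ?thesis
    by (simp add: phase_def)
qed

lemma admissible_continuous:
  assumes "admissible n G"
  shows "continuous_on (cball 0 1) G" "continuous_on (sphere 0 1) G" "G holomorphic_on ball 0 1"
proof -
  have "G holomorphic_on ball 0 (1 / T)"
    using assms by (simp add: admissible_def)
  moreover have "cball 0 1 \<subseteq> ball (0::complex) (1 / T)"
    using less_inverse_T by auto
  ultimately show "continuous_on (cball 0 1) G" "continuous_on (sphere 0 1) G" "G holomorphic_on ball 0 1"
    by (meson holomorphic_on_imp_continuous_on continuous_on_subset sphere_cball holomorphic_on_subset ball_subset_cball)+
qed

lemma admissible_norm: "admissible n G \<Longrightarrow> cmod w \<le> 1 \<Longrightarrow> cmod (G w) \<le> 1"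
  by (simp add: admissible_def)

text \<open>By the reflection symmetry of \<open>G\<close> the Fourier modes \<open>\<psi>\<^sup>0\<close> and \<open>\<psi>\<^sup>-\<^sup>1\<close> of the Poisson kernel
  contribute the same amount, and all other modes are exponentially small.\<close>

lemma circle_mean_admissible_\<Phi>:
  assumes G: "admissible n G" and y: "symmetric_weight Y y" and r: "0 \<le> r" "r < 1" and decay: "decay n \<le> 1 / 2"
  shows "cmod (circle_mean (\<lambda>w. G w * phase w * weight w * y w * \<Phi> n r w)
      - (1 + of_real r) * circle_mean (\<lambda>w. G w * phase w * weight w * y w)) \<le> 4 * (weight_bound * Y) * decay n"
proof -
  obtain S where S: "open S" "y holomorphic_on S" "\<And>w. \<rho> \<le> cmod w \<Longrightarrow> cmod w \<le> 1 \<Longrightarrow> w \<in> S"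
    using y unfolding symmetric_weight_def by blast
  have sym: "y (- 1 / w) = y w" if "cmod w = 1" for w
    using y that unfolding symmetric_weight_def by blast
  have yb: "cmod (y w) \<le> Y" if "cmod w = \<rho>" for w
    using y that \<rho> unfolding symmetric_weight_def by force
  have holG: "G holomorphic_on ball 0 (1 / T)"
    using G by (simp add: admissible_def)
  note conts = continuous_on_symmetric_weight[OF y] continuous_on_circle continuous_on_kernels[OF r]
    admissible_continuous(2)[OF G]
  define g where "g = (\<lambda>w. G w * phase w * weight w * y w)"
  define H where "H = (\<lambda>w. of_real r * \<psi> n w / (1 - of_real r * \<psi> n w))"
  define H' where "H' = (\<lambda>w. of_real r / (\<psi> n w - of_real r))"
  have cont: "continuous_on (sphere 0 1) H" "continuous_on (sphere 0 1) H'" "continuous_on (sphere 0 1) g"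
    unfolding H_def H'_def g_def by (intro continuous_intros conts)+
  have "circle_mean (\<lambda>w. g w * \<Phi> n r w) = circle_mean (\<lambda>w. (g w + g w * H w) + g w * H' w)"
    unfolding \<Phi>_def H_def H'_def by (simp add: algebra_simps)
  also have "\<dots> = circle_mean g + circle_mean (\<lambda>w. g w * H w) + circle_mean (\<lambda>w. g w * H' w)"
    by (subst circle_mean_add circle_mean_add; (intro continuous_intros cont)?)+ simp
  \<comment> \<open>By the reflection law g w = g (- 1 / w) \<psi> w, so the negative modes of g
    turn into r times the reflected modes k >= 0. The constant one among these stems from mode -1
    and is the summand r in 1 + r.\<close>
  also have "circle_mean (\<lambda>w. g w * H' w) = circle_mean (\<lambda>w. (\<lambda>w. of_real r * (g w + g w * H w)) (- 1 / w))"
  proof (rule circle_mean_cong)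
    fix w :: complex assume w: "cmod w = 1"
    have w': "cmod (- 1 / w) = 1"
      using w by (simp add: norm_divide)
    have "of_real r * (g (- 1 / w) + g (- 1 / w) * H (- 1 / w))
      = g (- 1 / w) * (of_real r / (1 - of_real r * \<psi> n (- 1 / w)))"
      unfolding H_def using \<Phi>_circle(2)[OF w' r, of n] by (simp add: divide_simps) (simp add: algebra_simps)
    also have "\<dots> = g (- 1 / w) * (of_real r * \<psi> n w / (\<psi> n w - of_real r))"
      unfolding reflection_kernel(2)[OF w r] ..
    also have "\<dots> = (G (- 1 / w) * phase (- 1 / w) * \<psi> n w) * weight w * y w * H' w"
      unfolding g_def H'_def sym[OF w] reflection_weight[OF circle_nonzero(1)[OF w]] by simp
    also have "\<dots> = g w * H' w"
      unfolding admissible_reflection[OF G w] g_def ..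
    finally show "g w * H' w = of_real r * (g (- 1 / w) + g (- 1 / w) * H (- 1 / w))" ..
  qed
  also have "\<dots> = circle_mean (\<lambda>w. of_real r * (g w + g w * H w))"
    by (intro circle_mean_minus_inverse continuous_intros cont)
  also have "\<dots> = of_real r * (circle_mean g + circle_mean (\<lambda>w. g w * H w))"
    unfolding circle_mean_cmult by (subst circle_mean_add; (intro continuous_intros cont)?) simp
  finally have eq: "circle_mean (\<lambda>w. g w * \<Phi> n r w) - (1 + of_real r) * circle_mean g
      = of_real (1 + r) * circle_mean (\<lambda>w. g w * H w)"
    by (simp add: algebra_simps)
  have "cmod (circle_mean (\<lambda>w. g w * H w)) \<le> 2 * (weight_bound * Y) * decay n"
    unfolding H_def
  proof (rule circle_mean_tail[where S = "S \<inter> weight_domain", OF _ _ _ _ r decay])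
    show "g holomorphic_on S \<inter> weight_domain"
      unfolding g_def
      by (intro holomorphic_intros holomorphic_on_subset[OF S(2)] holomorphic_on_subset[OF holomorphic_weight_phase(1)]
          holomorphic_on_subset[OF holomorphic_weight_phase(2)] holomorphic_on_subset[OF holG]) (auto simp: weight_domain_def)
    show "cmod (g w) \<le> weight_bound * Y" if w: "cmod w = \<rho>" for w
    proof -
      have "cmod (G w) * cmod (phase w * weight w) * cmod (y w) \<le> 1 * weight_bound * Y"
        using norm_weight_inner(2)[OF w] yb[OF w] \<rho>_T_bounds admissible_norm[OF G, of w] w \<rho>
        by (intro mult_mono) auto
      then show ?thesis
        by (simp add: g_def norm_mult mult_ac)
    qed
  qed (use S open_weight_domain annulus_subset_weight_domain in auto)
  then have "cmod (of_real (1 + r) * circle_mean (\<lambda>w. g w * H w)) \<le> 2 * (2 * (weight_bound * Y) * decay n)"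
    unfolding norm_mult using r by (intro mult_mono) (simp_all only: norm_of_real, auto)
  then show ?thesis
    unfolding eq[unfolded g_def, symmetric] g_def eq by (simp add: eq[unfolded g_def])
qed

section \<open>Explicit means by Cauchy's formula\<close>

lemma circle_mean_weight: "circle_mean weight = 1 / (1 - \<tau> ^ 4)"
proof -
  \<comment> \<open>Partial fractions: w^2 / (w^2 - \<tau>^2) is half the sum of the Cauchy kernels
    at \<tau> and - \<tau>.\<close>
  define k where "k = (\<lambda>w. 1 / (2 * (1 - \<tau>\<^sup>2 * w\<^sup>2)))"
  have k: "continuous_on (cball 0 1) k" "k holomorphic_on ball 0 1"
    unfolding k_def using denominators_disc by (auto intro!: continuous_intros holomorphic_intros)
  have k': "continuous_on (sphere 0 1) k"
    by (rule continuous_on_subset[OF k(1)]) auto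
  have "circle_mean weight = circle_mean (\<lambda>w. k w * (w / (w - \<tau>)) + k w * (w / (w - (- \<tau>))))"
  proof (rule circle_mean_cong)
    fix w :: complex assume w: "cmod w = 1"
    have "(w\<^sup>2 - \<tau>\<^sup>2) = (w - \<tau>) * (w + \<tau>)"
      by (simp add: power2_eq_square algebra_simps)
    then show "weight w = k w * (w / (w - \<tau>)) + k w * (w / (w - (- \<tau>)))"
      using circle_nonzero[OF w] denominators_disc[of w] w unfolding k_def weight_def
      by (simp add: divide_simps) (simp add: algebra_simps power2_eq_square)
  qed
  also have "\<dots> = k \<tau> + k (- \<tau>)"
  proof -
    have "circle_mean (\<lambda>w. k w * (w / (w - \<tau>))) = k \<tau>" "circle_mean (\<lambda>w. k w * (w / (w - (- \<tau>)))) = k (- \<tau>)"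
      using T by (intro circle_mean_Cauchy k; simp)+
    then show ?thesis
      using circle_nonzero by (subst circle_mean_add) (auto intro!: continuous_intros k' simp: add_eq_0_iff2)
  qed
  also have "\<dots> = 1 / (1 - \<tau> ^ 4)"
    using one_plus_T_square_nonzero by (simp add: k_def field_simps flip: power_add)
  finally show ?thesis .
qed

lemma phase_weight_circle:
  assumes "cmod w = 1"
  shows "phase w * weight w = 1 / ((1 + \<tau> * w) * (1 - \<tau>\<^sup>2 * w\<^sup>2)) * (w / (w - \<tau>))"
proof -
  have *: "(w\<^sup>2 - \<tau>\<^sup>2) = (w - \<tau>) * (w + \<tau>)"
    by (simp add: power2_eq_square algebra_simps)
  show ?thesis
    unfolding phase_def weight_def bA_def *
    using circle_nonzero[OF assms] denominators_disc[of w] assms by (simp add: power2_eq_square)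
qed

lemma circle_mean_phase_weight:
  assumes "continuous_on (cball 0 1) G" "G holomorphic_on ball 0 1"
  shows "circle_mean (\<lambda>w. G w * phase w * weight w) = G \<tau> / ((1 + \<tau>\<^sup>2) * (1 - \<tau> ^ 4))"
proof -
  define k where "k = (\<lambda>w. G w / ((1 + \<tau> * w) * (1 - \<tau>\<^sup>2 * w\<^sup>2)))"
  have k: "continuous_on (cball 0 1) k" "k holomorphic_on ball 0 1"
    unfolding k_def using denominators_disc assms by (auto intro!: continuous_intros holomorphic_intros)
  have "circle_mean (\<lambda>w. G w * phase w * weight w) = circle_mean (\<lambda>w. k w * (w / (w - \<tau>)))"
    by (rule circle_mean_cong) (simp only: mult.assoc phase_weight_circle, simp add: k_def)
  also have "\<dots> = k \<tau>"
    using T by (intro circle_mean_Cauchy k) auto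
  also have "\<dots> = G \<tau> / ((1 + \<tau>\<^sup>2) * (1 - \<tau> ^ 4))"
    by (simp add: k_def power2_eq_square flip: power_add) (simp add: power4_eq_xxxx mult_ac)
  finally show ?thesis .
qed

text \<open>On the circle \<open>lim_fun\<close> times \<open>phase\<close> takes values at w and -
  1 / w that add up to 1. Averaging the integrand with its reflection therefore gives the factor 1/2
  for every symmetric y, with no residue to compute.\<close>

lemma circle_mean_lim_fun:
  assumes y: "symmetric_weight Y y"
  shows "2 * circle_mean (\<lambda>w. lim_fun w * phase w * weight w * y w) = circle_mean (\<lambda>w. weight w * y w)"
proof -
  have sym: "y (- 1 / w) = y w" if "cmod w = 1" for w
    using y that unfolding symmetric_weight_def by blast
  have cont_lim_fun: "continuous_on (sphere 0 1) lim_fun"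
  proof -
    have "2 * (1 + \<tau>\<^sup>2) \<noteq> 0"
      unfolding mult_eq_0_iff using one_plus_T_square_nonzero by simp
    then show ?thesis
      unfolding lim_fun_def by (intro continuous_intros ballI)
  qed
  note conts = continuous_on_symmetric_weight[OF y] continuous_on_circle cont_lim_fun
  have c: "lim_fun w * phase w = (1 + \<tau> * w) * (w + \<tau>) / (2 * (1 + \<tau>\<^sup>2) * w)" if "cmod w = 1" for w
    unfolding lim_fun_def phase_def bA_def using denominators_disc[of w] that by (simp add: power2_eq_square)
  have "circle_mean (\<lambda>w. lim_fun w * phase w * weight w * y w)
      = circle_mean (\<lambda>w. (\<lambda>w. lim_fun w * phase w * weight w * y w) (- 1 / w))"
    by (intro circle_mean_minus_inverse[symmetric] continuous_intros conts)
  also have "\<dots> = circle_mean (\<lambda>w. weight w * y w - lim_fun w * phase w * weight w * y w)"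
  proof (rule circle_mean_cong)
    fix w :: complex assume w: "cmod w = 1"
    then have w': "cmod (- 1 / w) = 1"
      by (simp add: norm_divide)
    have "lim_fun (- 1 / w) * phase (- 1 / w) = 1 - lim_fun w * phase w"
    proof -
      define N where "N = 1 + \<tau>\<^sup>2"
      have nz: "N \<noteq> 0" "w \<noteq> 0"
        using one_plus_T_square_nonzero circle_nonzero[OF w] by (auto simp: N_def)
      have "lim_fun (- 1 / w) * phase (- 1 / w) = (w - \<tau>) * (1 - \<tau> * w) / (2 * N * w)"
        unfolding c[OF w'] N_def[symmetric] using nz by (simp add: divide_simps) (simp add: algebra_simps)
      moreover have "lim_fun w * phase w = (1 + \<tau> * w) * (w + \<tau>) / (2 * N * w)"
        unfolding c[OF w] N_def ..
      moreover have "(w - \<tau>) * (1 - \<tau> * w) + (1 + \<tau> * w) * (w + \<tau>) = 2 * N * w"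
        by (simp add: N_def power2_eq_square algebra_simps)
      ultimately have "lim_fun (- 1 / w) * phase (- 1 / w) + lim_fun w * phase w = 1"
        using nz by (simp add: add_divide_distrib[symmetric])
      then show ?thesis
        by (rule add_implies_diff)
    qed
    note f = this
    show "lim_fun (- 1 / w) * phase (- 1 / w) * weight (- 1 / w) * y (- 1 / w) = weight w * y w - lim_fun w * phase w * weight w * y w"
      unfolding f sym[OF w] reflection_weight[OF circle_nonzero(1)[OF w]] by (simp add: algebra_simps)
  qed
  also have "\<dots> = circle_mean (\<lambda>w. weight w * y w) - circle_mean (\<lambda>w. lim_fun w * phase w * weight w * y w)"
    by (intro circle_mean_diff continuous_intros conts)
  finally show ?thesis
    by simp
qed


section \<open>Distance of an admissible function from the limit function\<close>

lemma norm_diff_add_le: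
  fixes a b c :: "'a :: real_normed_vector"
  assumes "norm a \<le> \<alpha>" "norm b \<le> \<beta>" "norm c \<le> \<gamma>"
  shows "norm (a - b + c) \<le> \<alpha> + \<beta> + \<gamma>"
  using norm_triangle_ineq[of "a - b" c] norm_triangle_ineq4[of a b] assms by linarith

lemma symmetric_weight_one: "symmetric_weight 1 (\<lambda>_. 1)"
  unfolding symmetric_weight_def by (auto intro!: exI[of _ UNIV])

text \<open>The mean of p is (1 + \<tau>^2) / \<kappa> = 2 f(\<tau>) / \<kappa>, and that of G e p
  \<Phi> is about 2 G(\<tau>) / \<kappa>, where \<kappa> is the denominator that Cauchy's formula
  leaves at \<tau>. So Re E >= 0 bounds G(\<tau>) from above, and near-equality in that bound makes
  E small.\<close>

lemma deviation_mean:
  assumes G: "admissible n G" and decay: "decay n \<le> 1 / 2" and r: "r = 1 - decay n" "r < 1"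
  defines "E \<equiv> circle_mean (\<lambda>w. (1 - G w * phase w) * weight w * \<Phi> n r w)"
    and "\<kappa> \<equiv> (1 + T\<^sup>2) * (1 - T ^ 4)"
  shows "cmod (E - 2 * (lim_fun \<tau> - G \<tau>) / of_real \<kappa>) \<le> (8 * weight_bound + 1 / \<kappa>) * decay n"
    and "0 \<le> Re E"
    and "cmod (circle_mean (\<lambda>w. weight w * \<Phi> n r w)) \<le> 1 / (1 - T ^ 4) + 2 * weight_bound"
proof -
  have r': "0 \<le> r" "r < 1"
    using r decay by auto
  have \<kappa>: "0 < \<kappa>"
    unfolding \<kappa>_def by (rule T_power_bounds)
  note conts = continuous_on_circle continuous_on_kernels[OF r'] admissible_continuous(2)[OF G]
  have 1: "cmod (circle_mean (\<lambda>w. weight w * \<Phi> n r w) - circle_mean weight) \<le> 4 * weight_bound * decay n"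
    using circle_mean_weight_\<Phi>[OF symmetric_weight_one r' decay] by simp
  have 2: "cmod (circle_mean (\<lambda>w. G w * phase w * weight w * \<Phi> n r w)
      - (1 + of_real r) * (G \<tau> / of_real \<kappa>)) \<le> 4 * weight_bound * decay n"
    using circle_mean_admissible_\<Phi>[OF G symmetric_weight_one r' decay]
      circle_mean_phase_weight[OF admissible_continuous(1,3)[OF G]]
    by (simp add: \<kappa>_def)
  have 3: "circle_mean weight = 2 * lim_fun \<tau> / of_real \<kappa>"
    unfolding circle_mean_weight lim_fun_\<tau> \<kappa>_def using one_plus_T_square_nonzero by simp
  have E: "E = circle_mean (\<lambda>w. weight w * \<Phi> n r w) - circle_mean (\<lambda>w. G w * phase w * weight w * \<Phi> n r w)"
    unfolding E_def
    by (subst circle_mean_diff[symmetric]; (intro continuous_intros conts)?) (simp add: algebra_simps)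
  \<comment> \<open>The last term makes up for 1 + r being 2 - \<open>decay n\<close> instead of
    2.\<close>
  have "E - 2 * (lim_fun \<tau> - G \<tau>) / of_real \<kappa>
      = (circle_mean (\<lambda>w. weight w * \<Phi> n r w) - circle_mean weight)
        - (circle_mean (\<lambda>w. G w * phase w * weight w * \<Phi> n r w) - (1 + of_real r) * (G \<tau> / of_real \<kappa>))
        + of_real (decay n) * (G \<tau> / of_real \<kappa>)"
    unfolding E 3 r(1) by (simp add: algebra_simps diff_divide_distrib)
  also have "cmod \<dots> \<le> 4 * weight_bound * decay n + 4 * weight_bound * decay n + decay n * (1 / \<kappa>)"
  proof (rule norm_diff_add_le[OF 1 2])
    show "cmod (of_real (decay n) * (G \<tau> / of_real \<kappa>)) \<le> decay n * (1 / \<kappa>)"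
      unfolding norm_mult norm_divide using admissible_norm[OF G, of \<tau>] T less_imp_le[OF decay_pos] \<kappa>
      by (intro mult_mono) (auto simp: divide_right_mono)
  qed
  finally show "cmod (E - 2 * (lim_fun \<tau> - G \<tau>) / of_real \<kappa>) \<le> (8 * weight_bound + 1 / \<kappa>) * decay n"
    by (simp add: algebra_simps)
  have "cmod (circle_mean (\<lambda>w. 0)) \<le> Re E"
    unfolding E_def
  proof (rule circle_mean_norm_le)
    fix w :: complex assume w: "cmod w = 1"
    have "cmod (G w * phase w) \<le> 1"
      using admissible_norm[OF G] w norm_phase_circle[OF w] by (simp add: norm_mult)
    then have "0 \<le> Re (1 - G w * phase w)"
      using complex_Re_le_cmod[of "G w * phase w"] by simp
    moreover have "r\<^sup>2 \<le> 1"
      using r' by (simp add: power_le_one)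
    ultimately show "cmod 0 \<le> Re ((1 - G w * phase w) * weight w * \<Phi> n r w)"
      unfolding weight_circle[OF w] \<Phi>_circle(1)[OF w r'] mult.assoc of_real_mult[symmetric]
      by (subst Re_complex_of_real[symmetric]) (simp del: of_real_mult)
  qed (intro continuous_intros conts)+
  then show "0 \<le> Re E"
    by (simp add: circle_mean_def)
  have "cmod (circle_mean weight) = 1 / (1 - T ^ 4)"
  proof -
    have "circle_mean weight = of_real (1 / (1 - T ^ 4))"
      by (simp add: circle_mean_weight)
    then show ?thesis
      using T power_less_one_iff[of T 4] by (simp only: norm_of_real) simp
  qed
  moreover have "4 * weight_bound * decay n \<le> 2 * weight_bound"
    using decay \<rho>_T_bounds(3) mult_left_mono[of "decay n" "1/2" "4 * weight_bound"] by simp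
  ultimately show "cmod (circle_mean (\<lambda>w. weight w * \<Phi> n r w)) \<le> 1 / (1 - T ^ 4) + 2 * weight_bound"
    using 1 norm_triangle_sub[of "circle_mean (\<lambda>w. weight w * \<Phi> n r w)" "circle_mean weight"] by linarith
qed

text \<open>\<open>norm_diff_1_le\<close> holds pointwise for x = G \<open>phase\<close>, and
  \<open>weight\<close> times \<Phi> is a non-negative density on the circle, so the estimate
  integrates. The factor y costs only its bound Y.\<close>

lemma weighted_deviation:
  assumes G: "admissible n G" and y: "symmetric_weight Y y" and Y: "0 \<le> Y"
    and r: "0 \<le> r" "r < 1" and \<epsilon>: "0 < \<epsilon>"
  shows "cmod (circle_mean (\<lambda>w. (G w * phase w - 1) * weight w * y w * \<Phi> n r w))
    \<le> Y * (\<epsilon> / 2 * cmod (circle_mean (\<lambda>w. weight w * \<Phi> n r w))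
        + Re (circle_mean (\<lambda>w. (1 - G w * phase w) * weight w * \<Phi> n r w)) / \<epsilon>)"
proof -
  note conts = continuous_on_symmetric_weight[OF y] continuous_on_circle continuous_on_kernels[OF r]
    admissible_continuous(2)[OF G]
  define g where "g = (\<lambda>w. of_real Y * (of_real (\<epsilon> / 2) * (weight w * \<Phi> n r w)
      + of_real (1 / \<epsilon>) * ((1 - G w * phase w) * weight w * \<Phi> n r w)))"
  have "cmod (circle_mean (\<lambda>w. (G w * phase w - 1) * weight w * y w * \<Phi> n r w)) \<le> Re (circle_mean g)"
  proof (rule circle_mean_norm_le)
    fix w :: complex assume w: "cmod w = 1"
    define x where "x = G w * phase w"
    define P where "P = 1 / (cmod (1 - \<tau>\<^sup>2 * w\<^sup>2))\<^sup>2 * ((1 - r\<^sup>2) / (cmod (1 - of_real r * \<psi> n w))\<^sup>2)"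
    have P: "weight w * \<Phi> n r w = of_real P"
      unfolding weight_circle[OF w] \<Phi>_circle(1)[OF w r] P_def by simp
    have "r\<^sup>2 \<le> 1"
      using r by (simp add: power_le_one)
    then have "0 \<le> P"
      by (simp add: P_def)
    have "cmod x \<le> 1"
      using admissible_norm[OF G] w norm_phase_circle[OF w] by (simp add: norm_mult x_def)
    then have 1: "cmod (x - 1) \<le> \<epsilon> / 2 + (1 - Re x) / \<epsilon>"
      using \<epsilon> by (rule norm_diff_1_le)
    have "cmod (y w) \<le> Y"
      using y w \<rho> unfolding symmetric_weight_def by auto
    have "(G w * phase w - 1) * weight w * y w * \<Phi> n r w = y w * (x - 1) * of_real P"
      unfolding P[symmetric] x_def by (simp add: mult_ac)
    also have "cmod \<dots> \<le> Y * (\<epsilon> / 2 + (1 - Re x) / \<epsilon>) * P"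
      unfolding norm_mult using \<open>0 \<le> P\<close> \<open>cmod (y w) \<le> Y\<close> 1 Y
      by (intro mult_mono mult_nonneg_nonneg order_trans[OF norm_ge_zero 1]) auto
    also have "\<dots> = Re (g w)"
    proof -
      have "g w = of_real Y * (of_real (\<epsilon> / 2) + of_real (1 / \<epsilon>) * (1 - x)) * of_real P"
        unfolding g_def P[symmetric] x_def by (simp add: algebra_simps)
      then show ?thesis
        by simp
    qed
    finally show "cmod ((G w * phase w - 1) * weight w * y w * \<Phi> n r w) \<le> Re (g w)" .
  next
    show "continuous_on (sphere 0 1) g"
      unfolding g_def by (intro continuous_intros conts)
  qed (intro continuous_intros conts)
  also have "circle_mean g = of_real Y * (of_real (\<epsilon> / 2) * circle_mean (\<lambda>w. weight w * \<Phi> n r w)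
      + of_real (1 / \<epsilon>) * circle_mean (\<lambda>w. (1 - G w * phase w) * weight w * \<Phi> n r w))"
    unfolding g_def circle_mean_cmult
    by (subst circle_mean_add; (intro continuous_intros conts)?) (simp only: circle_mean_cmult)
  also have "Re \<dots> = Y * (\<epsilon> / 2 * Re (circle_mean (\<lambda>w. weight w * \<Phi> n r w))
      + Re (circle_mean (\<lambda>w. (1 - G w * phase w) * weight w * \<Phi> n r w)) / \<epsilon>)"
    by simp
  also have "\<dots> \<le> Y * (\<epsilon> / 2 * cmod (circle_mean (\<lambda>w. weight w * \<Phi> n r w))
        + Re (circle_mean (\<lambda>w. (1 - G w * phase w) * weight w * \<Phi> n r w)) / \<epsilon>)"
    using Y \<epsilon> by (intro mult_left_mono add_right_mono complex_Re_le_cmod) auto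
  finally show ?thesis .
qed

lemma value_upper_bound:
  assumes G: "admissible n G" and decay: "decay n \<le> 1 / 2"
  shows "Re (G \<tau>) \<le> Re (lim_fun \<tau>) + (1 + T\<^sup>2) * (1 - T ^ 4) * (8 * weight_bound + 1 / ((1 + T\<^sup>2) * (1 - T ^ 4))) * decay n"
proof -
  define \<kappa> where "\<kappa> = (1 + T\<^sup>2) * (1 - T ^ 4)"
  have \<kappa>: "0 < \<kappa>"
    unfolding \<kappa>_def by (rule T_power_bounds)
  define E where "E = circle_mean (\<lambda>w. (1 - G w * phase w) * weight w * \<Phi> n (1 - decay n) w)"
  have *: "cmod (E - 2 * (lim_fun \<tau> - G \<tau>) / of_real \<kappa>) \<le> (8 * weight_bound + 1 / \<kappa>) * decay n" "0 \<le> Re E"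
    using deviation_mean(1,2)[OF G decay refl] decay_pos[of n] unfolding E_def \<kappa>_def by auto
  have "2 * (Re (G \<tau>) - Re (lim_fun \<tau>)) / \<kappa> \<le> Re (E - 2 * (lim_fun \<tau> - G \<tau>) / of_real \<kappa>)"
    using *(2) by (simp add: algebra_simps diff_divide_distrib)
  also have "\<dots> \<le> (8 * weight_bound + 1 / \<kappa>) * decay n"
    using *(1) complex_Re_le_cmod order_trans by blast
  finally have "2 * (Re (G \<tau>) - Re (lim_fun \<tau>)) / \<kappa> \<le> (8 * weight_bound + 1 / \<kappa>) * decay n" .
  moreover define X where "X = \<kappa> * (8 * weight_bound + 1 / \<kappa>) * decay n"
  ultimately have "2 * (Re (G \<tau>) - Re (lim_fun \<tau>)) \<le> X"
    using \<kappa> by (simp add: divide_le_eq mult_ac)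
  moreover have "0 \<le> X"
    unfolding X_def using \<kappa> \<rho>_T_bounds decay_pos[of n] by simp
  ultimately have "Re (G \<tau>) \<le> Re (lim_fun \<tau>) + X"
    by argo
  then show ?thesis
    by (simp add: \<kappa>_def X_def)
qed

text \<open>The kernel \<Phi> is removed again: passing between means with and without it costs a
  multiple of \<open>decay n\<close>, and the difference with \<Phi> is small by
  \<open>weighted_deviation\<close>. Once \<open>decay n\<close> and the defect at \<tau> tend to 0,
  only a multiple of \<epsilon> remains.\<close>

lemma mean_difference_bound:
  assumes G: "admissible n G" and y: "symmetric_weight Y y" and Y: "0 \<le> Y"
    and decay: "decay n \<le> 1 / 2" and \<epsilon>: "0 < \<epsilon>" "\<epsilon> \<le> 1"
  defines "\<kappa> \<equiv> (1 + T\<^sup>2) * (1 - T ^ 4)"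
  defines "C \<equiv> 2 / (1 - T ^ 4) + 18 * weight_bound + 3 / \<kappa>"
  shows "cmod (circle_mean (\<lambda>w. (G w - lim_fun w) * phase w * weight w * y w))
    \<le> Y * C * (\<epsilon> + (decay n + cmod (lim_fun \<tau> - G \<tau>)) / \<epsilon>)"
proof -
  define r where "r = 1 - decay n"
  have r: "0 \<le> r" "r < 1"
    using decay decay_pos[of n] by (auto simp: r_def)
  note T4 = T_power_bounds(3)
  have \<kappa>: "0 < \<kappa>"
    unfolding \<kappa>_def by (rule T_power_bounds)
  have cont_lim_fun: "continuous_on (sphere 0 1) lim_fun"
    unfolding lim_fun_def by (intro continuous_intros ballI) (use one_plus_T_square_nonzero(1) in \<open>simp del: distrib_left_numeral\<close>)
  note conts = continuous_on_symmetric_weight[OF y] continuous_on_circle continuous_on_kernels[OF r]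
    admissible_continuous(2)[OF G] cont_lim_fun
  define x where "x = decay n"
  define \<delta> where "\<delta> = cmod (lim_fun \<tau> - G \<tau>)"
  define M where "M = circle_mean (\<lambda>w. (G w - lim_fun w) * phase w * weight w * y w)"
  define a where "a = circle_mean (\<lambda>w. G w * phase w * weight w * y w * \<Phi> n r w)"
  define b where "b = circle_mean (\<lambda>w. weight w * y w * \<Phi> n r w)"
  define g where "g = circle_mean (\<lambda>w. G w * phase w * weight w * y w)"
  define f where "f = circle_mean (\<lambda>w. weight w * y w)"
  define P1 where "P1 = cmod (circle_mean (\<lambda>w. weight w * \<Phi> n r w))"
  define E where "E = circle_mean (\<lambda>w. (1 - G w * phase w) * weight w * \<Phi> n r w)"
  have a: "cmod (a - (1 + of_real r) * g) \<le> 4 * (weight_bound * Y) * x"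
    unfolding a_def g_def x_def by (rule circle_mean_admissible_\<Phi>[OF G y r decay])
  have b: "cmod (b - f) \<le> 4 * (weight_bound * Y) * x"
    unfolding b_def f_def x_def by (rule circle_mean_weight_\<Phi>[OF y r decay])
  have "a - b = circle_mean (\<lambda>w. (G w * phase w - 1) * weight w * y w * \<Phi> n r w)"
    unfolding a_def b_def
    by (subst circle_mean_diff[symmetric]; (intro continuous_intros conts)?) (simp add: algebra_simps)
  then have ab: "cmod (a - b) \<le> Y * (\<epsilon> / 2 * P1 + Re E / \<epsilon>)"
    using weighted_deviation[OF G y Y r \<epsilon>(1)] unfolding P1_def E_def by simp
  have "M = g - circle_mean (\<lambda>w. lim_fun w * phase w * weight w * y w)"
    unfolding M_def g_def
    by (subst circle_mean_diff[symmetric]; (intro continuous_intros conts)?) (simp add: algebra_simps)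
  then have "2 * M = 2 * g - 2 * circle_mean (\<lambda>w. lim_fun w * phase w * weight w * y w)"
    by (simp only: right_diff_distrib)
  also have "\<dots> = 2 * g - f"
    unfolding circle_mean_lim_fun[OF y] f_def ..
  \<comment> \<open>a is close to (1 + r) g and b to f, while x g corrects 1 + r to 2; so 2 g - f is
    close to a - b.\<close>
  also have "\<dots> = ((a - b) + of_real x * g) - (a - (1 + of_real r) * g) + (b - f)"
    by (simp add: algebra_simps r_def x_def)
  also have "cmod \<dots> \<le> (Y * (\<epsilon> / 2 * P1 + Re E / \<epsilon>) + x * (Y * (1 / (1 - T ^ 4)))) + 4 * (weight_bound * Y) * x + 4 * (weight_bound * Y) * x"
  proof (rule norm_diff_add_le[OF _ a b], rule norm_triangle_le, rule add_mono[OF ab])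
    have "cmod g \<le> Re (circle_mean (\<lambda>w. of_real Y * weight w))"
      unfolding g_def
    proof (rule circle_mean_norm_le)
      fix w :: complex assume w: "cmod w = 1"
      have "cmod (y w) \<le> Y"
        using y w \<rho> unfolding symmetric_weight_def by auto
      moreover have "cmod (weight w) = Re (weight w)"
        unfolding weight_circle[OF w] norm_of_real Re_complex_of_real by simp
      moreover from this have "0 \<le> Re (weight w)"
        by (metis norm_ge_zero)
      ultimately have "cmod (G w) * cmod (phase w) * cmod (weight w) * cmod (y w) \<le> 1 * 1 * Re (weight w) * Y"
        using admissible_norm[OF G] w norm_phase_circle[OF w] Y by (intro mult_mono) auto
      then show "cmod (G w * phase w * weight w * y w) \<le> Re (of_real Y * weight w)"
        by (simp add: norm_mult mult.commute)
    qed (intro continuous_intros conts)+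
    also have "circle_mean (\<lambda>w. of_real Y * weight w) = of_real (Y * (1 / (1 - T ^ 4)))"
      unfolding circle_mean_cmult circle_mean_weight by simp
    finally show "cmod (of_real x * g) \<le> x * (Y * (1 / (1 - T ^ 4)))"
      using decay_pos[of n] unfolding norm_mult norm_of_real Re_complex_of_real x_def by (intro mult_mono) auto
  qed
  also have "\<dots> = Y * (\<epsilon> / 2 * P1 + Re E / \<epsilon> + x * (1 / (1 - T ^ 4)) + 8 * weight_bound * x)"
    by (simp add: algebra_simps)
  also have "\<dots> \<le> Y * (C * (\<epsilon> + (x + \<delta>) / \<epsilon>))"
  proof (intro mult_left_mono Y)
    have dev: "cmod (E - 2 * (lim_fun \<tau> - G \<tau>) / of_real \<kappa>) \<le> (8 * weight_bound + 1 / \<kappa>) * x"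
      unfolding E_def \<kappa>_def x_def by (rule deviation_mean(1)[OF G decay r_def r(2)])
    have P1: "P1 \<le> 1 / (1 - T ^ 4) + 2 * weight_bound"
      unfolding P1_def by (rule deviation_mean(3)[OF G decay r_def r(2)])
    define t where "t = 1 / (1 - T ^ 4)"
    define c where "c = 1 / \<kappa>"
    define u where "u = (x + \<delta>) / \<epsilon>"
    have C: "C = 2 * t + 18 * weight_bound + 3 * c"
      by (simp add: C_def t_def c_def)
    have nonneg: "0 \<le> t" "0 \<le> c" "0 \<le> weight_bound" "0 \<le> x" "0 \<le> \<delta>" "0 \<le> u"
      using T4 \<kappa> \<rho>_T_bounds(3) decay_pos[of n] \<epsilon> by (auto simp: x_def \<delta>_def t_def c_def u_def)
    \<comment> \<open>As \<epsilon> <= 1, a bare x is absorbed into u, so that all error terms fit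
      under the single constant C.\<close>
    have "x * 1 \<le> (x + \<delta>) * (1 / \<epsilon>)"
      using nonneg \<epsilon> by (intro mult_mono) auto
    then have "x \<le> u"
      by (simp add: u_def)
    have "cmod (2 * (lim_fun \<tau> - G \<tau>) / of_real \<kappa>) = 2 * c * \<delta>"
      using \<kappa> by (simp only: norm_divide norm_mult \<delta>_def c_def norm_of_real) simp
    then have "Re E \<le> (8 * weight_bound + c) * x + 2 * c * \<delta>"
      using dev norm_triangle_sub[of E "2 * (lim_fun \<tau> - G \<tau>) / of_real \<kappa>"] complex_Re_le_cmod[of E]
      unfolding c_def[symmetric] by linarith
    also have "\<dots> \<le> (8 * weight_bound + 3 * c) * (x + \<delta>)"
      using mult_nonneg_nonneg[of c x] mult_nonneg_nonneg[of c \<delta>] mult_nonneg_nonneg[of weight_bound \<delta>] nonneg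
      by (simp add: algebra_simps)
    finally have "Re E / \<epsilon> \<le> (8 * weight_bound + 3 * c) * (x + \<delta>) / \<epsilon>"
      using \<epsilon> by (intro divide_right_mono) auto
    also have "\<dots> = (8 * weight_bound + 3 * c) * u"
      by (simp add: u_def)
    finally have E: "Re E / \<epsilon> \<le> 8 * (weight_bound * u) + 3 * (c * u)"
      by (simp add: algebra_simps)
    have "0 \<le> P1"
      by (simp add: P1_def)
    have "\<epsilon> / 2 * P1 \<le> \<epsilon> * (t + 2 * weight_bound)"
      using P1[folded t_def] \<epsilon> \<open>0 \<le> P1\<close> by (intro mult_mono) simp_all
    moreover have "t * x \<le> t * u" "weight_bound * x \<le> weight_bound * u"
      using \<open>x \<le> u\<close> nonneg by (auto intro!: mult_left_mono)
    moreover have "0 \<le> t * \<epsilon>" "0 \<le> weight_bound * \<epsilon>" "0 \<le> c * \<epsilon>" "0 \<le> t * u" "0 \<le> weight_bound * u"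
      using nonneg \<epsilon> by auto
    ultimately have "\<epsilon> / 2 * P1 + Re E / \<epsilon> + t * x + 8 * (weight_bound * x) \<le> C * (\<epsilon> + u)"
      using E unfolding C by (simp add: algebra_simps)
    then show "\<epsilon> / 2 * P1 + Re E / \<epsilon> + x * (1 / (1 - T ^ 4)) + 8 * weight_bound * x \<le> C * (\<epsilon> + (x + \<delta>) / \<epsilon>)"
      by (simp add: t_def u_def)
  qed
  finally have "2 * cmod M \<le> Y * (C * (\<epsilon> + (x + \<delta>) / \<epsilon>))"
    by (simp add: norm_mult)
  then have "cmod M \<le> Y * (C * (\<epsilon> + (x + \<delta>) / \<epsilon>))"
    using norm_ge_zero[of M] by linarith
  then show ?thesis
    by (simp add: M_def x_def \<delta>_def mult.assoc)
qed

text \<open>Reflection exchanges w - \<zeta> and 1 + \<zeta> w up to factors that the numerator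
  compensates, so the pole at \<zeta> is paired with one at - 1 / \<zeta> outside the disc.\<close>

lemma symmetric_weight_pole:
  assumes \<zeta>: "cmod \<zeta> = R" and R: "R < \<rho>"
  shows "symmetric_weight (1 / ((\<rho> - R) * (1 - R))) (\<lambda>w. w / ((w - \<zeta>) * (1 + \<zeta> * w)))"
proof -
  have R': "0 \<le> R" "R < 1"
    using \<zeta> R \<rho> norm_ge_zero[of \<zeta>] by auto
  have bound: "(\<rho> - R) * (1 - R) \<le> cmod ((w - \<zeta>) * (1 + \<zeta> * w))" if "\<rho> \<le> cmod w" "cmod w \<le> 1" for w
  proof -
    have "\<rho> - R \<le> cmod (w - \<zeta>)"
      using norm_triangle_ineq2[of w \<zeta>] that \<zeta> by simp
    moreover have "cmod (\<zeta> * w) \<le> R * 1"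
      unfolding norm_mult using \<zeta> that R' by (intro mult_mono) auto
    then have "1 - R \<le> cmod (1 + \<zeta> * w)"
      using norm_triangle_ineq2[of 1 "- (\<zeta> * w)"] by simp
    ultimately show ?thesis
      unfolding norm_mult[of "w - \<zeta>"] using R R' by (intro mult_mono) auto
  qed
  have pos: "0 < (\<rho> - R) * (1 - R)"
    using R R' by simp
  show ?thesis
    unfolding symmetric_weight_def
  proof (intro conjI allI impI exI[of _ "{w. (w - \<zeta>) * (1 + \<zeta> * w) \<noteq> 0}"])
    show "open {w. (w - \<zeta>) * (1 + \<zeta> * w) \<noteq> 0}"
      by (intro open_Collect_neq continuous_intros)
    show "(\<lambda>w. w / ((w - \<zeta>) * (1 + \<zeta> * w))) holomorphic_on {w. (w - \<zeta>) * (1 + \<zeta> * w) \<noteq> 0}"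
      by (intro holomorphic_intros) auto
  next
    fix w assume "\<rho> \<le> cmod w" "cmod w \<le> 1"
    then have "0 < cmod ((w - \<zeta>) * (1 + \<zeta> * w))"
      using bound[of w] pos by linarith
    then show "w \<in> {w. (w - \<zeta>) * (1 + \<zeta> * w) \<noteq> 0}"
      by simp
  next
    fix w :: complex assume "cmod w = 1"
    then have "w \<noteq> 0"
      by auto
    then have eq: "- 1 / w - \<zeta> = - (1 + \<zeta> * w) / w" "1 + \<zeta> * (- 1 / w) = (w - \<zeta>) / w"
      by (simp_all add: add_divide_distrib diff_divide_distrib)
    define c d where "c = 1 + \<zeta> * w" and "d = w - \<zeta>"
    show "- 1 / w / ((- 1 / w - \<zeta>) * (1 + \<zeta> * (- 1 / w))) = w / ((w - \<zeta>) * (1 + \<zeta> * w))"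
      unfolding eq c_def[symmetric] d_def[symmetric] using \<open>w \<noteq> 0\<close> by (simp add: divide_simps)
  next
    fix w assume w: "\<rho> \<le> cmod w" "cmod w \<le> 1"
    show "cmod (w / ((w - \<zeta>) * (1 + \<zeta> * w))) \<le> 1 / ((\<rho> - R) * (1 - R))"
      unfolding norm_divide using bound[OF w] pos w by (intro frac_le) auto
  qed
qed


text \<open>Two simple poles remain in the disc, \<tau> from e p and \<zeta> from the added factor.
  The mean thus determines D \<zeta> once D \<tau> is known.\<close>

lemma circle_mean_pole:
  assumes D: "continuous_on (cball 0 1) D" "D holomorphic_on ball 0 1" and \<zeta>: "cmod \<zeta> < 1" "\<zeta> \<noteq> \<tau>"
  defines "k \<equiv> \<lambda>w. D w / ((1 + \<tau> * w) * (1 - \<tau>\<^sup>2 * w\<^sup>2) * (1 + \<zeta> * w))"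
  shows "circle_mean (\<lambda>w. D w * phase w * weight w * (w / ((w - \<zeta>) * (1 + \<zeta> * w))))
    = (\<tau> * k \<tau> - \<zeta> * k \<zeta>) / (\<tau> - \<zeta>)"
proof -
  have nz: "1 + \<zeta> * w \<noteq> 0" if "cmod w \<le> 1" for w
  proof -
    have "cmod \<zeta> * cmod w \<le> cmod \<zeta> * 1"
      using that by (intro mult_left_mono) auto
    then show ?thesis
      using blaschke_denominator_nonzero[of "- cnj \<zeta>" w] \<zeta> by simp
  qed
  have k: "continuous_on (cball 0 1) k" "k holomorphic_on ball 0 1"
    unfolding k_def using denominators_disc D nz by (auto intro!: continuous_intros holomorphic_intros)
  have k': "continuous_on (sphere 0 1) k"
    by (rule continuous_on_subset[OF k(1)]) auto
  have w\<zeta>: "w \<noteq> \<zeta>" if "cmod w = 1" for w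
    using that \<zeta> by auto
  have "circle_mean (\<lambda>w. D w * phase w * weight w * (w / ((w - \<zeta>) * (1 + \<zeta> * w))))
      = circle_mean (\<lambda>w. \<tau> / (\<tau> - \<zeta>) * (k w * (w / (w - \<tau>))) - \<zeta> / (\<tau> - \<zeta>) * (k w * (w / (w - \<zeta>))))"
  proof (rule circle_mean_cong)
    fix w :: complex assume w: "cmod w = 1"
    have 1: "w / (w - \<tau>) * (w / (w - \<zeta>)) = \<tau> / (\<tau> - \<zeta>) * (w / (w - \<tau>)) - \<zeta> / (\<tau> - \<zeta>) * (w / (w - \<zeta>))"
      using \<zeta> circle_nonzero[OF w] w\<zeta>[OF w] by (simp add: divide_simps) (simp add: algebra_simps)
    have 2: "D w * phase w * weight w * (w / ((w - \<zeta>) * (1 + \<zeta> * w))) = k w * (w / (w - \<tau>) * (w / (w - \<zeta>)))"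
      unfolding mult.assoc[of "D w"] phase_weight_circle[OF w] k_def by simp
    show "D w * phase w * weight w * (w / ((w - \<zeta>) * (1 + \<zeta> * w)))
        = \<tau> / (\<tau> - \<zeta>) * (k w * (w / (w - \<tau>))) - \<zeta> / (\<tau> - \<zeta>) * (k w * (w / (w - \<zeta>)))"
      unfolding 2 1 by (simp only: right_diff_distrib mult.left_commute)
  qed
  also have "\<dots> = circle_mean (\<lambda>w. \<tau> / (\<tau> - \<zeta>) * (k w * (w / (w - \<tau>))))
      - circle_mean (\<lambda>w. \<zeta> / (\<tau> - \<zeta>) * (k w * (w / (w - \<zeta>))))"
    using circle_nonzero w\<zeta> by (intro circle_mean_diff continuous_intros k') auto
  also have "\<dots> = \<tau> / (\<tau> - \<zeta>) * k \<tau> - \<zeta> / (\<tau> - \<zeta>) * k \<zeta>"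
    unfolding circle_mean_cmult using circle_mean_Cauchy[OF k, of \<tau>] circle_mean_Cauchy[OF k, of \<zeta>] T \<zeta> by simp
  finally show ?thesis
    by (simp add: diff_divide_distrib)
qed

lemma holomorphic_lim_fun: "lim_fun holomorphic_on S" and continuous_lim_fun: "continuous_on S lim_fun"
  unfolding lim_fun_def
  by (intro holomorphic_intros continuous_intros ballI; use one_plus_T_square_nonzero(1) in \<open>simp del: distrib_left_numeral\<close>)+

text \<open>On |z| = R the two-pole formula is solved for D z: R > T keeps z away from \<tau>, and R
  > 0 permits division by z. The maximum principle carries the bound inside.\<close>

theorem stability:
  assumes R: "T < R" "R < \<rho>"
  obtains C where "0 \<le> C"
    and "\<And>n G (\<epsilon> :: real) \<zeta>. \<lbrakk>admissible n G; decay n \<le> 1 / 2; 0 < \<epsilon>; \<epsilon> \<le> 1; cmod \<zeta> \<le> R\<rbrakk>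
      \<Longrightarrow> cmod (G \<zeta> - lim_fun \<zeta>) \<le> C * (\<epsilon> + (decay n + cmod (lim_fun \<tau> - G \<tau>)) / \<epsilon>)"
proof -
  have R': "0 < R" "R < 1"
    using R T \<rho> by auto
  define Y where "Y = 1 / ((\<rho> - R) * (1 - R))"
  define \<kappa> where "\<kappa> = (1 + T\<^sup>2) * (1 - T ^ 4)"
  define C where "C = 2 / (1 - T ^ 4) + 18 * weight_bound + 3 / \<kappa>"
  note T4 = T_power_bounds(3)
  have \<kappa>: "0 < \<kappa>"
    unfolding \<kappa>_def by (rule T_power_bounds)
  have Y: "0 \<le> Y" and C: "0 \<le> C"
    using R R' T4 \<kappa> \<rho>_T_bounds(3) by (auto simp: Y_def C_def add_nonneg_nonneg)
  \<comment> \<open>8 bounds the denominator of k z, 1 / R comes from dividing by z, and 2 bounds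
    |\<tau> - z|. The two summands come from D \<tau> and from the mean.\<close>
  define C' where "C' = 8 / R * (1 / (\<kappa> * (1 - R)) + 2 * (Y * C))"
  show thesis
  proof (rule that[of C'])
    show "0 \<le> C'"
      unfolding C'_def using R' \<kappa> Y C by simp
    fix n G and \<epsilon> :: real and \<zeta>
    assume G: "admissible n G" and decay: "decay n \<le> 1 / 2" and \<epsilon>: "0 < \<epsilon>" "\<epsilon> \<le> 1" and "cmod \<zeta> \<le> R"
    define D where "D w = G w - lim_fun w" for w
    define \<delta> where "\<delta> = cmod (lim_fun \<tau> - G \<tau>)"
    define u where "u = \<epsilon> + (decay n + \<delta>) / \<epsilon>"
    have D: "continuous_on (cball 0 1) D" "D holomorphic_on ball 0 1"
      unfolding D_def
      by (intro continuous_intros holomorphic_intros holomorphic_lim_fun continuous_lim_fun admissible_continuous[OF G])+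
    have "\<delta> * 1 \<le> (decay n + \<delta>) * (1 / \<epsilon>)"
      using \<epsilon> decay_pos[of n] by (intro mult_mono) (auto simp: \<delta>_def)
    then have \<delta>u: "\<delta> \<le> u"
      using \<epsilon> by (simp add: u_def)
    have u0: "0 \<le> u"
      using \<delta>u norm_ge_zero[of "lim_fun \<tau> - G \<tau>"] unfolding \<delta>_def by linarith
    have circle: "cmod (D z) \<le> C' * u" if z: "cmod z = R" for z
    proof -
      have "z \<noteq> \<tau>" "cmod z < 1"
        using z R R' T by auto
      define k where "k = (\<lambda>w. D w / ((1 + \<tau> * w) * (1 - \<tau>\<^sup>2 * w\<^sup>2) * (1 + z * w)))"
      define M where "M = circle_mean (\<lambda>w. D w * phase w * weight w * (w / ((w - z) * (1 + z * w))))"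
      have "cmod M \<le> Y * C * u"
        using mean_difference_bound[OF G symmetric_weight_pole[OF z R(2)] _ decay \<epsilon>] Y
        unfolding M_def D_def Y_def[symmetric] C_def \<kappa>_def u_def \<delta>_def by simp
      have "M = (\<tau> * k \<tau> - z * k z) / (\<tau> - z)"
        unfolding M_def k_def by (rule circle_mean_pole[OF D \<open>cmod z < 1\<close> \<open>z \<noteq> \<tau>\<close>])
      then have zk: "z * k z = \<tau> * k \<tau> - (\<tau> - z) * M"
        using \<open>z \<noteq> \<tau>\<close> by simp
      have "cmod (k \<tau>) \<le> \<delta> / (\<kappa> * (1 - R))"
      proof -
        have "cmod (z * \<tau>) \<le> R * 1"
          unfolding norm_mult z using T R' by (intro mult_mono) auto
        then have "1 - R \<le> cmod (1 + z * \<tau>)"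
          using norm_triangle_ineq2[of 1 "- (z * \<tau>)"] by simp
        moreover have "cmod ((1 + \<tau> * \<tau>) * (1 - \<tau>\<^sup>2 * \<tau>\<^sup>2)) = \<kappa>"
        proof -
          have "(1 + \<tau> * \<tau>) * (1 - \<tau>\<^sup>2 * \<tau>\<^sup>2) = of_real \<kappa>"
            by (simp add: \<kappa>_def power2_eq_square power4_eq_xxxx mult_ac)
          then show ?thesis
            using \<kappa> by (simp only: norm_of_real abs_of_pos)
        qed
        ultimately have "\<kappa> * (1 - R) \<le> cmod ((1 + \<tau> * \<tau>) * (1 - \<tau>\<^sup>2 * \<tau>\<^sup>2) * (1 + z * \<tau>))"
          unfolding norm_mult[of "_ * _"] using \<kappa> by simp
        moreover have "cmod (D \<tau>) = \<delta>"
          by (simp add: D_def \<delta>_def norm_minus_commute)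
        ultimately show ?thesis
          unfolding k_def norm_divide using \<kappa> R' by (intro frac_le) auto
      qed
      also have "\<dots> \<le> u / (\<kappa> * (1 - R))"
        using \<delta>u \<kappa> R' by (intro divide_right_mono) auto
      finally have "cmod (\<tau> * k \<tau>) \<le> 1 * (u / (\<kappa> * (1 - R)))"
        unfolding norm_mult using T by (intro mult_mono) auto
      moreover have "cmod ((\<tau> - z) * M) \<le> 2 * (Y * C * u)"
      proof -
        have "cmod (\<tau> - z) \<le> 2"
          using norm_triangle_ineq4[of \<tau> z] T z R' by simp
        then show ?thesis
          unfolding norm_mult using \<open>cmod M \<le> Y * C * u\<close> by (intro mult_mono) auto
      qed
      ultimately have "cmod (z * k z) \<le> u * (1 / (\<kappa> * (1 - R))) + 2 * (Y * C * u)"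
        unfolding zk using norm_triangle_ineq4[of "\<tau> * k \<tau>" "(\<tau> - z) * M"] by simp
      then have "R * cmod (k z) \<le> u * (1 / (\<kappa> * (1 - R))) + 2 * (Y * C * u)"
        by (simp add: norm_mult z)
      then have kz: "cmod (k z) \<le> (1 / (\<kappa> * (1 - R)) + 2 * (Y * C)) * u / R"
        using R' by (simp add: pos_le_divide_eq algebra_simps)
      define d where "d = (1 + \<tau> * z) * (1 - \<tau>\<^sup>2 * z\<^sup>2) * (1 + z * z)"
      have "d \<noteq> 0"
      proof -
        have "1 + z * z \<noteq> 0"
          using blaschke_denominator_nonzero[of "- cnj z" z] \<open>cmod z < 1\<close> abs_square_less_1[of "cmod z"]
          by (simp add: power2_eq_square)
        then show ?thesis
          using denominators_disc[of z] \<open>cmod z < 1\<close> by (simp add: d_def)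
      qed
      then have "D z = k z * d"
        unfolding k_def d_def by simp
      moreover have "cmod d \<le> 2 * 2 * 2"
      proof -
        have "cmod (\<tau> * z) \<le> 1 * 1" "cmod (\<tau>\<^sup>2 * z\<^sup>2) \<le> 1 * 1" "cmod (z * z) \<le> 1 * 1"
          unfolding norm_mult norm_power using T \<open>cmod z < 1\<close> by (intro mult_mono; simp add: power_le_one)+
        then have "cmod (1 + \<tau> * z) \<le> 2" "cmod (1 - \<tau>\<^sup>2 * z\<^sup>2) \<le> 2" "cmod (1 + z * z) \<le> 2"
          using norm_triangle_ineq[of 1 "\<tau> * z"] norm_triangle_ineq4[of 1 "\<tau>\<^sup>2 * z\<^sup>2"] norm_triangle_ineq[of 1 "z * z"]
          by auto
        then show ?thesis
          unfolding d_def norm_mult[of "_ * _"] norm_mult[of "1 + \<tau> * z"] by (intro mult_mono) auto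
      qed
      ultimately have "cmod (D z) \<le> ((1 / (\<kappa> * (1 - R)) + 2 * (Y * C)) * u / R) * (2 * 2 * 2)"
        unfolding \<open>D z = k z * d\<close> norm_mult using kz by (intro mult_mono) (auto intro: order_trans[OF norm_ge_zero])
      then show ?thesis
        by (simp add: C'_def mult_ac)
    qed
    have sub: "cball 0 R \<subseteq> ball (0::complex) 1"
      using R' by auto
    have "cmod (D \<zeta>) \<le> C' * u"
    proof (rule maximum_modulus_frontier[where f = D and S = "cball 0 R"])
      show "D holomorphic_on interior (cball 0 R)"
        by (rule holomorphic_on_subset[OF D(2)]) (use sub interior_subset in blast)
      show "continuous_on (closure (cball 0 R)) D"
        by (rule continuous_on_subset[OF D(1)]) (use R' in auto)
      show "cmod (D z) \<le> C' * u" if "z \<in> frontier (cball 0 R)" for z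
        using that circle[of z] by simp
    qed (use \<open>cmod \<zeta> \<le> R\<close> in auto)
    then show "cmod (G \<zeta> - lim_fun \<zeta>) \<le> C' * (\<epsilon> + (decay n + cmod (lim_fun \<tau> - G \<tau>)) / \<epsilon>)"
      by (simp add: D_def u_def \<delta>_def)
  qed
qed

end

section \<open>Asymptotically extremal polynomials\<close>

context disc_param
begin

text \<open>\<open>value_upper_bound\<close> and the sequence L squeeze G n \<tau> to its limit. For
  fixed \<epsilon> the stability bound then tends to C \<epsilon>, and \<epsilon> is
  arbitrary.\<close>

lemma extremal_convergence:
  fixes G :: "nat \<Rightarrow> complex \<Rightarrow> complex"
  assumes adm: "\<And>n. admissible n (G n)" and real: "\<And>n. Im (G n \<tau>) = 0"
    and lower: "\<And>n. L n \<le> Re (G n \<tau>)" "L \<longlonglongrightarrow> Re (lim_fun \<tau>)"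
    and R: "R < 1"
  shows "uniform_limit (cball 0 R) G lim_fun sequentially"
proof -
  \<comment> \<open>The radius is enlarged beyond T, as the stability estimate demands; \<rho> is
    then halfway between R' and 1.\<close>
  define R' where "R' = max R ((1 + T) / 2)"
  define \<rho> where "\<rho> = (1 + R') / 2"
  have R': "R \<le> R'" "T < R'" "R' < \<rho>" "\<rho> < 1"
    using R T by (auto simp: R'_def \<rho>_def max_def field_simps)
  have "\<exists>q. 0 < q \<and> q < 1 \<and> (\<forall>w. cmod w = \<rho> \<longrightarrow> cmod (bA w * bB w) \<le> q)"
  proof -
    have "continuous_on (sphere 0 \<rho>) (\<lambda>w. cmod (bA w * bB w))"
      using R' less_inverse_T
      by (intro continuous_intros continuous_on_subset[OF holomorphic_on_imp_continuous_on[OF holomorphic_b(1)]]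
          continuous_on_subset[OF holomorphic_on_imp_continuous_on[OF holomorphic_b(2)]]) auto
    moreover have "complex_of_real \<rho> \<in> sphere 0 \<rho>"
      using R' T by simp
    ultimately have "\<exists>w0\<in>sphere 0 \<rho>. \<forall>w\<in>sphere 0 \<rho>. cmod (bA w * bB w) \<le> cmod (bA w0 * bB w0)"
      by (intro continuous_attains_sup) auto
    then obtain w0 where w0: "cmod w0 = \<rho>" "\<And>w. cmod w = \<rho> \<Longrightarrow> cmod (bA w * bB w) \<le> cmod (bA w0 * bB w0)"
      unfolding Ball_def Bex_def mem_sphere_0 by blast
    have "cmod (bA w0) < 1" "cmod (bB w0) < 1"
      unfolding bA_blaschke bB_blaschke using w0(1) R' T by (intro norm_blaschke_less_1; simp)+
    then have "cmod (bA w0 * bB w0) < 1"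
      unfolding norm_mult using mult_strict_mono'[of "cmod (bA w0)" 1 "cmod (bB w0)" 1] by simp
    \<comment> \<open>The witness is max (1/2) m; the 1/2 secures positivity.\<close>
    moreover define m where "m = cmod (bA w0 * bB w0)"
    ultimately show ?thesis
      using w0(2)[folded m_def] by (intro exI[of _ "max (1/2) m"]) (auto intro: max.coboundedI2)
  qed
  then obtain q where qq: "0 < q" "q < 1" "\<And>w. cmod w = \<rho> \<Longrightarrow> cmod (bA w * bB w) \<le> q"
    by blast
  interpret disc_annulus T \<rho> q
    using R' qq by unfold_locales auto
  obtain C where C: "0 \<le> C"
    "\<And>n G (\<epsilon>::real) \<zeta>. \<lbrakk>admissible n G; decay n \<le> 1 / 2; 0 < \<epsilon>; \<epsilon> \<le> 1; cmod \<zeta> \<le> R'\<rbrakk>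
      \<Longrightarrow> cmod (G \<zeta> - lim_fun \<zeta>) \<le> C * (\<epsilon> + (decay n + cmod (lim_fun \<tau> - G \<tau>)) / \<epsilon>)"
    using stability[OF R'(2,3)] by blast
  have "(\<lambda>n. q ^ Suc n / \<rho>\<^sup>2) \<longlonglongrightarrow> 0 / \<rho>\<^sup>2"
    using qq by (intro tendsto_divide LIMSEQ_Suc[OF LIMSEQ_power_zero] tendsto_const) (use R' T in auto)
  then have decay: "decay \<longlonglongrightarrow> 0"
    by (simp add: decay_def[abs_def])
  define B where "B = (1 + T\<^sup>2) * (1 - T ^ 4) * (8 * weight_bound + 1 / ((1 + T\<^sup>2) * (1 - T ^ 4)))"
  have half: "\<forall>\<^sub>F n in sequentially. decay n \<le> 1 / 2"
    using order_tendstoD(2)[OF decay, of "1/2"] by (auto elim: eventually_mono)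
  have lim: "(\<lambda>n. G n \<tau>) \<longlonglongrightarrow> lim_fun \<tau>"
  proof -
    have "(\<lambda>n. Re (G n \<tau>)) \<longlonglongrightarrow> Re (lim_fun \<tau>)"
    proof (rule tendsto_sandwich[OF _ _ lower(2)])
      show "\<forall>\<^sub>F n in sequentially. Re (G n \<tau>) \<le> Re (lim_fun \<tau>) + B * decay n"
        using half by eventually_elim (simp add: B_def value_upper_bound[OF adm])
      have "(\<lambda>n. Re (lim_fun \<tau>) + B * decay n) \<longlonglongrightarrow> Re (lim_fun \<tau>) + B * 0"
        by (intro tendsto_intros decay)
      then show "(\<lambda>n. Re (lim_fun \<tau>) + B * decay n) \<longlonglongrightarrow> Re (lim_fun \<tau>)"
        by simp
    qed (use lower(1) in simp)
    moreover have "Im (lim_fun \<tau>) = 0"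
      using arg_cong[OF lim_fun_\<tau>, of Im] by (simp add: power2_eq_square)
    ultimately show ?thesis
      using real by (simp add: tendsto_complex_iff)
  qed
  show ?thesis
  proof (rule uniform_limitI)
    fix e :: real assume "0 < e"
    \<comment> \<open>C + 1 in the denominator allows C = 0 and still gives C \<epsilon> <
      e.\<close>
    define \<epsilon> where "\<epsilon> = min 1 (e / (2 * (C + 1)))"
    have \<epsilon>: "0 < \<epsilon>" "\<epsilon> \<le> 1"
      using \<open>0 < e\<close> C(1) by (auto simp: \<epsilon>_def)
    have "(\<lambda>n. C * (\<epsilon> + (decay n + cmod (lim_fun \<tau> - G n \<tau>)) / \<epsilon>)) \<longlonglongrightarrow> C * (\<epsilon> + (0 + cmod (lim_fun \<tau> - lim_fun \<tau>)) / \<epsilon>)"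
      by (intro tendsto_intros decay lim) (use \<epsilon> in auto)
    moreover have "C * (\<epsilon> + (0 + cmod (lim_fun \<tau> - lim_fun \<tau>)) / \<epsilon>) < e"
    proof -
      have "C * \<epsilon> \<le> C * (e / (2 * (C + 1)))"
        using C(1) by (intro mult_left_mono) (auto simp: \<epsilon>_def)
      also have "\<dots> < e"
        using C(1) \<open>0 < e\<close> by (simp add: field_simps add_strict_increasing)
      finally show ?thesis
        by simp
    qed
    ultimately have "\<forall>\<^sub>F n in sequentially. C * (\<epsilon> + (decay n + cmod (lim_fun \<tau> - G n \<tau>)) / \<epsilon>) < e"
      by (rule order_tendstoD)
    then show "\<forall>\<^sub>F n in sequentially. \<forall>\<zeta>\<in>cball 0 R. dist (G n \<zeta>) (lim_fun \<zeta>) < e"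
      using half
    proof eventually_elim
      case (elim n)
      show ?case
      proof
        fix \<zeta> :: complex assume "\<zeta> \<in> cball 0 R"
        then have "cmod (G n \<zeta> - lim_fun \<zeta>) \<le> C * (\<epsilon> + (decay n + cmod (lim_fun \<tau> - G n \<tau>)) / \<epsilon>)"
          using R'(1) by (intro C(2) adm elim(2) \<epsilon>) auto
        then show "dist (G n \<zeta>) (lim_fun \<zeta>) < e"
          using elim(1) by (simp add: dist_norm)
      qed
    qed
  qed
qed

section \<open>Polynomials as forms of degree n in A and B\<close>

definition homog :: "nat \<Rightarrow> complex poly \<Rightarrow> complex \<Rightarrow> complex" where
  "homog n P w = (\<Sum>k\<le>n. coeff P k * bA w ^ k * bB w ^ (n - k))"

text \<open>\<open>homog\<close> is defined as a form, and not as this product, because it must be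
  analytic at \<tau> too, where B vanishes and u is infinite.\<close>

lemma homog_eq:
  assumes "degree P \<le> n" and "bB w \<noteq> 0"
  shows "homog n P w = bB w ^ n * poly P (bA w / bB w)"
proof -
  have "poly P x = (\<Sum>k\<le>n. coeff P k * x ^ k)" for x
    unfolding poly_altdef using assms(1)
    by (intro sum.mono_neutral_left) (auto simp: coeff_eq_0)
  moreover have "bA w ^ k * bB w ^ (n - k) = bB w ^ n * (bA w / bB w) ^ k" if "k \<le> n" for k
    using assms(2) that by (simp add: power_divide power_diff)
  ultimately show ?thesis
    unfolding homog_def sum_distrib_left mult.assoc
    by (auto intro!: sum.cong simp: sum_distrib_left mult.left_commute)
qed

lemma bB_\<tau>: "bB \<tau> = 0" and bA_\<tau>: "bA \<tau> = of_real (2 * T / (1 + T\<^sup>2))"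
  by (simp_all add: bA_def bB_def power2_eq_square)

text \<open>B vanishes at \<tau>, so only the top power of A is left. This turns the extremal
  problem for the leading coefficient into one for G(\<tau>).\<close>

lemma homog_\<tau>: "homog n P \<tau> = coeff P n * bA \<tau> ^ n"
proof -
  have "homog n P \<tau> = (\<Sum>k\<in>{n}. coeff P k * bA \<tau> ^ k * bB \<tau> ^ (n - k))"
    unfolding homog_def by (rule sum.mono_neutral_right) (auto simp: bB_\<tau>)
  then show ?thesis
    by simp
qed

lemma holomorphic_homog: "homog n P holomorphic_on ball 0 (1 / T)"
  unfolding homog_def by (intro holomorphic_intros holomorphic_b)

text \<open>The reflection law arises because w and - 1 / w have the same quotient A / B. The bound
  spreads from the circle to the disc by the maximum principle.\<close>

lemma homog_admissible:
  assumes "degree P \<le> n" and P: "\<And>w. cmod w = 1 \<Longrightarrow> cmod (poly P (bA w / bB w)) \<le> 1"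
  shows "admissible n (homog n P)"
  unfolding admissible_def
proof (intro conjI allI impI holomorphic_homog)
  have nz: "bB w \<noteq> 0" "bA w \<noteq> 0" if "cmod w = 1" for w
    using norm_b_circle[OF that] by auto
  have circle: "cmod (homog n P w) \<le> 1" if "cmod w = 1" for w
    using P[OF that] by (simp add: homog_eq[OF assms(1) nz(1)[OF that]] norm_mult norm_power norm_b_circle that)
  fix w :: complex
  have sub: "cball 0 1 \<subseteq> ball (0::complex) (1 / T)"
    using less_inverse_T by auto
  show "cmod (homog n P w) \<le> 1" if "cmod w \<le> 1"
  proof (rule maximum_modulus_frontier[where f = "homog n P" and S = "cball 0 1"])
    show "homog n P holomorphic_on interior (cball 0 1)"
      using sub interior_subset by (blast intro: holomorphic_on_subset[OF holomorphic_homog])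
    show "continuous_on (closure (cball 0 1)) (homog n P)"
      using sub by (auto intro: continuous_on_subset[OF holomorphic_on_imp_continuous_on[OF holomorphic_homog]])
  qed (use circle that in auto)
  show "homog n P w = (- 1) ^ n * (bA w * bB w) ^ n * homog n P (- 1 / w)" if w: "cmod w = 1"
  proof -
    have "bB (- 1 / w) \<noteq> 0"
      using nz[of "- 1 / w"] w by (simp add: norm_divide)
    moreover have "bA (- 1 / w) / bB (- 1 / w) = bA w / bB w"
      unfolding reflection_b[OF circle_nonzero(1)[OF w]] by simp
    ultimately have "homog n P (- 1 / w) = (- 1 / bA w) ^ n * poly P (bA w / bB w)"
      using homog_eq[OF assms(1)] reflection_b(2)[OF circle_nonzero(1)[OF w]] by metis
    then show ?thesis
      using nz[OF w] by (cases "even n") (simp_all add: homog_eq[OF assms(1)] power_divide power_mult_distrib)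
  qed
qed

section \<open>Trial polynomials built from power sums\<close>

definition \<gamma> :: complex where
  "\<gamma> = (1 + \<tau>\<^sup>2) / (2 * \<tau>)"

fun lucas :: "nat \<Rightarrow> complex poly" where
  "lucas 0 = [:2:]"
| "lucas (Suc 0) = [:\<gamma>, - \<gamma>:]"
| "lucas (Suc (Suc m)) = [:\<gamma>, - \<gamma>:] * lucas (Suc m) + [:0, 1:] * lucas m"

lemma degree_lucas: "degree (lucas m) \<le> m"
proof (induction m rule: lucas.induct)
  case (3 m)
  have "degree ([:\<gamma>, - \<gamma>:] * lucas (Suc m)) \<le> degree [:\<gamma>, - \<gamma>:] + degree (lucas (Suc m))"
    "degree ([:0, 1:] * lucas m) \<le> degree [:0, 1::complex:] + degree (lucas m)"
    by (rule degree_mult_le)+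
  moreover have "degree [:\<gamma>, - \<gamma>:] \<le> 1" "degree [:0, 1::complex:] \<le> 1"
    by simp_all
  ultimately show ?case
    using 3 by (auto intro!: degree_add_le)
qed auto

text \<open>Both A - 1 / B and 1 - A / B are constant multiples of (w^2 - 1) / ((1 + \<tau> w) (w -
  \<tau>)), and \<gamma> is the ratio of the constants. The identity also shows later that small B
  forces large u.\<close>

lemma bA_minus_inverse_bB:
  assumes "cmod w \<le> 1" and "bB w \<noteq> 0"
  shows "bA w - 1 / bB w = \<gamma> * (1 - bA w / bB w)"
proof -
  have nz: "1 + \<tau> * w \<noteq> 0" "1 - \<tau> * w \<noteq> 0" "w - \<tau> \<noteq> 0" "\<tau> \<noteq> 0"
    using assms denominators_disc[of w] T by (auto simp: bB_def)
  have "bA w - 1 / bB w = ((w + \<tau>) * (w - \<tau>) - (1 - \<tau> * w) * (1 + \<tau> * w)) / ((1 + \<tau> * w) * (w - \<tau>))"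
    unfolding bA_def bB_def using nz by (simp add: divide_simps)
  also have "(w + \<tau>) * (w - \<tau>) - (1 - \<tau> * w) * (1 + \<tau> * w) = (1 + \<tau>\<^sup>2) * (w\<^sup>2 - 1)"
    by (simp add: algebra_simps power2_eq_square)
  finally have 1: "bA w - 1 / bB w = (1 + \<tau>\<^sup>2) * (w\<^sup>2 - 1) / ((1 + \<tau> * w) * (w - \<tau>))" .
  have "1 - bA w / bB w = ((1 + \<tau> * w) * (w - \<tau>) - (w + \<tau>) * (1 - \<tau> * w)) / ((1 + \<tau> * w) * (w - \<tau>))"
    unfolding bA_def bB_def using nz by (simp add: divide_simps)
  also have "(1 + \<tau> * w) * (w - \<tau>) - (w + \<tau>) * (1 - \<tau> * w) = 2 * \<tau> * (w\<^sup>2 - 1)"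
    by (simp add: algebra_simps power2_eq_square)
  finally have 2: "1 - bA w / bB w = 2 * \<tau> * (w\<^sup>2 - 1) / ((1 + \<tau> * w) * (w - \<tau>))" .
  show ?thesis
    unfolding 1 2 \<gamma>_def using nz by simp
qed

text \<open>\<open>bA w\<close> and \<open>- 1 / bB w\<close> are the roots of \<open>X\<^sup>2 - \<gamma> (1 - u) X - u\<close> for \<open>u = bA w / bB w\<close>, so their
  power sums are polynomials in \<open>u\<close>.\<close>

lemma poly_lucas:
  assumes "cmod w \<le> 1" and "bB w \<noteq> 0"
  shows "poly (lucas m) (bA w / bB w) = bA w ^ m + (- 1 / bB w) ^ m"
proof (induction m rule: lucas.induct)
  case 2
  show ?case
    using bA_minus_inverse_bB[OF assms] by (simp add: algebra_simps)
next
  case (3 m)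
  define x y u where "x = bA w" and "y = - 1 / bB w" and "u = bA w / bB w"
  have s: "\<gamma> - u * \<gamma> = x + y" and p: "u = - (x * y)"
    using bA_minus_inverse_bB[OF assms] by (simp_all add: x_def y_def u_def algebra_simps)
  have ih: "poly (lucas (Suc m)) u = x ^ Suc m + y ^ Suc m" "poly (lucas m) u = x ^ m + y ^ m"
    using 3 unfolding x_def y_def u_def by blast+
  have "poly (lucas (Suc (Suc m))) u = (\<gamma> - u * \<gamma>) * poly (lucas (Suc m)) u + u * poly (lucas m) u"
    by (simp add: algebra_simps)
  also have "\<dots> = (x + y) * (x ^ Suc m + y ^ Suc m) - (x * y) * (x ^ m + y ^ m)"
    unfolding s ih by (simp add: p)
  also have "\<dots> = x ^ Suc (Suc m) + y ^ Suc (Suc m)"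
    by (simp add: algebra_simps)
  finally show ?case
    by (simp add: x_def y_def u_def)
qed simp

text \<open>Since 1 - \<tau> A = (1 - \<tau>^2) / (1 + \<tau> w), the limit function is
  \<open>trial_scale\<close> / (1 - \<tau> A)^2, and \<open>trial_limit\<close> is a partial sum of
  its expansion in powers of \<tau> A.\<close>

definition trial_scale :: real where
  "trial_scale = (1 - T\<^sup>2)\<^sup>2 / (2 * (1 + T\<^sup>2))"

definition trial_limit :: "nat \<Rightarrow> complex \<Rightarrow> complex" where
  "trial_limit n w = of_real trial_scale * (\<Sum>k<n. of_nat (Suc k) * (\<tau> * bA w) ^ k)"

text \<open>In B^n u^k (A^(n-k) + (- 1 / B)^(n-k)) the second root yields the wanted power A^k up to
  sign and the first root its partner A^n B^(n-k). The signs (- 1)^n and (- \<tau>)^k cancel the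
  sign (- 1)^(n-k) of the second root.\<close>

definition trial :: "nat \<Rightarrow> complex poly" where
  "trial n = smult ((- 1) ^ n * of_real trial_scale)
     (\<Sum>k<n. smult (of_nat (Suc k) * (- \<tau>) ^ k) (monom 1 k * lucas (n - k)))"

lemma degree_trial: "degree (trial n) \<le> n"
proof -
  have "degree (smult (of_nat (Suc k) * (- \<tau>) ^ k) (monom 1 k * lucas (n - k))) \<le> n" if "k < n" for k
  proof -
    have "degree (monom (1::complex) k * lucas (n - k)) \<le> degree (monom (1::complex) k) + degree (lucas (n - k))"
      by (rule degree_mult_le)
    also have "\<dots> \<le> k + (n - k)"
      by (intro add_mono degree_monom_le degree_lucas)
    also have "\<dots> = n"
      using that by simp
    finally show ?thesis
      by (rule order_trans[OF degree_smult_le])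
  qed
  then show ?thesis
    unfolding trial_def by (intro order_trans[OF degree_smult_le degree_sum_le]) blast+
qed

lemma homog_trial:
  assumes "cmod w \<le> 1" and B: "bB w \<noteq> 0"
  shows "homog n (trial n) w = trial_limit n w
    + of_real trial_scale * (\<Sum>k<n. of_nat (Suc k) * (- \<tau>) ^ k * (- bA w) ^ n * bB w ^ (n - k))"
proof -
  define x y where "x = bA w" and "y = - 1 / bB w"
  have *: "bA w / bB w = - (x * y)"
    by (simp add: x_def y_def)
  have lu: "x ^ j + y ^ j = poly (lucas j) (bA w / bB w)" for j
    by (simp add: poly_lucas[OF assms] x_def y_def)
  have By: "bB w * y = - 1"
    using B by (simp add: y_def)
  have summand: "(- 1) ^ n * bB w ^ n * ((- \<tau>) ^ k * ((- (x * y)) ^ k * (x ^ (n - k) + y ^ (n - k))))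
    = (\<tau> * x) ^ k + (- \<tau>) ^ k * (- x) ^ n * bB w ^ (n - k)" if "k < n" for k
  proof -
    have n: "n = k + (n - k)"
      using that by simp
    have pow: "z ^ n = z ^ k * z ^ (n - k)" for z :: complex
      by (subst n) (rule power_add)
    have Byk: "bB w ^ k * y ^ k = (- 1) ^ k" "bB w ^ (n - k) * y ^ (n - k) = (- 1) ^ (n - k)"
      unfolding power_mult_distrib[symmetric] By by simp_all
    have "(- 1) ^ n * bB w ^ n * ((- \<tau>) ^ k * ((- (x * y)) ^ k * (x ^ (n - k) + y ^ (n - k))))
      = (- 1) ^ n * (- \<tau>) ^ k * (- x) ^ k * (bB w ^ k * y ^ k) * (bB w ^ (n - k) * x ^ (n - k) + bB w ^ (n - k) * y ^ (n - k))"
      unfolding pow[of "bB w"] by (simp add: power_mult_distrib power_minus[of "x * y"] power_minus[of x] algebra_simps)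
    also have "\<dots> = (\<tau> * x) ^ k + (- \<tau>) ^ k * (- x) ^ n * bB w ^ (n - k)"
      unfolding Byk pow[of "- 1"] pow[of "- x"] pow[of x] power_minus[of \<tau>] power_minus[of x] power_mult_distrib
      using pow[of x] by (cases "even k"; cases "even (n - k)") (simp_all add: algebra_simps)
    finally show ?thesis .
  qed
  have "homog n (trial n) w = of_real trial_scale * (\<Sum>k<n. of_nat (Suc k) *
      ((- 1) ^ n * bB w ^ n * ((- \<tau>) ^ k * ((- (x * y)) ^ k * (x ^ (n - k) + y ^ (n - k))))))"
    unfolding * [symmetric] lu
    by (subst homog_eq[OF degree_trial B]) (simp add: trial_def poly_sum poly_monom sum_distrib_left mult_ac)
  also have "\<dots> = of_real trial_scale * (\<Sum>k<n. of_nat (Suc k) * ((\<tau> * x) ^ k + (- \<tau>) ^ k * (- x) ^ n * bB w ^ (n - k)))"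
    by (intro arg_cong[of _ _ "\<lambda>s. of_real trial_scale * s"] sum.cong refl) (simp add: summand)
  finally show ?thesis
    by (simp add: trial_limit_def x_def distrib_left sum.distrib mult_ac)
qed

text \<open>\<open>homog_trial\<close> divides by B, so the identity is continued to the zero \<tau>
  of B. There the partner terms vanish: the sum stops before k = n, so each of them keeps a factor
  B.\<close>

lemma homog_trial_\<tau>: "homog n (trial n) \<tau> = trial_limit n \<tau>"
proof -
  define f where "f = (\<lambda>w. trial_limit n w
    + of_real trial_scale * (\<Sum>k<n. of_nat (Suc k) * (- \<tau>) ^ k * (- bA w) ^ n * bB w ^ (n - k)))"
  have \<tau>: "\<tau> \<in> ball 0 (1 / T)"
    using less_inverse_T[of \<tau>] T by auto
  have c: "isCont bA \<tau>" "isCont bB \<tau>" "isCont (homog n (trial n)) \<tau>"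
    using holomorphic_b holomorphic_homog \<tau>
    by (meson continuous_on_eq_continuous_at holomorphic_on_imp_continuous_on open_ball)+
  have "isCont f \<tau>"
    unfolding f_def trial_limit_def by (intro continuous_intros c)
  then have "(f \<longlongrightarrow> f \<tau>) (at \<tau>)"
    by (simp add: isCont_def)
  moreover have "\<forall>\<^sub>F w in at \<tau>. homog n (trial n) w = f w"
  proof -
    have "\<forall>\<^sub>F w in at \<tau>. w \<in> ball 0 1"
      using T by (intro eventually_at_in_open') auto
    moreover have "\<forall>\<^sub>F w in at \<tau>. w \<noteq> \<tau>"
      by (simp add: eventually_at_filter)
    ultimately show ?thesis
    proof eventually_elim
      case (elim w)
      then have "bB w \<noteq> 0"
        using denominators_disc(2)[of w] by (simp add: bB_def)
      then show ?case
        unfolding f_def using elim by (intro homog_trial) auto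
    qed
  qed
  then have "(homog n (trial n) \<longlongrightarrow> homog n (trial n) \<tau>) (at \<tau>) \<longleftrightarrow> (f \<longlongrightarrow> homog n (trial n) \<tau>) (at \<tau>)"
    by (intro tendsto_cong)
  ultimately have "homog n (trial n) \<tau> = f \<tau>"
    using c(3) by (metis isCont_def tendsto_unique trivial_limit_at)
  also have "f \<tau> = trial_limit n \<tau>"
    by (auto simp: f_def bB_\<tau> power_0_left intro!: sum.neutral)
  finally show ?thesis .
qed

text \<open>The tail of the expansion of the limit function with |\<tau> A| replaced by its bound T
  on the closed disc.\<close>

definition trial_error :: "nat \<Rightarrow> real" where
  "trial_error n = trial_scale * (1 / (1 - T)\<^sup>2 - (\<Sum>k<n. real (Suc k) * T ^ k))"

lemma trial_scale_pos: "0 < trial_scale"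
  unfolding trial_scale_def using T_power_bounds(1,2) by simp

lemma sums_T: "(\<lambda>k. real (Suc k) * T ^ k) sums (1 / (1 - T)\<^sup>2)"
  using geometric_deriv_sums[of T] T by simp

lemma trial_error_tendsto: "trial_error \<longlonglongrightarrow> 0"
proof -
  have "trial_error \<longlonglongrightarrow> trial_scale * (1 / (1 - T)\<^sup>2 - 1 / (1 - T)\<^sup>2)"
    unfolding trial_error_def[abs_def] by (intro tendsto_intros sums_T[unfolded sums_def])
  then show ?thesis
    by simp
qed

lemma norm_trial_limit_minus:
  assumes w: "cmod w \<le> 1"
  shows "cmod (trial_limit n w - lim_fun w) \<le> trial_error n" and "0 \<le> trial_error n"
proof -
  define a where "a = (\<lambda>k. of_nat (Suc k) * (\<tau> * bA w) ^ k)"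
  have "cmod (\<tau> * bA w) \<le> T * 1"
    unfolding norm_mult using norm_b_disc[OF w] T by (intro mult_mono) auto
  then have \<tau>A: "cmod (\<tau> * bA w) \<le> T" "cmod (\<tau> * bA w) < 1"
    using T by auto
  have "1 - \<tau> * bA w = (1 - \<tau>\<^sup>2) / (1 + \<tau> * w)"
    unfolding bA_def using denominators_disc[OF w] by (simp add: field_simps power2_eq_square)
  then have lim_fun: "lim_fun w = of_real trial_scale * (1 / (1 - \<tau> * bA w)\<^sup>2)"
    using one_plus_T_square_nonzero denominators_disc(1)[OF w]
    by (simp add: lim_fun_def trial_scale_def power_divide)
  have sums: "a sums (1 / (1 - \<tau> * bA w)\<^sup>2)"
    unfolding a_def by (rule geometric_deriv_sums[OF \<tau>A(2)])
  have sum_a: "sum a {..<n} + suminf (\<lambda>k. a (k + n)) = 1 / (1 - \<tau> * bA w)\<^sup>2"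
    using suminf_split_initial_segment[OF sums_summable[OF sums], of n] sums_unique[OF sums] by simp
  have sum_T: "(\<Sum>k<n. real (Suc k) * T ^ k) + suminf (\<lambda>k. real (Suc (k + n)) * T ^ (k + n)) = 1 / (1 - T)\<^sup>2"
    using suminf_split_initial_segment[OF sums_summable[OF sums_T], of n] sums_unique[OF sums_T] by simp
  have summ: "summable (\<lambda>k. real (Suc (k + n)) * T ^ (k + n))"
    using summable_ignore_initial_segment[OF sums_summable[OF sums_T], of n] .
  have "cmod (suminf (\<lambda>k. a (k + n))) \<le> suminf (\<lambda>k. real (Suc (k + n)) * T ^ (k + n))"
  proof (rule norm_suminf_le[OF _ summ])
    fix k
    have "cmod (of_nat (Suc (k + n))) * cmod (\<tau> * bA w) ^ (k + n) \<le> real (Suc (k + n)) * T ^ (k + n)"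
      using \<tau>A(1) unfolding norm_of_nat by (intro mult_left_mono power_mono) auto
    then show "cmod (a (k + n)) \<le> real (Suc (k + n)) * T ^ (k + n)"
      unfolding a_def norm_mult[of "of_nat _"] norm_power .
  qed
  moreover have "trial_limit n w - lim_fun w = - of_real trial_scale * suminf (\<lambda>k. a (k + n))"
    unfolding trial_limit_def lim_fun sum_a[symmetric] a_def[symmetric] by (simp add: a_def algebra_simps)
  moreover have trial_error: "trial_error n = trial_scale * suminf (\<lambda>k. real (Suc (k + n)) * T ^ (k + n))"
    unfolding trial_error_def sum_T[symmetric] by simp
  ultimately show "cmod (trial_limit n w - lim_fun w) \<le> trial_error n"
    using trial_scale_pos by (simp add: norm_mult)
  then show "0 \<le> trial_error n"
    using norm_ge_zero order_trans by blast
qed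

text \<open>The partner sum is the reflected \<open>trial_limit\<close> times a factor of modulus 1.
  Up to one \<open>trial_error\<close> each, the two moduli are |f(w)| and |f(- 1 / w)|, which add
  up to 1 by the parallelogram law for 1 and \<tau> w.\<close>

lemma norm_trial:
  assumes w: "cmod w = 1"
  shows "cmod (poly (trial n) (bA w / bB w)) \<le> 1 + 2 * trial_error n"
proof -
  have nz: "bB w \<noteq> 0" "w \<noteq> 0"
    using norm_b_circle[OF w] w by auto
  have w': "cmod (- 1 / w) = 1"
    using w by (simp add: norm_divide)
  have "of_real trial_scale * (\<Sum>k<n. of_nat (Suc k) * (- \<tau>) ^ k * (- bA w) ^ n * bB w ^ (n - k))
      = (- bA w * bB w) ^ n * trial_limit n (- 1 / w)"
  proof -
    have "(- \<tau>) ^ k * (- bA w) ^ n * bB w ^ (n - k) = (- bA w * bB w) ^ n * (\<tau> * bA (- 1 / w)) ^ k" if "k < n" for k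
      unfolding reflection_b[OF nz(2)] using nz that
      by (simp add: power_mult_distrib power_diff power_divide power_minus[of \<tau>] power_minus[of "inverse _"] power_minus[of "\<tau> / _"]
          power_minus[of "bA w"] power_minus[of "bA w * bB w"])
    then show ?thesis
      unfolding trial_limit_def by (simp add: sum_distrib_left mult_ac)
  qed
  then have "homog n (trial n) w = trial_limit n w + (- bA w * bB w) ^ n * trial_limit n (- 1 / w)"
    using homog_trial[of w n] w nz by simp
  then have "cmod (homog n (trial n) w) \<le> cmod (trial_limit n w) + cmod (trial_limit n (- 1 / w))"
    using norm_triangle_ineq[of "trial_limit n w" "(- bA w * bB w) ^ n * trial_limit n (- 1 / w)"]
    by (simp add: norm_mult norm_power norm_b_circle[OF w])
  also have "\<dots> \<le> (cmod (lim_fun w) + trial_error n) + (cmod (lim_fun (- 1 / w)) + trial_error n)"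
    using norm_trial_limit_minus(1)[of w n] norm_trial_limit_minus(1)[of "- 1 / w" n] w w'
      norm_triangle_sub[of "trial_limit n w" "lim_fun w"] norm_triangle_sub[of "trial_limit n (- 1 / w)" "lim_fun (- 1 / w)"] by linarith
  also have "\<dots> = 1 + 2 * trial_error n"
  proof -
    have lim_fun: "cmod (lim_fun z) = (cmod (1 + \<tau> * z))\<^sup>2 / (2 * (1 + T\<^sup>2))" for z
    proof -
      have "2 * (1 + \<tau>\<^sup>2) = of_real (2 * (1 + T\<^sup>2))"
        by simp
      then have "cmod (2 * (1 + \<tau>\<^sup>2)) = 2 * (1 + T\<^sup>2)"
        by (simp only: norm_of_real) (simp add: add_nonneg_nonneg)
      then show ?thesis
        by (simp only: lim_fun_def norm_divide norm_power)
    qed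
    have "1 / w = cnj w"
      using w by (metis complex_norm_square divide_eq_eq mult.commute nz(2) of_real_1 power_one)
    then have "(cmod (1 + \<tau> * w))\<^sup>2 + (cmod (1 + \<tau> * (- 1 / w)))\<^sup>2 = 2 * (1 + T\<^sup>2 * ((Re w)\<^sup>2 + (Im w)\<^sup>2))"
      by (simp add: cmod_power2) (simp add: power2_eq_square algebra_simps)
    also have "(Re w)\<^sup>2 + (Im w)\<^sup>2 = 1"
      using w by (metis cmod_power2 power_one)
    finally have "cmod (lim_fun w) + cmod (lim_fun (- 1 / w)) = 2 * (1 + T\<^sup>2) / (2 * (1 + T\<^sup>2))"
      unfolding lim_fun add_divide_distrib[symmetric] by simp
    also have "\<dots> = 1"
      using add_pos_nonneg[of 1 "T\<^sup>2"] by simp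
    finally show ?thesis
      by simp
  qed
  finally show ?thesis
    unfolding homog_eq[OF degree_trial nz(1)] by (simp add: norm_mult norm_power norm_b_circle[OF w])
qed

end

section \<open>The conformal maps\<close>

lemma mem_\<Omega>\<^sub>0_iff: "z \<in> \<Omega>\<^sub>0 \<longleftrightarrow> \<not> (Im z = 0 \<and> 1 \<le> \<bar>Re z\<bar>)"
proof -
  have "z \<in> complex_of_real ` {-1<..<1} \<longleftrightarrow> Im z = 0 \<and> \<bar>Re z\<bar> < 1"
    by (auto simp: image_iff complex_eq_iff intro!: bexI[of _ "Re z"])
  then show ?thesis
    unfolding \<Omega>\<^sub>0_def by (auto simp: complex_is_Real_iff)
qed

lemma open_\<Omega>\<^sub>0: "open \<Omega>\<^sub>0"
proof -
  have "\<Omega>\<^sub>0 = - ({z. Im z = 0} \<inter> {z. 1 \<le> \<bar>Re z\<bar>})"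
    by (auto simp: mem_\<Omega>\<^sub>0_iff)
  moreover have "closed ({z. Im z = 0} \<inter> {z. 1 \<le> \<bar>Re z\<bar>})"
    by (intro closed_Int closed_Collect_eq closed_Collect_le continuous_intros)
  ultimately show ?thesis
    by (metis open_Compl)
qed

lemma mem_arc_iff:
  assumes "0 < \<alpha>" and "\<alpha> < pi"
  shows "u \<in> arc \<alpha> \<longleftrightarrow> cmod u = 1 \<and> cos \<alpha> \<le> Re u"
proof (cases "cmod u = 1")
  case True
  then have "u \<noteq> 0"
    by auto
  then have "cos \<alpha> \<le> Re u \<longleftrightarrow> cos \<alpha> \<le> cos \<bar>Arg u\<bar>"
    using True by (simp add: cos_Arg)
  also have "\<dots> \<longleftrightarrow> \<bar>Arg u\<bar> \<le> \<alpha>"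
    using assms Arg_bounded[of u] by (intro cos_mono_le_eq) auto
  finally show ?thesis
    using True by (auto simp: arc_def abs_le_iff)
qed (auto simp: arc_def)

section \<open>The slit plane as conformal image of the unit disc\<close>

definition slit_of :: "complex \<Rightarrow> complex" where
  "slit_of w = - 2 * \<i> * w / (1 - w\<^sup>2)"

definition disc_of :: "complex \<Rightarrow> complex" where
  "disc_of z = \<i> * z / (1 + csqrt (1 - z\<^sup>2))"

lemma one_minus_square_nonzero:
  fixes w :: complex
  assumes "cmod w < 1"
  shows "1 - w\<^sup>2 \<noteq> 0" "1 + w\<^sup>2 \<noteq> 0"
proof -
  have "cmod (w\<^sup>2) \<noteq> 1"
    using assms abs_square_less_1[of "cmod w"] by (simp add: norm_power)
  then show "1 - w\<^sup>2 \<noteq> 0" "1 + w\<^sup>2 \<noteq> 0"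
    by (metis norm_one right_minus_eq, metis add_eq_0_iff norm_minus_cancel norm_one)
qed

text \<open>\<open>slit_of\<close> takes equal values at w and - 1 / w, which accounts for both
  factors. Injectivity, the Blaschke form of u and the logarithmic poles are all read off from this
  factorization.\<close>

lemma slit_of_diff:
  assumes "cmod w < 1" and "cmod v < 1"
  shows "slit_of w - slit_of v = - 2 * \<i> * (w - v) * (1 + w * v) / ((1 - w\<^sup>2) * (1 - v\<^sup>2))"
  unfolding slit_of_def using one_minus_square_nonzero assms
  by (simp add: divide_simps) (simp add: algebra_simps power2_eq_square)

lemma one_plus_mult_nonzero:
  assumes "cmod w < 1" and "cmod v < 1"
  shows "1 + w * v \<noteq> 0"
proof -
  have "cmod w * cmod v < 1"
    using mult_strict_mono'[of "cmod w" 1 "cmod v" 1] assms by simp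
  then show ?thesis
    using blaschke_denominator_nonzero[of "- cnj w" v] by simp
qed

lemma inj_on_slit_of: "inj_on slit_of (ball 0 1)"
proof (rule inj_onI)
  fix w v assume *: "w \<in> ball 0 1" "v \<in> ball 0 1" "slit_of w = slit_of v"
  then have "(w - v) * (1 + w * v) / ((1 - w\<^sup>2) * (1 - v\<^sup>2)) = 0"
    using slit_of_diff[of w v] by simp
  then show "w = v"
    using * one_minus_square_nonzero one_plus_mult_nonzero[of w v] by auto
qed

lemma slit_of_mem:
  assumes w: "cmod w < 1"
  shows "slit_of w \<in> \<Omega>\<^sub>0"
proof (rule ccontr)
  assume "slit_of w \<notin> \<Omega>\<^sub>0"
  then have z: "Im (slit_of w) = 0" "1 \<le> \<bar>Re (slit_of w)\<bar>"
    by (auto simp: mem_\<Omega>\<^sub>0_iff)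
  define x where "x = Re (slit_of w)"
  define s where "s = sqrt (x\<^sup>2 - 1)"
  have x1: "1 \<le> x\<^sup>2"
    using z(2) by (simp add: x_def abs_le_square_iff[of 1, simplified])
  have "of_real x = slit_of w"
    using z(1) by (simp add: x_def complex_eq_iff)
  then have "of_real x * (1 - w\<^sup>2) = - 2 * \<i> * w"
    unfolding slit_of_def using one_minus_square_nonzero[OF w] by simp
  \<comment> \<open>After multiplication by x the square is completed. Then x w is \<i> + s or \<i>
    - s with s real, so |x w|^2 = 1 + s^2 = x^2, which forces |w| = 1.\<close>
  then have "(of_real x * w - \<i>)\<^sup>2 = (of_real x)\<^sup>2 - 1"
    by (simp add: power2_eq_square algebra_simps) algebra
  also have "\<dots> = (of_real s)\<^sup>2"
    using x1 unfolding of_real_power[symmetric] s_def by simp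
  finally have "of_real x * w = \<i> + of_real s \<or> of_real x * w = \<i> - of_real s"
    by (auto simp: power2_eq_iff algebra_simps)
  then have "(cmod (of_real x * w))\<^sup>2 = 1 + s\<^sup>2"
    by (elim disjE; simp only: cmod_power2; simp)
  also have "\<dots> = x\<^sup>2"
    using x1 by (simp add: s_def)
  finally have "x\<^sup>2 * (cmod w)\<^sup>2 = x\<^sup>2"
    by (simp add: norm_mult power_mult_distrib)
  then have "(cmod w)\<^sup>2 = 1"
    using x1 by auto
  then show False
    using w abs_square_less_1[of "cmod w"] by simp
qed

lemma csqrt_argument:
  assumes "z \<in> \<Omega>\<^sub>0"
  shows "1 - z\<^sup>2 \<notin> \<real>\<^sub>\<le>\<^sub>0"
proof
  assume "1 - z\<^sup>2 \<in> \<real>\<^sub>\<le>\<^sub>0"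
  then have "Im (z\<^sup>2) = 0" "1 \<le> Re (z\<^sup>2)"
    by (auto simp: complex_nonpos_Reals_iff)
  then have *: "Re z * Im z = 0" "1 \<le> (Re z)\<^sup>2 - (Im z)\<^sup>2"
    by (auto simp: power2_eq_square)
  then have "Re z \<noteq> 0"
    by (auto simp: power2_eq_square) (smt (verit) zero_le_square)
  with * have "Im z = 0" "1 \<le> \<bar>Re z\<bar>"
    by (auto simp: abs_le_square_iff[of 1, simplified])
  with assms show False
    by (simp add: mem_\<Omega>\<^sub>0_iff)
qed

lemma disc_of:
  assumes z: "z \<in> \<Omega>\<^sub>0"
  shows "cmod (disc_of z) < 1" "slit_of (disc_of z) = z"
proof -
  define q where "q = csqrt (1 - z\<^sup>2)"
  have q2: "q\<^sup>2 = 1 - z\<^sup>2"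
    by (simp add: q_def)
  have "Re q \<noteq> 0"
  proof
    assume "Re q = 0"
    then have "q\<^sup>2 = of_real (- (Im q)\<^sup>2)"
      by (simp add: complex_eq_iff power2_eq_square)
    then have "1 - z\<^sup>2 \<in> \<real>\<^sub>\<le>\<^sub>0"
      unfolding q2[symmetric] by (auto simp: complex_nonpos_Reals_iff)
    with csqrt_argument[OF z] show False ..
  qed
  then have Re_q: "0 < Re q"
    using csqrt_principal[of "1 - z\<^sup>2"] by (auto simp: q_def)
  then have nz: "1 + q \<noteq> 0"
    by (auto simp: complex_eq_iff)
  \<comment> \<open>The square of \<open>disc_of z\<close> is the Cayley transform of q, so Re q > 0
    places it inside the disc.\<close>
  have W2: "(disc_of z)\<^sup>2 = (q - 1) / (1 + q)"
  proof -
    have "(disc_of z)\<^sup>2 = - (z\<^sup>2) / (1 + q)\<^sup>2"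
      by (simp add: disc_of_def q_def power_divide power_mult_distrib)
    also have "- (z\<^sup>2) = (q - 1) * (1 + q)"
      using q2 by (simp add: algebra_simps power2_eq_square)
    finally show ?thesis
      using nz by (simp add: power2_eq_square)
  qed
  have "(cmod (q - 1))\<^sup>2 < (cmod (1 + q))\<^sup>2"
    using Re_q unfolding cmod_power2 by (simp add: power2_eq_square algebra_simps)
  then have "cmod (q - 1) < cmod (1 + q)"
    by (rule power2_less_imp_less) simp
  then have "(cmod (disc_of z))\<^sup>2 < 1"
    unfolding norm_power[symmetric] W2 norm_divide by (simp add: divide_less_eq_1)
  then show W: "cmod (disc_of z) < 1"
    by (simp add: abs_square_less_1)
  have "1 - (disc_of z)\<^sup>2 = 2 / (1 + q)"
    unfolding W2 using nz by (simp add: field_simps)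
  then show "slit_of (disc_of z) = z"
    unfolding slit_of_def using nz by (simp add: disc_of_def q_def[symmetric])
qed

lemma disc_of_slit_of:
  assumes "cmod w < 1"
  shows "disc_of (slit_of w) = w"
  using inj_onD[OF inj_on_slit_of, of "disc_of (slit_of w)" w] disc_of[OF slit_of_mem[OF assms]] assms by simp

lemma holomorphic_disc_of: "disc_of holomorphic_on \<Omega>\<^sub>0"
proof -
  have "1 + csqrt (1 - z\<^sup>2) \<noteq> 0" if "z \<in> \<Omega>\<^sub>0" for z
  proof
    assume "1 + csqrt (1 - z\<^sup>2) = 0"
    then have "Re (1 + csqrt (1 - z\<^sup>2)) = 0"
      by (simp only: zero_complex.sel)
    with Re_csqrt[of "1 - z\<^sup>2"] show False
      by (simp del: csqrt.simps)
  qed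
  then show ?thesis
    unfolding disc_of_def using csqrt_argument
    by (intro holomorphic_intros holomorphic_on_csqrt'[unfolded o_def]) auto
qed

lemma holomorphic_slit_of: "slit_of holomorphic_on ball 0 1"
  unfolding slit_of_def using one_minus_square_nonzero by (intro holomorphic_intros) auto

lemma connected_\<Omega>\<^sub>0: "connected \<Omega>\<^sub>0"
proof -
  have "\<Omega>\<^sub>0 = slit_of ` ball 0 1"
    using disc_of slit_of_mem by (force simp: image_iff)
  then show ?thesis
    using connected_continuous_image[OF holomorphic_on_imp_continuous_on[OF holomorphic_slit_of]] by simp
qed

text \<open>A Blaschke factor has modulus 1 on the circle, so the bound c' < 1 lets the open disc be
  replaced by the closed one.\<close>

lemma compact_blaschke_annulus:
  assumes a: "cmod a < 1" and c: "0 < c" "c' < 1"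
  shows "compact {w. w \<in> ball 0 1 \<and> c \<le> cmod (blaschke a w) \<and> cmod (blaschke a w) \<le> c'}"
proof -
  have "1 - cnj a * w \<noteq> 0" if "cmod w \<le> 1" for w
  proof (rule blaschke_denominator_nonzero)
    have "cmod a * cmod w \<le> cmod a * 1"
      using that by (intro mult_left_mono) auto
    with a show "cmod a * cmod w < 1"
      by simp
  qed
  then have "continuous_on (cball 0 1) (\<lambda>w. cmod (blaschke a w))"
    unfolding blaschke_def by (intro continuous_intros) auto
  from continuous_closed_preimage[OF this closed_cball closed_atLeastAtMost]
  have "compact (cball 0 1 \<inter> (\<lambda>w. cmod (blaschke a w)) -` {c..c'})"
    unfolding compact_eq_bounded_closed by (blast intro: bounded_subset[OF bounded_cball])
  moreover have "cball 0 1 \<inter> (\<lambda>w. cmod (blaschke a w)) -` {c..c'}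
      = {w. w \<in> ball 0 1 \<and> c \<le> cmod (blaschke a w) \<and> cmod (blaschke a w) \<le> c'}"
  proof -
    have "cmod w \<noteq> 1" if "cmod (blaschke a w) \<le> c'" for w
      using norm_blaschke_eq_1[OF a, of w] that c by auto
    then show ?thesis
      by (auto simp: less_le)
  qed
  ultimately show ?thesis
    by simp
qed


section \<open>The arc and its complement in the disc coordinate\<close>

locale circular_arc = disc_param +
  fixes \<alpha> :: real
  assumes \<alpha>: "0 < \<alpha>" "\<alpha> < pi" and T_eq: "T = tan (\<alpha> / 4)"
begin

definition half_tan :: real where
  "half_tan = 2 * T / (1 - T\<^sup>2)"

lemma half_tan_pos: "0 < half_tan"
  unfolding half_tan_def using T power_less_one_iff[of T 2] by simp

lemma tan_half: "tan (\<alpha> / 2) = half_tan"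
proof -
  have "cos (\<alpha> / 4) > 0" "cos (\<alpha> / 2) > 0"
    using \<alpha> by (auto intro!: cos_gt_zero_pi)
  then show ?thesis
    using tan_double[of "\<alpha> / 4"] by (simp add: half_tan_def flip: T_eq)
qed

lemma cos_\<alpha>: "cos \<alpha> = (1 - half_tan\<^sup>2) / (1 + half_tan\<^sup>2)"
proof -
  have "cos (\<alpha> / 2) > 0"
    using \<alpha> by (auto intro!: cos_gt_zero_pi)
  then show ?thesis
    using cos_tan_half[of "\<alpha> / 2"] by (simp add: tan_half)
qed

lemma z\<^sub>0_eq: "z\<^sub>0 \<alpha> = \<i> * of_real half_tan" "cnj (z\<^sub>0 \<alpha>) = - (\<i> * of_real half_tan)"
  by (simp_all add: z\<^sub>0_def tan_half)

lemma slit_of_\<tau>: "slit_of \<tau> = - (\<i> * of_real half_tan)" "slit_of (- \<tau>) = \<i> * of_real half_tan"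
  by (simp_all add: slit_of_def half_tan_def)

text \<open>Zero and pole of the map are mirror images in the real axis, so modulus 1 means that z
  is real; for real z the condition cos \<alpha> <= Re u reduces to z^2 >= 1.\<close>

lemma moebius_mem_arc_iff:
  assumes z: "z + \<i> * of_real half_tan \<noteq> 0"
  shows "(z - \<i> * of_real half_tan) / (z + \<i> * of_real half_tan) \<in> arc \<alpha> \<longleftrightarrow> z \<notin> \<Omega>\<^sub>0"
proof -
  define u where "u = (z - \<i> * of_real half_tan) / (z + \<i> * of_real half_tan)"
  have "cmod u = 1 \<longleftrightarrow> cmod (z - \<i> * of_real half_tan) = cmod (z + \<i> * of_real half_tan)"
    unfolding u_def norm_divide using z by auto
  also have "\<dots> \<longleftrightarrow> (cmod (z - \<i> * of_real half_tan))\<^sup>2 = (cmod (z + \<i> * of_real half_tan))\<^sup>2"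
    by (auto simp: power2_eq_iff_nonneg)
  also have "\<dots> \<longleftrightarrow> Im z = 0"
    unfolding cmod_power2 using half_tan_pos by (auto simp: power2_eq_square algebra_simps)
  finally have norm: "cmod u = 1 \<longleftrightarrow> Im z = 0" .
  have "cos \<alpha> \<le> Re u \<longleftrightarrow> 1 \<le> \<bar>Re z\<bar>" if "Im z = 0"
  proof -
    define x where "x = Re z"
    have zx: "z = of_real x"
      using that by (simp add: x_def complex_eq_iff)
    have pos: "0 < x\<^sup>2 + half_tan\<^sup>2" "0 < 1 + half_tan\<^sup>2"
      using half_tan_pos by (auto intro: add_nonneg_pos)
    have "Re u = (x\<^sup>2 - half_tan\<^sup>2) / (x\<^sup>2 + half_tan\<^sup>2)"
      unfolding u_def zx by (simp add: Re_divide power2_eq_square)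
    then have "cos \<alpha> \<le> Re u \<longleftrightarrow> (1 - half_tan\<^sup>2) * (x\<^sup>2 + half_tan\<^sup>2) \<le> (x\<^sup>2 - half_tan\<^sup>2) * (1 + half_tan\<^sup>2)"
      unfolding cos_\<alpha> using pos by (simp add: divide_le_eq pos_le_divide_eq mult.commute)
    also have "\<dots> \<longleftrightarrow> 0 \<le> (2 * half_tan\<^sup>2) * (x\<^sup>2 - 1)"
      by (simp add: algebra_simps)
    also have "\<dots> \<longleftrightarrow> 1 \<le> x\<^sup>2"
      using half_tan_pos by (simp add: zero_le_mult_iff)
    also have "\<dots> \<longleftrightarrow> 1 \<le> \<bar>x\<bar>"
      using abs_le_square_iff[of 1 x] by simp
    finally show ?thesis
      by (simp add: x_def)
  qed
  with norm show ?thesis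
    unfolding u_def[symmetric] mem_arc_iff[OF \<alpha>] mem_\<Omega>\<^sub>0_iff by auto
qed

lemma u_map_eq:
  "u_map \<alpha> z = (if z = - (\<i> * of_real half_tan) then None else Some ((z - \<i> * of_real half_tan) / (z + \<i> * of_real half_tan)))"
  unfolding u_map_def z\<^sub>0_eq by simp

definition slit_of_u :: "complex \<Rightarrow> complex" where
  "slit_of_u u = \<i> * of_real half_tan * (1 + u) / (1 - u)"

lemma one_mem_arc: "1 \<in> arc \<alpha>"
  using mem_arc_iff[OF \<alpha>, of 1] by simp

lemma moebius_slit_of_u:
  assumes "u \<noteq> 1"
  shows "slit_of_u u + \<i> * of_real half_tan \<noteq> 0" "(slit_of_u u - \<i> * of_real half_tan) / (slit_of_u u + \<i> * of_real half_tan) = u"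
proof -
  have 1: "slit_of_u u + \<i> * of_real half_tan = 2 * \<i> * of_real half_tan / (1 - u)" "slit_of_u u - \<i> * of_real half_tan = 2 * \<i> * of_real half_tan * u / (1 - u)"
    using assms by (simp_all add: slit_of_u_def divide_simps) (simp_all add: algebra_simps)
  show "slit_of_u u + \<i> * of_real half_tan \<noteq> 0" "(slit_of_u u - \<i> * of_real half_tan) / (slit_of_u u + \<i> * of_real half_tan) = u"
    unfolding 1 using assms half_tan_pos by auto
qed

lemma slit_of_u_mem:
  assumes "u \<notin> arc \<alpha>"
  shows "slit_of_u u \<in> \<Omega>\<^sub>0"
proof -
  have "u \<noteq> 1"
    using assms one_mem_arc by auto
  from moebius_mem_arc_iff[OF moebius_slit_of_u(1)[OF this]] moebius_slit_of_u(2)[OF this] assms show ?thesis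
    by simp
qed

lemma slit_of_u_moebius:
  assumes "z + \<i> * of_real half_tan \<noteq> 0"
  shows "slit_of_u ((z - \<i> * of_real half_tan) / (z + \<i> * of_real half_tan)) = z"
proof -
  have "1 + (z - \<i> * of_real half_tan) / (z + \<i> * of_real half_tan) = 2 * z / (z + \<i> * of_real half_tan)"
    "1 - (z - \<i> * of_real half_tan) / (z + \<i> * of_real half_tan) = 2 * \<i> * of_real half_tan / (z + \<i> * of_real half_tan)"
    using assms by (simp_all add: divide_simps)
  then show ?thesis
    unfolding slit_of_u_def using assms half_tan_pos by simp
qed

lemma inj_u_map: "inj (u_map \<alpha>)"
proof (rule injI)
  fix z z' assume eq: "u_map \<alpha> z = u_map \<alpha> z'"
  show "z = z'"
  proof (cases "z = - (\<i> * of_real half_tan)")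
    case True
    then show ?thesis
      using eq by (simp add: u_map_eq split: if_splits)
  next
    case False
    with eq have "z' \<noteq> - (\<i> * of_real half_tan)"
      by (auto simp: u_map_eq split: if_splits)
    with False eq have "(z - \<i> * of_real half_tan) / (z + \<i> * of_real half_tan) = (z' - \<i> * of_real half_tan) / (z' + \<i> * of_real half_tan)"
      by (simp add: u_map_eq)
    then show ?thesis
      using slit_of_u_moebius[of z] slit_of_u_moebius[of z'] False \<open>z' \<noteq> - (\<i> * of_real half_tan)\<close>
      by (metis add_eq_0_iff2)
  qed
qed

lemma z_map_u_map:
  assumes "z \<in> \<Omega>\<^sub>0"
  shows "z_map \<alpha> (u_map \<alpha> z) = z"
  unfolding z_map_def using the_inv_into_f_f[OF inj_on_subset[OF inj_u_map] assms] by simp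

lemma z_map_Some:
  assumes "u \<notin> arc \<alpha>"
  shows "z_map \<alpha> (Some u) = slit_of_u u"
proof -
  have "u \<noteq> 1"
    using assms one_mem_arc by auto
  then have "u_map \<alpha> (slit_of_u u) = Some u"
    using moebius_slit_of_u[of u] by (auto simp: u_map_eq)
  then show ?thesis
    using z_map_u_map[OF slit_of_u_mem[OF assms]] by simp
qed

lemma z_map_None: "z_map \<alpha> None = slit_of \<tau>"
proof -
  have "slit_of \<tau> \<in> \<Omega>\<^sub>0"
    using T by (intro slit_of_mem) simp
  from z_map_u_map[OF this] show ?thesis
    by (simp add: u_map_eq slit_of_\<tau>)
qed

text \<open>Numerator and denominator are the differences of \<open>slit_of w\<close> with
  \<open>slit_of (- \<tau>)\<close> and \<open>slit_of \<tau>\<close>; their factorizations combine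
  to the two Blaschke factors.\<close>

lemma moebius_slit_of:
  assumes "cmod w < 1" and "w \<noteq> \<tau>"
  shows "slit_of w + \<i> * of_real half_tan \<noteq> 0"
    "(slit_of w - \<i> * of_real half_tan) / (slit_of w + \<i> * of_real half_tan) = bA w / bB w"
proof -
  have \<tau>: "cmod \<tau> < 1" "cmod (- \<tau>) < 1"
    using T by auto
  have 1: "slit_of w + \<i> * of_real half_tan = - 2 * \<i> * (w - \<tau>) * (1 + w * \<tau>) / ((1 - w\<^sup>2) * (1 - \<tau>\<^sup>2))"
    using slit_of_diff[OF assms(1) \<tau>(1)] by (simp add: slit_of_\<tau>)
  have 2: "slit_of w - \<i> * of_real half_tan = - 2 * \<i> * (w + \<tau>) * (1 - w * \<tau>) / ((1 - w\<^sup>2) * (1 - \<tau>\<^sup>2))"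
    using slit_of_diff[OF assms(1) \<tau>(2)] by (simp add: slit_of_\<tau>)
  have nz: "1 - w\<^sup>2 \<noteq> 0" "1 - \<tau>\<^sup>2 \<noteq> 0" "1 + w * \<tau> \<noteq> 0" "1 - w * \<tau> \<noteq> 0" "w - \<tau> \<noteq> 0"
    using one_minus_square_nonzero[OF assms(1)] one_plus_T_square_nonzero(2)
      denominators_disc(1,2)[of w] assms by (auto simp: mult.commute)
  show "slit_of w + \<i> * of_real half_tan \<noteq> 0"
    unfolding 1 using nz by simp
  show "(slit_of w - \<i> * of_real half_tan) / (slit_of w + \<i> * of_real half_tan) = bA w / bB w"
    unfolding 1 2 bA_def bB_def using nz by (simp add: mult.commute[of \<tau>])
qed

definition disc_of_u :: "complex \<Rightarrow> complex" where
  "disc_of_u u = disc_of (slit_of_u u)"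

lemma disc_of_u:
  assumes "u \<notin> arc \<alpha>"
  shows "cmod (disc_of_u u) < 1" "disc_of_u u \<noteq> \<tau>" "bA (disc_of_u u) / bB (disc_of_u u) = u" "slit_of (disc_of_u u) = slit_of_u u"
proof -
  have u: "u \<noteq> 1"
    using assms one_mem_arc by auto
  show W: "cmod (disc_of_u u) < 1" "slit_of (disc_of_u u) = slit_of_u u"
    using disc_of[OF slit_of_u_mem[OF assms]] by (simp_all add: disc_of_u_def)
  show "disc_of_u u \<noteq> \<tau>"
    using W(2) moebius_slit_of_u(1)[OF u] slit_of_\<tau>(1) by (metis add.left_inverse)
  from moebius_slit_of(2)[OF W(1) this] show "bA (disc_of_u u) / bB (disc_of_u u) = u"
    unfolding W(2) using moebius_slit_of_u(2)[OF u] by simp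
qed

lemma bB_nonzero:
  assumes "cmod w < 1" "w \<noteq> \<tau>"
  shows "bB w \<noteq> 0"
  using assms denominators_disc(2)[of w] by (auto simp: bB_def)

lemma disc_of_u_quotient:
  assumes "cmod w < 1" "w \<noteq> \<tau>"
  shows "bA w / bB w \<notin> arc \<alpha>" "disc_of_u (bA w / bB w) = w"
  using moebius_mem_arc_iff[OF moebius_slit_of(1)[OF assms]] slit_of_mem[OF assms(1)] moebius_slit_of(2)[OF assms]
    slit_of_u_moebius[OF moebius_slit_of(1)[OF assms]] disc_of_slit_of[OF assms(1)]
  by (simp_all add: disc_of_u_def)

lemma holomorphic_disc_of_u: "disc_of_u holomorphic_on - arc \<alpha>"
proof -
  have "slit_of_u holomorphic_on - arc \<alpha>"
    unfolding slit_of_u_def using one_mem_arc by (intro holomorphic_intros) auto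
  then have "(disc_of \<circ> slit_of_u) holomorphic_on - arc \<alpha>"
    by (rule holomorphic_on_compose_gen[OF _ holomorphic_disc_of]) (use slit_of_u_mem in auto)
  then show ?thesis
    by (simp add: disc_of_u_def[abs_def] o_def)
qed

lemma closed_arc: "closed (arc \<alpha>)"
proof -
  have "arc \<alpha> = {u. cmod u = 1} \<inter> {u. cos \<alpha> \<le> Re u}"
    by (auto simp: mem_arc_iff[OF \<alpha>])
  then show ?thesis
    by (simp only:) (intro closed_Int closed_Collect_eq closed_Collect_le continuous_intros)
qed

text \<open>Clearing denominators leaves the factor (w - v) (1 + w v): the quotient is two-to-one,
  identifying w with - 1 / w.\<close>

lemma quotient_eq_iff:
  assumes "bB w \<noteq> 0" "bB v \<noteq> 0" "cmod w \<le> 1" "cmod v \<le> 1"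
  shows "bA w / bB w = bA v / bB v \<longleftrightarrow> w = v \<or> 1 + w * v = 0"
proof -
  have nz: "1 + \<tau> * w \<noteq> 0" "1 - \<tau> * w \<noteq> 0" "1 + \<tau> * v \<noteq> 0" "1 - \<tau> * v \<noteq> 0" "w - \<tau> \<noteq> 0" "v - \<tau> \<noteq> 0"
    using denominators_disc[of w] denominators_disc[of v] assms by (auto simp: bB_def)
  have q: "bA z / bB z = (z + \<tau>) * (1 - \<tau> * z) / ((z - \<tau>) * (1 + \<tau> * z))" for z
    by (simp add: bA_def bB_def)
  have "bA w / bB w = bA v / bB v \<longleftrightarrow>
      (w + \<tau>) * (1 - \<tau> * w) * ((v - \<tau>) * (1 + \<tau> * v)) - (v + \<tau>) * (1 - \<tau> * v) * ((w - \<tau>) * (1 + \<tau> * w)) = 0"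
    unfolding q using nz by (simp add: frac_eq_eq)
  also have "(w + \<tau>) * (1 - \<tau> * w) * ((v - \<tau>) * (1 + \<tau> * v)) - (v + \<tau>) * (1 - \<tau> * v) * ((w - \<tau>) * (1 + \<tau> * w))
      = - 2 * \<tau> * (1 - \<tau>\<^sup>2) * ((w - v) * (1 + w * v))"
    by (simp add: power2_eq_square algebra_simps)
  finally show ?thesis
    using one_plus_T_square_nonzero T by simp
qed

text \<open>A value off the arc is already attained at some v in the open disc, and its only other
  preimage - 1 / v lies outside the closed disc.\<close>

lemma circle_quotient_mem_arc:
  assumes w: "cmod w = 1"
  shows "bA w / bB w \<in> arc \<alpha>"
proof (rule ccontr)
  assume "bA w / bB w \<notin> arc \<alpha>"
  from disc_of_u[OF this] obtain v where v: "cmod v < 1" "v \<noteq> \<tau>" "bA v / bB v = bA w / bB w"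
    by blast
  moreover have "bB w \<noteq> 0"
    using norm_b_circle[OF w] by auto
  ultimately have "v = w \<or> 1 + v * w = 0"
    using quotient_eq_iff[of v w] bB_nonzero[of v] w by simp
  moreover have "1 + v * w \<noteq> 0"
    using blaschke_denominator_nonzero[of "- cnj v" w] v(1) w by simp
  ultimately show False
    using v(1) w by auto
qed

text \<open>A / B = u is a quadratic equation with roots w and - 1 / w. Neither lies in the open
  disc, where all values are off the arc, so both have modulus 1.\<close>

lemma arc_quotient:
  assumes "u \<in> arc \<alpha>"
  obtains w where "cmod w = 1" "bA w / bB w = u"
proof -
  have u: "cmod u = 1" "cos \<alpha> \<le> Re u"
    using assms by (auto simp: mem_arc_iff[OF \<alpha>])
  have "cos pi < cos \<alpha>"
    using \<alpha> by (intro cos_monotone_0_pi) auto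
  then have "u \<noteq> - 1"
    using u(2) by auto
  then have u1: "1 + u \<noteq> 0"
    by (simp add: add_eq_0_iff)
  \<comment> \<open>Clearing denominators in A / B = u gives a w^2 + b w - a = 0; a is nonzero
    because \<alpha> < pi excludes u = - 1.\<close>
  define a b where "a = \<tau> * (1 + u)" and "b = (1 - \<tau>\<^sup>2) * (u - 1)"
  have "a \<noteq> 0"
    using u1 T by (simp add: a_def)
  define w where "w = (- b + csqrt (b\<^sup>2 + 4 * a\<^sup>2)) / (2 * a)"
  have quad: "a * w\<^sup>2 + b * w - a = 0"
  proof -
    have "(2 * a * w + b)\<^sup>2 = b\<^sup>2 + 4 * a\<^sup>2"
      using \<open>a \<noteq> 0\<close> by (simp add: w_def)
    then have "4 * a * (a * w\<^sup>2 + b * w - a) = 0"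
      by (simp add: power2_eq_square algebra_simps)
    then show ?thesis
      using \<open>a \<noteq> 0\<close> by simp
  qed
  have "w \<noteq> 0"
    using quad \<open>a \<noteq> 0\<close> by auto
  have root: "bA v / bB v = u" if "a * v\<^sup>2 + b * v - a = 0" "cmod v \<le> 1" for v
  proof -
    have nz: "1 + \<tau> * v \<noteq> 0" "1 - \<tau> * v \<noteq> 0"
      using denominators_disc that by auto
    have eq: "u * ((v - \<tau>) * (1 + \<tau> * v)) = (v + \<tau>) * (1 - \<tau> * v)"
      using that(1) by (simp add: a_def b_def power2_eq_square algebra_simps)
    have "v \<noteq> \<tau>"
      using eq nz T by auto
    then show ?thesis
      unfolding bA_def bB_def using eq nz by (simp add: divide_eq_eq mult.commute)
  qed
  have not_less: "\<not> cmod v < 1" if "a * v\<^sup>2 + b * v - a = 0" for v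
  proof
    assume v: "cmod v < 1"
    have q: "bA v / bB v = u"
      using root that v by simp
    then have "v \<noteq> \<tau>"
      using u(1) by (auto simp: bB_\<tau>)
    with disc_of_u_quotient(1)[OF v] q assms show False
      by simp
  qed
  have "a * (- 1 / w)\<^sup>2 + b * (- 1 / w) - a = - (a * w\<^sup>2 + b * w - a) / w\<^sup>2"
    using \<open>w \<noteq> 0\<close> by (simp add: field_simps power2_eq_square)
  then have "a * (- 1 / w)\<^sup>2 + b * (- 1 / w) - a = 0"
    unfolding quad by simp
  then have "\<not> cmod w < 1" "\<not> cmod (- 1 / w) < 1"
    using not_less[OF quad] not_less by blast+
  then have "cmod w = 1"
    using \<open>w \<noteq> 0\<close> by (simp add: norm_divide)
  with root[OF quad] that show ?thesis
    by simp
qed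

end

section \<open>Green functions of the two domains\<close>

lemma tendsto_imp_bigo_1:
  fixes f :: "'a \<Rightarrow> real"
  assumes "(f \<longlongrightarrow> c) net"
  shows "f \<in> O[net](\<lambda>_. 1)"
  using assms by (intro bigoI_tendsto[of _ _ c]) auto

lemma image_Collect_inverse:
  assumes "\<And>w. w \<in> {w. w \<in> A \<and> P w} \<Longrightarrow> f w \<in> V \<and> g (f w) = w" and "\<And>z. z \<in> V \<Longrightarrow> g z \<in> A \<and> f (g z) = z"
  shows "f ` {w. w \<in> A \<and> P w} = {z \<in> V. P (g z)}"
  using assms by (force simp: image_iff)

text \<open>The candidate is the Blaschke factor in the disc coordinate. By \<open>norm_diff\<close>
  it differs from z - \<open>slit_of v\<close> by a factor that is continuous and nonzero at the
  pole, which gives the logarithmic singularity.\<close>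

lemma complex_Green_function_\<Omega>\<^sub>0:
  assumes b: "is_complex_Green_function (Some ` \<Omega>\<^sub>0) (Some (slit_of v)) b" and v: "cmod v < 1"
  obtains c where "cmod c = 1" "\<And>z. z \<in> \<Omega>\<^sub>0 - {slit_of v} \<Longrightarrow> b (Some z) = c * blaschke v (disc_of z)"
proof (rule complex_Green_function_eq[OF b, where V = "\<Omega>\<^sub>0 - {slit_of v}" and \<beta> = "\<lambda>z. blaschke v (disc_of z)"])
  have den: "1 - cnj v * w \<noteq> 0" if "cmod w < 1" for w
    using one_plus_mult_nonzero[of "- cnj v" w] v that by simp
  have disc_of_ne: "disc_of z \<noteq> v" if "z \<in> \<Omega>\<^sub>0 - {slit_of v}" for z
    using that disc_of(2)[of z] by auto
  have a: "slit_of v \<in> \<Omega>\<^sub>0"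
    using slit_of_mem[OF v] .
  have norm_diff: "cmod (z - slit_of v) = cmod (blaschke v (disc_of z)) *
      cmod (2 * (1 - cnj v * disc_of z) * (1 + disc_of z * v) / ((1 - (disc_of z)\<^sup>2) * (1 - v\<^sup>2)))" if "z \<in> \<Omega>\<^sub>0" for z
  proof -
    define w where "w = disc_of z"
    have w: "cmod w < 1" "slit_of w = z"
      using disc_of[OF that] by (simp_all add: w_def)
    have "w - v = blaschke v w * (1 - cnj v * w)"
      using den[OF w(1)] by (simp add: blaschke_def)
    then have "z - slit_of v = - \<i> * (blaschke v w * (2 * (1 - cnj v * w) * (1 + w * v) / ((1 - w\<^sup>2) * (1 - v\<^sup>2))))"
      using slit_of_diff[OF w(1) v] unfolding w(2) by simp
    then show ?thesis
      unfolding w_def[symmetric] by (simp only: norm_mult norm_minus_cancel norm_ii mult_1_left)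
  qed
  show "\<Omega>\<^sub>0 - {slit_of v} = {z. Some z \<in> Some ` \<Omega>\<^sub>0 - {Some (slit_of v)}}" "None \<notin> Some ` \<Omega>\<^sub>0 - {Some (slit_of v)}"
    by auto
  show "open (\<Omega>\<^sub>0 - {slit_of v})" "connected (\<Omega>\<^sub>0 - {slit_of v})"
    using open_\<Omega>\<^sub>0 connected_\<Omega>\<^sub>0 by (auto intro: connected_open_delete)
  show "(\<lambda>z. blaschke v (disc_of z)) holomorphic_on \<Omega>\<^sub>0 - {slit_of v}"
    unfolding blaschke_def using den disc_of(1)
    by (intro holomorphic_intros holomorphic_on_subset[OF holomorphic_disc_of]) auto
  show "blaschke v (disc_of z) \<noteq> 0" "cmod (blaschke v (disc_of z)) < 1" if "z \<in> \<Omega>\<^sub>0 - {slit_of v}" for z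
    using that disc_of_ne[OF that] den[of "disc_of z"] disc_of(1)[of z] norm_blaschke_less_1[OF v, of "disc_of z"]
    by (auto simp: blaschke_def)
  show "compact {z \<in> \<Omega>\<^sub>0 - {slit_of v}. c \<le> cmod (blaschke v (disc_of z)) \<and> cmod (blaschke v (disc_of z)) \<le> c'}"
    if c: "0 < c" "c' < 1" for c c'
  proof -
    let ?A = "{w. w \<in> ball 0 1 \<and> c \<le> cmod (blaschke v w) \<and> cmod (blaschke v w) \<le> c'}"
    have "continuous_on ?A slit_of"
      by (rule holomorphic_on_imp_continuous_on[OF holomorphic_on_subset[OF holomorphic_slit_of]]) auto
    then have "compact (slit_of ` ?A)"
      using compact_blaschke_annulus[OF v c] by (intro compact_continuous_image)
    moreover have "slit_of ` ?A = {z \<in> \<Omega>\<^sub>0 - {slit_of v}. c \<le> cmod (blaschke v (disc_of z)) \<and> cmod (blaschke v (disc_of z)) \<le> c'}"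
    proof (rule image_Collect_inverse[where A = "ball 0 1" and g = disc_of])
      fix w assume "w \<in> ?A"
      then have w: "cmod w < 1" "w \<noteq> v"
        using c by (auto simp: blaschke_def)
      then have "slit_of w \<noteq> slit_of v"
        using v disc_of_slit_of by metis
      then show "slit_of w \<in> \<Omega>\<^sub>0 - {slit_of v} \<and> disc_of (slit_of w) = w"
        using slit_of_mem[OF w(1)] disc_of_slit_of[OF w(1)] by simp
    qed (use disc_of in auto)
    ultimately show ?thesis
      by simp
  qed
  show "log_pole_at (Some (slit_of v)) (\<lambda>q. case q of Some z \<Rightarrow> - ln (cmod (blaschke v (disc_of z))) | None \<Rightarrow> 0)"
  proof -
    define k where "k = (\<lambda>z. cmod (2 * (1 - cnj v * disc_of z) * (1 + disc_of z * v) / ((1 - (disc_of z)\<^sup>2) * (1 - v\<^sup>2))))"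
    have contW: "isCont disc_of (slit_of v)"
      using holomorphic_on_imp_continuous_on[OF holomorphic_disc_of] open_\<Omega>\<^sub>0 a continuous_on_eq_continuous_at by blast
    have "k (slit_of v) \<noteq> 0" and nz: "(1 - (disc_of (slit_of v))\<^sup>2) * (1 - v\<^sup>2) \<noteq> 0"
      using one_minus_square_nonzero[OF v] den[OF v] one_plus_mult_nonzero[OF v v] v
      by (auto simp: k_def disc_of_slit_of)
    moreover have "isCont k (slit_of v)"
      unfolding k_def using nz by (intro continuous_intros contW)
    ultimately have "((\<lambda>z. ln (k z)) \<longlongrightarrow> ln (k (slit_of v))) (at (slit_of v))"
      unfolding isCont_def by (intro tendsto_ln)
    moreover have "\<forall>\<^sub>F z in at (slit_of v). z \<in> \<Omega>\<^sub>0 - {slit_of v}"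
      using eventually_at_in_open[OF open_\<Omega>\<^sub>0 a] by simp
    then have "\<forall>\<^sub>F z in at (slit_of v). ln (k z) = - ln (cmod (blaschke v (disc_of z))) + ln (cmod (z - slit_of v))"
    proof eventually_elim
      case (elim z)
      have "0 < cmod (z - slit_of v)"
        using elim by simp
      then have "0 < cmod (blaschke v (disc_of z))" "0 < k z"
        using norm_diff[of z] elim unfolding k_def by (auto simp: zero_less_mult_iff)
      moreover have "cmod (z - slit_of v) = cmod (blaschke v (disc_of z)) * k z"
        using norm_diff[of z] elim by (simp add: k_def)
      ultimately show ?case
        by (simp add: ln_mult)
    qed
    ultimately have "((\<lambda>z. - ln (cmod (blaschke v (disc_of z))) + ln (cmod (z - slit_of v))) \<longlongrightarrow> ln (k (slit_of v))) (at (slit_of v))"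
      by (rule Lim_transform_eventually)
    then show ?thesis
      by (simp add: log_pole_at_def tendsto_imp_bigo_1)
  qed
  show "\<exists>c>0. \<forall>z\<in>\<Omega>\<^sub>0 - {slit_of v}. cmod (blaschke v (disc_of z)) < c \<longrightarrow> N z"
    if "eventually N (pole_filter (Some (slit_of v)))" for N
  proof -
    obtain d where d: "0 < d" "\<And>z. z \<noteq> slit_of v \<Longrightarrow> dist z (slit_of v) < d \<Longrightarrow> N z"
      using \<open>eventually N _\<close> by (auto simp: pole_filter_def eventually_at)
    have "isCont slit_of v"
      using holomorphic_on_imp_continuous_on[OF holomorphic_slit_of] v
      by (metis continuous_on_eq_continuous_at mem_ball_0 open_ball)
    then obtain e where e: "0 < e" "\<And>w. dist w v < e \<Longrightarrow> dist (slit_of w) (slit_of v) < d"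
      using d(1) unfolding continuous_at_eps_delta by (metis dist_commute)
    \<comment> \<open>The radius e / 2 suffices because |w - v| <= 2 |\<open>blaschke v w\<close>|
      in the disc.\<close>
    have "N z" if z: "z \<in> \<Omega>\<^sub>0 - {slit_of v}" "cmod (blaschke v (disc_of z)) < e / 2" for z
    proof -
      define w where "w = disc_of z"
      have w: "cmod w < 1" "slit_of w = z"
        using disc_of[of z] z by (simp_all add: w_def)
      have "cmod (cnj v * w) \<le> 1 * 1"
        unfolding norm_mult using v w by (intro mult_mono) auto
      then have "cmod (1 - cnj v * w) \<le> 2"
        using norm_triangle_ineq4[of 1 "cnj v * w"] by simp
      moreover have "w - v = blaschke v w * (1 - cnj v * w)"
        using den[OF w(1)] by (simp add: blaschke_def)
      ultimately have "cmod (w - v) \<le> cmod (blaschke v w) * 2"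
        by (simp add: norm_mult mult_left_mono)
      then have "dist w v < e"
        using z(2) by (simp add: dist_norm w_def)
      then show ?thesis
        using e(2) d(2) w(2) z(1) by auto
    qed
    then show ?thesis
      using e(1) by (intro exI[of _ "e / 2"]) auto
  qed
  fix c assume "cmod c = 1" "\<And>z. z \<in> \<Omega>\<^sub>0 - {slit_of v} \<Longrightarrow> b (Some z) = c * blaschke v (disc_of z)"
  then show thesis
    by (rule that)
qed

context circular_arc
begin

lemma disc_of_u_at_infinity: "(disc_of_u \<longlongrightarrow> \<tau>) at_infinity"
proof -
  have lim: "((\<lambda>u. - (\<i> * of_real half_tan) - 2 * \<i> * of_real half_tan / (- 1 + u)) \<longlongrightarrow> - (\<i> * of_real half_tan) - 0) at_infinity"
    by (intro tendsto_diff tendsto_const tendsto_divide_0[OF tendsto_const]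
        tendsto_add_filterlim_at_infinity[OF tendsto_const] filterlim_ident)
  have "\<forall>\<^sub>F u in at_infinity. u \<noteq> (1 :: complex)"
    unfolding eventually_at_infinity by (intro exI[of _ 2]) auto
  then have "\<forall>\<^sub>F u in at_infinity. - (\<i> * of_real half_tan) - 2 * \<i> * of_real half_tan / (- 1 + u) = slit_of_u u"
    by eventually_elim (simp add: slit_of_u_def divide_simps, simp add: algebra_simps)
  from Lim_transform_eventually[OF lim this] have "(slit_of_u \<longlongrightarrow> slit_of \<tau>) at_infinity"
    by (simp add: slit_of_\<tau>)
  moreover have "isCont disc_of (slit_of \<tau>)"
    using holomorphic_on_imp_continuous_on[OF holomorphic_disc_of] open_\<Omega>\<^sub>0 slit_of_mem[of \<tau>] T
    by (simp add: continuous_on_eq_continuous_at)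
  ultimately have "((\<lambda>u. disc_of (slit_of_u u)) \<longlongrightarrow> disc_of (slit_of \<tau>)) at_infinity"
    by (rule isCont_tendsto_compose[rotated])
  then show ?thesis
    using disc_of_slit_of[of \<tau>] T by (simp add: disc_of_u_def[abs_def])
qed

lemma eventually_not_arc: "\<forall>\<^sub>F u in at_infinity. u \<notin> arc \<alpha>"
  unfolding eventually_at_infinity by (intro exI[of _ 2]) (auto simp: mem_arc_iff[OF \<alpha>])

lemma continuous_b: "continuous_on (cball 0 1) bA" "continuous_on (cball 0 1) bB"
  using less_inverse_T
  by (auto intro!: continuous_on_subset[OF holomorphic_on_imp_continuous_on[OF holomorphic_b(1)]]
      continuous_on_subset[OF holomorphic_on_imp_continuous_on[OF holomorphic_b(2)]])

lemma tendsto_b: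
  assumes "(f \<longlongrightarrow> w) net" and "cmod w < 1"
  shows "((\<lambda>x. bA (f x)) \<longlongrightarrow> bA w) net" "((\<lambda>x. bB (f x)) \<longlongrightarrow> bB w) net"
  unfolding bA_def bB_def using denominators_disc(1,2)[of w] assms(2) by (auto intro!: tendsto_intros assms(1))

lemma bB_disc_of_u:
  assumes "u \<notin> arc \<alpha>"
  shows "bB (disc_of_u u) \<noteq> 0" "cmod (bB (disc_of_u u)) < 1" "bA (disc_of_u u) = u * bB (disc_of_u u)"
proof -
  show nz: "bB (disc_of_u u) \<noteq> 0"
    using bB_nonzero disc_of_u[OF assms] by blast
  show "cmod (bB (disc_of_u u)) < 1"
    unfolding bB_blaschke using disc_of_u[OF assms] T by (intro norm_blaschke_less_1) auto
  show "bA (disc_of_u u) = u * bB (disc_of_u u)"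
    using disc_of_u(3)[OF assms] nz by (simp add: divide_eq_eq)
qed

text \<open>This number is A(\<tau>) = 1 / \<gamma> = sin (\<alpha> / 2), the logarithmic capacity
  of the arc.\<close>

lemma capacity_pos: "0 < 2 * T / (1 + T\<^sup>2)"
  using T T_power_bounds(1) by simp

lemma complex_Green_function_arc:
  assumes b: "is_complex_Green_function (\<Omega>_arc \<alpha>) None b"
  obtains c where "cmod c = 1" "\<And>u. u \<notin> arc \<alpha> \<Longrightarrow> b (Some u) = c * bB (disc_of_u u)"
proof (rule complex_Green_function_eq[OF b, where V = "- arc \<alpha>" and \<beta> = "\<lambda>u. bB (disc_of_u u)"])
  show "- arc \<alpha> = {z. Some z \<in> \<Omega>_arc \<alpha> - {None}}" "None \<notin> \<Omega>_arc \<alpha> - {None}"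
    by (auto simp: \<Omega>_arc_def)
  show "open (- arc \<alpha>)"
    using closed_arc by (simp add: open_Compl)
  have cont: "continuous_on (ball 0 1 - {\<tau>}) (\<lambda>w. bA w / bB w)"
    using bB_nonzero
    by (intro continuous_intros continuous_on_subset[OF continuous_b(1)] continuous_on_subset[OF continuous_b(2)]) auto
  have "- arc \<alpha> = (\<lambda>w. bA w / bB w) ` (ball 0 1 - {\<tau>})"
  proof (intro equalityI subsetI)
    fix u assume "u \<in> - arc \<alpha>"
    then show "u \<in> (\<lambda>w. bA w / bB w) ` (ball 0 1 - {\<tau>})"
      using disc_of_u[of u] by (intro image_eqI[of _ _ "disc_of_u u"]) auto
  next
    fix u assume "u \<in> (\<lambda>w. bA w / bB w) ` (ball 0 1 - {\<tau>})"
    then show "u \<in> - arc \<alpha>"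
      using disc_of_u_quotient(1) by auto
  qed
  moreover have "connected (ball 0 1 - {\<tau>})"
    by (intro connected_open_delete) auto
  ultimately show "connected (- arc \<alpha>)"
    using connected_continuous_image[OF cont] by simp
  show "(\<lambda>u. bB (disc_of_u u)) holomorphic_on - arc \<alpha>"
    by (rule holomorphic_on_compose_gen[OF holomorphic_disc_of_u holomorphic_b(2), unfolded o_def])
      (use disc_of_u(1) less_inverse_T[OF less_imp_le] in auto)
  show "bB (disc_of_u u) \<noteq> 0" "cmod (bB (disc_of_u u)) < 1" if "u \<in> - arc \<alpha>" for u
    using bB_disc_of_u that by auto
  show "compact {u \<in> - arc \<alpha>. c \<le> cmod (bB (disc_of_u u)) \<and> cmod (bB (disc_of_u u)) \<le> c'}" if c: "0 < c" "c' < 1" for c c'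
  proof -
    let ?A = "{w. w \<in> ball 0 1 \<and> c \<le> cmod (bB w) \<and> cmod (bB w) \<le> c'}"
    have ne: "w \<noteq> \<tau>" if "w \<in> ?A" for w
      using that c by (auto simp: bB_\<tau>)
    have "compact ?A"
      unfolding bB_blaschke using T c by (intro compact_blaschke_annulus) auto
    moreover have "continuous_on ?A (\<lambda>w. bA w / bB w)"
      by (rule continuous_on_subset[OF cont]) (use ne in auto)
    ultimately have "compact ((\<lambda>w. bA w / bB w) ` ?A)"
      by (intro compact_continuous_image)
    moreover have "(\<lambda>w. bA w / bB w) ` ?A = {u \<in> - arc \<alpha>. c \<le> cmod (bB (disc_of_u u)) \<and> cmod (bB (disc_of_u u)) \<le> c'}"
      by (rule image_Collect_inverse[where A = "ball 0 1" and g = disc_of_u]) (use disc_of_u_quotient ne disc_of_u in auto)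
    ultimately show ?thesis
      by simp
  qed
  show "log_pole_at None (\<lambda>q. case q of Some u \<Rightarrow> - ln (cmod (bB (disc_of_u u))) | None \<Rightarrow> 0)"
  proof -
    \<comment> \<open>Since A = u B, the expression - ln |B| - ln |u| equals - ln |A|, which has a
      finite limit at infinity because A(\<tau>) is nonzero.\<close>
    have "bA \<tau> \<noteq> 0"
      unfolding bA_\<tau> of_real_eq_0_iff using capacity_pos by (metis less_irrefl)
    then have lim: "((\<lambda>u. - ln (cmod (bA (disc_of_u u)))) \<longlongrightarrow> - ln (cmod (bA \<tau>))) at_infinity"
      using T by (intro tendsto_intros tendsto_b(1)[OF disc_of_u_at_infinity]) auto
    have "\<forall>\<^sub>F u in at_infinity. u \<noteq> (0 :: complex)"
      unfolding eventually_at_infinity by (intro exI[of _ 1]) auto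
    with eventually_not_arc have "\<forall>\<^sub>F u in at_infinity. - ln (cmod (bA (disc_of_u u))) = - ln (cmod (bB (disc_of_u u))) - ln (cmod u)"
      by eventually_elim (simp add: bB_disc_of_u norm_mult ln_mult)
    from Lim_transform_eventually[OF lim this] show ?thesis
      by (simp add: log_pole_at_def tendsto_imp_bigo_1)
  qed
  show "\<exists>c>0. \<forall>u\<in>- arc \<alpha>. cmod (bB (disc_of_u u)) < c \<longrightarrow> N u" if "eventually N (pole_filter None)" for N
  proof -
    obtain M where M: "\<And>u. M \<le> cmod u \<Longrightarrow> N u"
      using \<open>eventually N (pole_filter None)\<close> by (auto simp: pole_filter_def eventually_at_infinity)
    \<comment> \<open>From 1 / B = A - \<gamma> (1 - u): if |u| <= |M| then 1 / |B| is at most this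
      denominator, so |B| < c forces u to be large.\<close>
    define c where "c = 1 / (1 + cmod \<gamma> * (1 + \<bar>M\<bar>))"
    have "0 < c"
      unfolding c_def by (intro divide_pos_pos add_pos_nonneg) auto
    moreover have "N u" if u: "u \<notin> arc \<alpha>" "cmod (bB (disc_of_u u)) < c" for u
    proof (rule M, rule ccontr)
      assume "\<not> M \<le> cmod u"
      then have "cmod u \<le> \<bar>M\<bar>"
        by auto
      define w where "w = disc_of_u u"
      have w: "cmod w < 1" "bB w \<noteq> 0" "bA w / bB w = u"
        using disc_of_u[OF u(1)] bB_disc_of_u(1)[OF u(1)] by (simp_all add: w_def)
      have "bA w - \<gamma> * (1 - u) = 1 / bB w"
        using bA_minus_inverse_bB[of w] w by (simp add: algebra_simps)
      then have "1 / cmod (bB w) \<le> cmod (bA w) + cmod \<gamma> * cmod (1 - u)"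
        using norm_triangle_ineq4[of "bA w" "\<gamma> * (1 - u)"] by (simp add: norm_mult norm_divide)
      also have "\<dots> \<le> 1 + cmod \<gamma> * (1 + \<bar>M\<bar>)"
        using norm_b_disc(1)[of w] w(1) norm_triangle_ineq4[of 1 u] \<open>cmod u \<le> \<bar>M\<bar>\<close>
        by (intro add_mono mult_left_mono) auto
      finally have "1 / cmod (bB w) \<le> 1 / c"
        by (simp add: c_def)
      then have "c \<le> cmod (bB w)"
        using \<open>0 < c\<close> w(2) by (simp add: divide_le_eq pos_le_divide_eq field_simps)
      with u(2) show False
        by (simp add: w_def)
    qed
    ultimately show ?thesis
      by blast
  qed
  fix c assume "cmod c = 1" "\<And>u. u \<in> - arc \<alpha> \<Longrightarrow> b (Some u) = c * bB (disc_of_u u)"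
  then show thesis
    by (intro that) auto
qed


section \<open>Reflection and compact sets on the sphere\<close>

definition disc_of_sphere :: "sphere \<Rightarrow> complex" where
  "disc_of_sphere q = (case q of None \<Rightarrow> \<tau> | Some u \<Rightarrow> disc_of_u u)"

lemma mem_\<Omega>_arc: "None \<in> \<Omega>_arc \<alpha>" "Some u \<in> \<Omega>_arc \<alpha> \<longleftrightarrow> u \<notin> arc \<alpha>"
  by (auto simp: \<Omega>_arc_def)

lemma norm_disc_of_sphere_less_1: "q \<in> \<Omega>_arc \<alpha> \<Longrightarrow> cmod (disc_of_sphere q) < 1"
  using T disc_of_u(1) by (cases q) (auto simp: disc_of_sphere_def mem_\<Omega>_arc)

lemma z_map_disc_of_sphere: "q \<in> \<Omega>_arc \<alpha> \<Longrightarrow> z_map \<alpha> q = slit_of (disc_of_sphere q)"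
  by (cases q) (auto simp: disc_of_sphere_def mem_\<Omega>_arc z_map_None z_map_Some disc_of_u)

lemma zero_notin_arc: "0 \<notin> arc \<alpha>"
  by (simp add: arc_def)

lemma disc_of_u_0: "disc_of_u 0 = - \<tau>"
proof -
  have "cmod (- \<tau>) < 1" "- \<tau> \<noteq> \<tau>"
    using T by auto
  from disc_of_u_quotient(2)[OF this] show ?thesis
    by (simp add: bA_def)
qed

text \<open>The map w -> - cnj w exchanges A and B up to sign and conjugation, hence inverts and
  conjugates their quotient. The points 0 and infinity, at w = - \<tau> and w = \<tau>, are the
  special cases of \<open>reflect\<close>.\<close>

lemma disc_of_sphere_reflect:
  assumes q: "q \<in> \<Omega>_arc \<alpha>"
  shows "reflect q \<in> \<Omega>_arc \<alpha>" "disc_of_sphere (reflect q) = - cnj (disc_of_sphere q)"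
proof -
  have "reflect q \<in> \<Omega>_arc \<alpha> \<and> disc_of_sphere (reflect q) = - cnj (disc_of_sphere q)"
  proof (cases q)
    case None
    then show ?thesis
      by (simp add: reflect_def disc_of_sphere_def mem_\<Omega>_arc zero_notin_arc disc_of_u_0)
  next
    case (Some u)
    show ?thesis
    proof (cases "u = 0")
      case True
      then show ?thesis
        using Some by (simp add: reflect_def disc_of_sphere_def mem_\<Omega>_arc disc_of_u_0)
    next
      case False
      define w where "w = disc_of_u u"
      have u: "u \<notin> arc \<alpha>"
        using q Some by (simp add: mem_\<Omega>_arc)
      have w: "cmod w < 1" "bA w / bB w = u"
        using disc_of_u[OF u] by (simp_all add: w_def)
      have 1: "bA (- cnj w) = - cnj (bB w)" "bB (- cnj w) = - cnj (bA w)"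
        by (simp_all add: bA_def bB_def minus_divide_left add.commute)
      have "bA (- cnj w) / bB (- cnj w) = cnj (1 / (bA w / bB w))"
        unfolding 1 by simp
      then have 2: "bA (- cnj w) / bB (- cnj w) = 1 / cnj u"
        unfolding w(2) by simp
      moreover have "- cnj w \<noteq> \<tau>"
      proof
        assume "- cnj w = \<tau>"
        with 2 False show False
          by (simp add: bB_\<tau>)
      qed
      ultimately show ?thesis
        using disc_of_u_quotient[of "- cnj w"] w(1) Some False
        by (simp add: reflect_def disc_of_sphere_def mem_\<Omega>_arc w_def)
    qed
  qed
  then show "reflect q \<in> \<Omega>_arc \<alpha>" "disc_of_sphere (reflect q) = - cnj (disc_of_sphere q)"
    by auto
qed

text \<open>The points with r0 <= |w| <= 1 and A / B in K form a compact set, as r0 > T keeps the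
  quotient continuous. It misses the unit circle, which is mapped into the arc, so |w| has a maximum
  below 1 on it.\<close>

lemma compact_imp_norm_disc_of_sphere_bounded:
  assumes K: "compactin riemann_sphere K" "K \<subseteq> \<Omega>_arc \<alpha>"
  obtains r where "r < 1" "\<And>q. q \<in> K \<Longrightarrow> cmod (disc_of_sphere q) \<le> r"
proof -
  define K' where "K' = {u. Some u \<in> K}"
  have "Hausdorff_space riemann_sphere"
    unfolding riemann_sphere_def Hausdorff_space_Alexandroff_compactification
    by (simp add: locally_compact_space_euclidean)
  then have "closedin riemann_sphere K"
    using K(1) by (rule compactin_imp_closedin)
  then have "closed K'"
    using closedin_continuous_map_preimage[OF continuous_map_Some[of euclidean]]
    unfolding riemann_sphere_def K'_def by fastforce
  define r0 where "r0 = (1 + T) / 2"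
  define S where "S = cball 0 1 - ball (0::complex) r0"
  have r0: "T < r0" "r0 < 1"
    using T by (auto simp: r0_def)
  have "bB w \<noteq> 0" if "w \<in> S" for w
    using that r0 T denominators_disc(2)[of w] by (auto simp: S_def bB_def)
  then have cont: "continuous_on S (\<lambda>w. bA w / bB w)"
    by (intro continuous_intros continuous_on_subset[OF continuous_b(1)] continuous_on_subset[OF continuous_b(2)])
      (auto simp: S_def)
  have "closed S"
    unfolding S_def by (intro closed_Diff) auto
  define M where "M = S \<inter> (\<lambda>w. bA w / bB w) -` K'"
  have "closed M"
    unfolding M_def by (rule continuous_closed_preimage[OF cont \<open>closed S\<close> \<open>closed K'\<close>])
  then have "compact M"
    unfolding compact_eq_bounded_closed M_def S_def by (blast intro: bounded_subset[OF bounded_cball])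
  have lt: "cmod w < 1" if "w \<in> M" for w
  proof (rule ccontr)
    assume "\<not> cmod w < 1"
    then have "cmod w = 1"
      using that by (auto simp: M_def S_def)
    from circle_quotient_mem_arc[OF this] show False
      using that K(2) by (auto simp: M_def K'_def mem_\<Omega>_arc)
  qed
  obtain r1 where r1: "r1 < 1" "\<And>w. w \<in> M \<Longrightarrow> cmod w \<le> r1"
  proof (cases "M = {}")
    case False
    have "continuous_on M cmod"
      by (intro continuous_intros)
    from continuous_attains_sup[OF \<open>compact M\<close> False this] lt that show ?thesis
      by blast
  qed (use that[of 0] in auto)
  show ?thesis
  proof (rule that[of "max r0 r1"])
    fix q assume q: "q \<in> K"
    then have q': "q \<in> \<Omega>_arc \<alpha>"
      using K(2) by auto
    show "cmod (disc_of_sphere q) \<le> max r0 r1"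
    proof (cases q)
      case None
      then show ?thesis
        using r0 T by (simp add: disc_of_sphere_def)
    next
      case (Some u)
      have u: "u \<notin> arc \<alpha>" "u \<in> K'"
        using q q' Some by (simp_all add: K'_def mem_\<Omega>_arc)
      show ?thesis
      proof (cases "cmod (disc_of_u u) < r0")
        case False
        then have "disc_of_u u \<in> M"
          using disc_of_u[OF u(1)] u(2) by (simp add: M_def S_def)
        then show ?thesis
          using r1(2) Some by (fastforce simp: disc_of_sphere_def)
      qed (use Some in \<open>simp add: disc_of_sphere_def\<close>)
    qed
  qed (use r0 r1 in simp)
qed

section \<open>The limit function in the disc coordinate\<close>

lemma s_branch_eq:
  assumes s: "is_s_branch \<alpha> s" and w: "cmod w < 1" "w \<noteq> 0"
  shows "s (slit_of w) = - ((1 + \<tau>\<^sup>2) * w / (\<tau> * (1 + w\<^sup>2)))"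
proof -
  define S where "S w = - ((1 + \<tau>\<^sup>2) * w / (\<tau> * (1 + w\<^sup>2)))" for w
  define V where "V = ball (0::complex) 1 - {0}"
  have T0: "\<tau> \<noteq> 0"
    using T by simp
  have S_nz: "S w \<noteq> 0" if "w \<in> V" for w
    unfolding S_def neg_equal_0_iff_equal divide_eq_0_iff mult_eq_0_iff
    using that one_plus_T_square_nonzero(1) one_minus_square_nonzero(2)[of w] T0 by (auto simp: V_def)
  have "connected V"
    unfolding V_def by (intro connected_open_delete) auto
  have "continuous_on V (\<lambda>w. s (slit_of w) / S w)"
  proof -
    have "s holomorphic_on \<Omega>\<^sub>0"
      using s by (simp add: is_s_branch_def)
    then have "continuous_on V (\<lambda>w. s (slit_of w))"
      by (intro continuous_on_compose2[OF holomorphic_on_imp_continuous_on holomorphic_on_imp_continuous_on]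
          holomorphic_on_subset[OF holomorphic_slit_of]) (auto simp: V_def intro: slit_of_mem)
    moreover have "continuous_on V S"
      unfolding S_def using one_minus_square_nonzero(2) T0 by (intro continuous_intros) (auto simp: V_def)
    ultimately show ?thesis
      using S_nz by (intro continuous_intros) auto
  qed
  moreover have sq: "(s (slit_of w) / S w)\<^sup>2 = 1" if "w \<in> V" for w
  proof -
    have w: "cmod w < 1" "w \<noteq> 0"
      using that by (auto simp: V_def)
    have nz: "1 - w\<^sup>2 \<noteq> 0" "1 + w\<^sup>2 \<noteq> 0" "1 - \<tau>\<^sup>2 \<noteq> 0" "1 + \<tau>\<^sup>2 \<noteq> 0"
      using one_minus_square_nonzero[OF w(1)] one_plus_T_square_nonzero by auto
    have quot: "(slit_of v)\<^sup>2 / ((slit_of v)\<^sup>2 - 1) = 4 * v\<^sup>2 / (1 + v\<^sup>2)\<^sup>2" if "1 - v\<^sup>2 \<noteq> 0" for v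
    proof -
      have "(slit_of v)\<^sup>2 = - 4 * v\<^sup>2 / (1 - v\<^sup>2)\<^sup>2"
        by (simp add: slit_of_def power_divide power_mult_distrib)
      moreover from this have "(slit_of v)\<^sup>2 - 1 = - ((1 + v\<^sup>2)\<^sup>2) / (1 - v\<^sup>2)\<^sup>2"
        using that by (simp add: divide_simps) (simp add: power2_eq_square algebra_simps)
      ultimately show ?thesis
        using that by simp
    qed
    have z0: "z\<^sub>0 \<alpha> = slit_of (- \<tau>)"
      by (simp add: z\<^sub>0_eq slit_of_\<tau>)
    have "(s (slit_of w))\<^sup>2 = ((z\<^sub>0 \<alpha>)\<^sup>2 - 1) / (z\<^sub>0 \<alpha>)\<^sup>2 * ((slit_of w)\<^sup>2 / ((slit_of w)\<^sup>2 - 1))"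
      using s slit_of_mem[OF w(1)] unfolding is_s_branch_def by blast
    also have "((z\<^sub>0 \<alpha>)\<^sup>2 - 1) / (z\<^sub>0 \<alpha>)\<^sup>2 = inverse (4 * (- \<tau>)\<^sup>2 / (1 + (- \<tau>)\<^sup>2)\<^sup>2)"
      unfolding z0 using quot[of "- \<tau>"] nz(3) by (metis inverse_divide power2_minus)
    also have "\<dots> * ((slit_of w)\<^sup>2 / ((slit_of w)\<^sup>2 - 1)) = (S w)\<^sup>2"
      unfolding quot[OF nz(1)] using T0 by (simp add: S_def power_divide power_mult_distrib)
    finally show ?thesis
      using S_nz[OF that] by (simp add: power_divide)
  qed
  moreover have "finite ((\<lambda>w. s (slit_of w) / S w) ` V)"
  proof (rule finite_subset)
    show "(\<lambda>w. s (slit_of w) / S w) ` V \<subseteq> {1, - 1}"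
      using sq unfolding power2_eq_1_iff by blast
  qed simp
  ultimately have "(\<lambda>w. s (slit_of w) / S w) constant_on V"
    using continuous_finite_range_constant[OF \<open>connected V\<close>] by blast
  then obtain c where c: "\<And>w. w \<in> V \<Longrightarrow> s (slit_of w) / S w = c"
    by (auto simp: constant_on_def)
  \<comment> \<open>The sign is decided at - \<tau>, which corresponds to the point
    \<open>z\<^sub>0 \<alpha>\<close> where s is normalised.\<close>
  have "s (slit_of (- \<tau>)) = 1"
    using s by (simp add: is_s_branch_def z\<^sub>0_eq slit_of_\<tau>)
  moreover have "S (- \<tau>) = 1"
    using one_plus_T_square_nonzero T0 by (simp add: S_def)
  ultimately have "c = 1"
    using c[of "- \<tau>"] T by (simp add: V_def)
  then show ?thesis
    using c[of w] S_nz[of w] w by (simp add: V_def S_def[symmetric])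
qed

text \<open>In the disc coordinate (1 + s) / (2 s) is (w - \<tau>) (1 - \<tau> w) / (2 (1 +
  \<tau>^2) w), and the two Green functions cancel w and w - \<tau>. At w = 0 and w = \<tau>
  division by zero makes the raw expression 0 instead of its limit, hence
  \<open>remove_sings\<close>.\<close>

lemma limit_function:
  assumes s: "is_s_branch \<alpha> s"
    and b0: "is_complex_Green_function (Some ` \<Omega>\<^sub>0) (Some 0) b\<^sub>0"
    and b1: "is_complex_Green_function (Some ` \<Omega>\<^sub>0) (Some (cnj (z\<^sub>0 \<alpha>))) b\<^sub>1"
  obtains c where "cmod c = 1"
    and "\<And>w. cmod w < 1 \<Longrightarrow>
      remove_sings (\<lambda>z. (1 + s z) / (2 * s z) * (b\<^sub>0 (Some z) / b\<^sub>1 (Some z))) (slit_of w) = c * lim_fun (- w)"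
proof -
  have Z0: "slit_of 0 = 0"
    by (simp add: slit_of_def)
  obtain c0 where c0: "cmod c0 = 1" "\<And>z. z \<in> \<Omega>\<^sub>0 - {slit_of 0} \<Longrightarrow> b\<^sub>0 (Some z) = c0 * blaschke 0 (disc_of z)"
    using complex_Green_function_\<Omega>\<^sub>0[of 0 b\<^sub>0] b0 unfolding Z0 by auto
  have "cnj (z\<^sub>0 \<alpha>) = slit_of \<tau>"
    by (simp add: z\<^sub>0_eq slit_of_\<tau>)
  then obtain c1 where c1: "cmod c1 = 1" "\<And>z. z \<in> \<Omega>\<^sub>0 - {slit_of \<tau>} \<Longrightarrow> b\<^sub>1 (Some z) = c1 * blaschke \<tau> (disc_of z)"
    using complex_Green_function_\<Omega>\<^sub>0[of \<tau> b\<^sub>1] b1 T by auto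
  define f where "f = (\<lambda>z. (1 + s z) / (2 * s z) * (b\<^sub>0 (Some z) / b\<^sub>1 (Some z)))"
  have f: "f z = c0 / c1 * lim_fun (- disc_of z)" if z: "z \<in> \<Omega>\<^sub>0" "z \<noteq> slit_of 0" "z \<noteq> slit_of \<tau>" for z
  proof -
    define w where "w = disc_of z"
    have w: "cmod w < 1" "slit_of w = z"
      using disc_of[OF z(1)] by (simp_all add: w_def)
    have w0: "w \<noteq> 0" "w \<noteq> \<tau>"
      using z w(2) by auto
    have nz: "1 + w\<^sup>2 \<noteq> 0" "1 + \<tau>\<^sup>2 \<noteq> 0" "1 - \<tau> * w \<noteq> 0" "\<tau> \<noteq> 0" "c1 \<noteq> 0" "w - \<tau> \<noteq> 0"
      using one_minus_square_nonzero(2)[OF w(1)] one_plus_T_square_nonzero(1) denominators_disc(2)[of w] w(1) T c1(1) w0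
      by auto
    define k where "k = (1 + \<tau>\<^sup>2) * w"
    have k0: "k \<noteq> 0"
      using nz w0 by (simp add: k_def)
    have sz: "s z = - (k / (\<tau> * (1 + w\<^sup>2)))"
      using s_branch_eq[OF s w(1) w0(1)] unfolding w(2) k_def by simp
    have "1 + s z = (\<tau> * (1 + w\<^sup>2) - k) / (\<tau> * (1 + w\<^sup>2))"
      unfolding sz using nz by (simp add: diff_divide_distrib)
    also have "\<tau> * (1 + w\<^sup>2) - k = - ((w - \<tau>) * (1 - \<tau> * w))"
      by (simp add: k_def power2_eq_square algebra_simps)
    finally have "(1 + s z) / (2 * s z) = (w - \<tau>) * (1 - \<tau> * w) / (2 * ((1 + \<tau>\<^sup>2) * w))"
      unfolding sz k_def[symmetric] using nz k0 by simp
    moreover have "b\<^sub>0 (Some z) = c0 * w"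
      using c0(2)[of z] z by (simp add: blaschke_def w_def)
    moreover have "b\<^sub>1 (Some z) = c1 * ((w - \<tau>) / (1 - \<tau> * w))"
      using c1(2)[of z] z by (simp add: blaschke_def w_def)
    ultimately show ?thesis
      unfolding f_def lim_fun_def w_def[symmetric] using nz w0
      by (simp add: power2_eq_square[of "1 - _"] mult_ac del: distrib_left_numeral)
  qed
  show ?thesis
  proof (rule that[of "c0 / c1"])
    show "cmod (c0 / c1) = 1"
      using c0 c1 by (simp add: norm_divide)
    fix w :: complex assume w: "cmod w < 1"
    show "remove_sings (\<lambda>z. (1 + s z) / (2 * s z) * (b\<^sub>0 (Some z) / b\<^sub>1 (Some z))) (slit_of w) = c0 / c1 * lim_fun (- w)"
      unfolding f_def[symmetric]
    proof (rule remove_sings_eqI)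
      have "isCont disc_of (slit_of w)"
        using holomorphic_on_imp_continuous_on[OF holomorphic_disc_of] open_\<Omega>\<^sub>0 slit_of_mem[OF w]
        by (simp add: continuous_on_eq_continuous_at)
      then have "((\<lambda>z. c0 / c1 * lim_fun (- disc_of z)) \<longlongrightarrow> c0 / c1 * lim_fun (- disc_of (slit_of w))) (at (slit_of w))"
        unfolding lim_fun_def isCont_def using one_plus_T_square_nonzero(1)
        by (intro tendsto_intros) (simp_all del: distrib_left_numeral)
      moreover have "\<forall>\<^sub>F z in at (slit_of w). c0 / c1 * lim_fun (- disc_of z) = f z"
      proof -
        \<comment> \<open>Of the two exceptional points only those different from
          \<open>slit_of w\<close> are cut out, so that the set remains a neighbourhood of
          \<open>slit_of w\<close>.\<close>
        have "open (\<Omega>\<^sub>0 - ({slit_of 0, slit_of \<tau>} - {slit_of w}))"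
          by (intro open_Diff open_\<Omega>\<^sub>0 finite_imp_closed) auto
        then have "\<forall>\<^sub>F z in at (slit_of w). z \<in> (\<Omega>\<^sub>0 - ({slit_of 0, slit_of \<tau>} - {slit_of w})) - {slit_of w}"
          using slit_of_mem[OF w] by (intro eventually_at_in_open) auto
        then show ?thesis
        proof eventually_elim
          case (elim z)
          then show ?case
            by (subst f) auto
        qed
      qed
      ultimately show "f \<midarrow>(slit_of w)\<rightarrow> c0 / c1 * lim_fun (- w)"
        using Lim_transform_eventually disc_of_slit_of[OF w] by fastforce
    qed
  qed
qed

text \<open>u B = A tends to A(\<tau>) > 0 at infinity, so the normalization makes the unimodular
  constant positive, that is 1.\<close>

lemma complex_Green_function_arc_normalized:
  assumes b: "is_complex_Green_function (\<Omega>_arc \<alpha>) None b"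
    and norm: "\<exists>c>0. ((\<lambda>u. u * b (Some u)) \<longlongrightarrow> of_real c) at_infinity"
    and u: "u \<notin> arc \<alpha>"
  shows "b (Some u) = bB (disc_of_u u)"
proof -
  obtain c where c: "cmod c = 1" "\<And>u. u \<notin> arc \<alpha> \<Longrightarrow> b (Some u) = c * bB (disc_of_u u)"
    using complex_Green_function_arc[OF b] by blast
  obtain d where d: "0 < d" "((\<lambda>u. u * b (Some u)) \<longlongrightarrow> of_real d) at_infinity"
    using norm by blast
  have "((\<lambda>u. c * bA (disc_of_u u)) \<longlongrightarrow> c * bA \<tau>) at_infinity"
    using T by (intro tendsto_intros tendsto_b(1)[OF disc_of_u_at_infinity]) auto
  moreover have "\<forall>\<^sub>F u in at_infinity. c * bA (disc_of_u u) = u * b (Some u)"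
    using eventually_not_arc by eventually_elim (simp add: c(2) bB_disc_of_u(3))
  ultimately have "((\<lambda>u. u * b (Some u)) \<longlongrightarrow> c * bA \<tau>) at_infinity"
    by (rule Lim_transform_eventually)
  with d(2) have "c * bA \<tau> = of_real d"
    by (intro tendsto_unique[OF trivial_limit_at_infinity _ d(2)])
  then have "c = of_real (d / (2 * T / (1 + T\<^sup>2)))"
    unfolding bA_\<tau> using capacity_pos by (metis less_irrefl nonzero_eq_divide_eq of_real_divide of_real_eq_0_iff)
  moreover have "0 < d / (2 * T / (1 + T\<^sup>2))"
    using d(1) capacity_pos by (rule divide_pos_pos)
  ultimately have "c = 1"
    using c(1) by (metis abs_of_pos norm_of_real of_real_1)
  then show ?thesis
    using c(2)[OF u] by simp
qed

section \<open>Transfer to the extremal polynomials\<close>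

lemma extend_to_infinity_eq_homog:
  assumes b: "\<And>u. u \<notin> arc \<alpha> \<Longrightarrow> b (Some u) = bB (disc_of_u u)"
    and P: "degree P \<le> n" and q: "q \<in> \<Omega>_arc \<alpha>"
  shows "extend_to_infinity (\<lambda>u. b (Some u) ^ n * poly P u) q = homog n P (disc_of_sphere q)"
proof -
  have fin: "b (Some u) ^ n * poly P u = homog n P (disc_of_u u)" if "u \<notin> arc \<alpha>" for u
    using homog_eq[OF P bB_disc_of_u(1)[OF that]] disc_of_u(3)[OF that] by (simp add: b that)
  show ?thesis
  proof (cases q)
    case None
    have "((\<lambda>u. homog n P (disc_of_u u)) \<longlongrightarrow> homog n P \<tau>) at_infinity"
      unfolding homog_def using T by (intro tendsto_intros tendsto_b[OF disc_of_u_at_infinity]) auto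
    moreover have "\<forall>\<^sub>F u in at_infinity. homog n P (disc_of_u u) = b (Some u) ^ n * poly P u"
      using eventually_not_arc by eventually_elim (simp add: fin)
    ultimately have "((\<lambda>u. b (Some u) ^ n * poly P u) \<longlongrightarrow> homog n P \<tau>) at_infinity"
      by (rule Lim_transform_eventually)
    then show ?thesis
      using None by (simp add: extend_to_infinity_def disc_of_sphere_def tendsto_Lim[OF trivial_limit_at_infinity])
  next
    case (Some u)
    then show ?thesis
      using q fin[of u] by (simp add: extend_to_infinity_def disc_of_sphere_def mem_\<Omega>_arc)
  qed
qed

text \<open>The trial polynomial divided by its bound m competes with P n. Leading coefficient and
  value at \<tau> differ by the same positive factor A(\<tau>)^n, so the competition bounds
  G(\<tau>) from below; G(\<tau>) is real because the leading coefficient of P n is.\<close>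

lemma extremal_homog_convergence:
  assumes P: "\<And>n. is_extremal_at_infinity n \<alpha> (P n)" and r: "r < 1"
  shows "uniform_limit (cball 0 r) (\<lambda>n. homog n (P n)) lim_fun sequentially"
proof (rule extremal_convergence[OF _ _ _ _ r])
  fix n
  have Pn: "degree (P n) \<le> n" "\<And>u. u \<in> arc \<alpha> \<Longrightarrow> cmod (poly (P n) u) \<le> 1"
    using P[of n] by (auto simp: is_extremal_at_infinity_def poly_class_def)
  show "admissible n (homog n (P n))"
    using Pn circle_quotient_mem_arc by (intro homog_admissible) auto
  obtain c where c: "0 < c" "coeff (P n) n = of_real c"
    using P[of n] by (auto simp: is_extremal_at_infinity_def)
  have val: "homog n (P n) \<tau> = of_real (c * (2 * T / (1 + T\<^sup>2)) ^ n)"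
    unfolding homog_\<tau> c(2) bA_\<tau> by simp
  then show "Im (homog n (P n) \<tau>) = 0"
    by (simp only: Im_complex_of_real)
  define m where "m = 1 + 2 * trial_error n"
  have m: "1 \<le> m"
    using norm_trial_limit_minus(2)[of 0 n] by (simp add: m_def)
  have "smult (of_real (1 / m)) (trial n) \<in> poly_class n \<alpha>"
    unfolding poly_class_def
  proof (intro CollectI conjI ballI)
    show "degree (smult (of_real (1 / m)) (trial n)) \<le> n"
      by (rule order_trans[OF degree_smult_le degree_trial])
    fix u assume "u \<in> arc \<alpha>"
    then obtain w where w: "cmod w = 1" "bA w / bB w = u"
      by (rule arc_quotient)
    then have "cmod (poly (trial n) u) \<le> m"
      using norm_trial[OF w(1), of n] by (simp add: m_def)
    then show "cmod (poly (smult (of_real (1 / m)) (trial n)) u) \<le> 1"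
      using m by (simp add: norm_mult norm_divide)
  qed
  then have "cmod (coeff (smult (of_real (1 / m)) (trial n)) n) \<le> cmod (coeff (P n) n)"
    using P[of n] unfolding is_extremal_at_infinity_def by blast
  then have "cmod (coeff (trial n) n) / m \<le> c"
    using m c by (simp add: norm_mult norm_divide)
  then have "cmod (coeff (trial n) n) / m * (2 * T / (1 + T\<^sup>2)) ^ n \<le> c * (2 * T / (1 + T\<^sup>2)) ^ n"
    using less_imp_le[OF capacity_pos] by (intro mult_right_mono zero_le_power)
  moreover have "cmod (homog n (trial n) \<tau>) = cmod (coeff (trial n) n) * (2 * T / (1 + T\<^sup>2)) ^ n"
    unfolding homog_\<tau> bA_\<tau> norm_mult norm_power norm_of_real abs_of_pos[OF capacity_pos] ..
  ultimately have "cmod (trial_limit n \<tau>) / m \<le> Re (homog n (P n) \<tau>)"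
    unfolding val Re_complex_of_real by (simp add: homog_trial_\<tau>)
  moreover have "Re (lim_fun \<tau>) - trial_error n \<le> cmod (trial_limit n \<tau>)"
  proof -
    have "cmod (trial_limit n \<tau> - lim_fun \<tau>) \<le> trial_error n"
      using T by (intro norm_trial_limit_minus) simp
    then show ?thesis
      using complex_Re_le_cmod[of "lim_fun \<tau>"] norm_triangle_sub[of "lim_fun \<tau>" "trial_limit n \<tau>"]
      by (simp add: norm_minus_commute)
  qed
  then have "(Re (lim_fun \<tau>) - trial_error n) / m \<le> cmod (trial_limit n \<tau>) / m"
    using m by (intro divide_right_mono) auto
  ultimately show "(Re (lim_fun \<tau>) - trial_error n) / (1 + 2 * trial_error n) \<le> Re (homog n (P n) \<tau>)"
    unfolding m_def by linarith
next
  have "(\<lambda>n. (Re (lim_fun \<tau>) - trial_error n) / (1 + 2 * trial_error n)) \<longlonglongrightarrow> (Re (lim_fun \<tau>) - 0) / (1 + 2 * 0)"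
    by (intro tendsto_intros trial_error_tendsto) auto
  then show "(\<lambda>n. (Re (lim_fun \<tau>) - trial_error n) / (1 + 2 * trial_error n)) \<longlonglongrightarrow> Re (lim_fun \<tau>)"
    by simp
qed

end

theorem theorem2p4:
  fixes \<alpha> :: real
    and s :: "complex \<Rightarrow> complex"
    and b b\<^sub>0 b\<^sub>1 :: "sphere \<Rightarrow> complex"
    and P :: "nat \<Rightarrow> complex poly"
  assumes "0 < \<alpha>" and "\<alpha> < pi"
    and "is_s_branch \<alpha> s"
    and "is_complex_Green_function (\<Omega>_arc \<alpha>) None b"
    and "\<exists>c>0. ((\<lambda>u. u * b (Some u)) \<longlongrightarrow> of_real c) at_infinity"
    and "is_complex_Green_function (Some ` \<Omega>\<^sub>0) (Some 0) b\<^sub>0"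
    and "is_complex_Green_function (Some ` \<Omega>\<^sub>0) (Some (cnj (z\<^sub>0 \<alpha>))) b\<^sub>1"
    and "\<And>n. is_extremal_at_infinity n \<alpha> (P n)"
  shows "\<exists>\<phi>::real. \<forall>K. compactin riemann_sphere K \<and> K \<subseteq> \<Omega>_arc \<alpha> \<longrightarrow>
           uniform_limit K
             (\<lambda>n u. cnj (extend_to_infinity (\<lambda>w. b (Some w) ^ n * poly (P n) w) (reflect u)))
             (\<lambda>u. exp (\<i> * of_real \<phi>) *
                  remove_sings (\<lambda>z. (1 + s z) / (2 * s z) * (b\<^sub>0 (Some z) / b\<^sub>1 (Some z)))
                    (z_map \<alpha> u))
             sequentially"
proof -
  have "0 < tan (\<alpha> / 4)" "tan (\<alpha> / 4) < tan (pi / 4)"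
    using assms(1,2) by (auto intro!: tan_gt_zero tan_monotone)
  then interpret circular_arc "tan (\<alpha> / 4)" \<alpha>
    using assms(1,2) by unfold_locales (auto simp: tan_45)
  obtain c where c: "cmod c = 1"
    and lim: "\<And>w. cmod w < 1 \<Longrightarrow>
      remove_sings (\<lambda>z. (1 + s z) / (2 * s z) * (b\<^sub>0 (Some z) / b\<^sub>1 (Some z))) (slit_of w) = c * lim_fun (- w)"
    using limit_function[OF assms(3,6,7)] by blast
  from c have "c \<noteq> 0"
    by auto
  \<comment> \<open>\<phi> compensates the unimodular constants of the two Green functions, so it is
    the same for all K.\<close>
  obtain \<phi> where \<phi>: "exp (\<i> * of_real \<phi>) = inverse c"
    using complex_norm_eq_1_exp[of "inverse c"] c by (auto simp: norm_inverse)
  \<comment> \<open>The limit function has real coefficients, so the conjugation in the claim undoes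
    the one that \<open>reflect\<close> causes in the disc coordinate.\<close>
  have cnj_lim_fun: "cnj (lim_fun (- cnj w)) = lim_fun (- w)" for w
    by (simp add: lim_fun_def)
  let ?f = "\<lambda>n. extend_to_infinity (\<lambda>w. b (Some w) ^ n * poly (P n) w)"
  let ?R = "remove_sings (\<lambda>z. (1 + s z) / (2 * s z) * (b\<^sub>0 (Some z) / b\<^sub>1 (Some z)))"
  show ?thesis
  proof (intro exI[of _ \<phi>] allI impI, elim conjE)
    fix K assume K: "compactin riemann_sphere K" "K \<subseteq> \<Omega>_arc \<alpha>"
    obtain r where r: "r < 1" "\<And>q. q \<in> K \<Longrightarrow> cmod (disc_of_sphere q) \<le> r"
      using compact_imp_norm_disc_of_sphere_bounded[OF K] by blast
    show "uniform_limit K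
             (\<lambda>n u. cnj (?f n (reflect u)))
             (\<lambda>u. exp (\<i> * of_real \<phi>) * ?R (z_map \<alpha> u))
             sequentially"
    proof (rule uniform_limitI)
      fix e :: real assume "0 < e"
      from uniform_limitD[OF extremal_homog_convergence[OF assms(8) r(1)] this]
      show "\<forall>\<^sub>F n in sequentially. \<forall>u\<in>K.
          dist (cnj (?f n (reflect u)))
            (exp (\<i> * of_real \<phi>) * ?R (z_map \<alpha> u)) < e"
      proof eventually_elim
        case (elim n)
        show ?case
        proof
          fix u assume "u \<in> K"
          then have u: "u \<in> \<Omega>_arc \<alpha>" and disc_of_sphere: "- cnj (disc_of_sphere u) \<in> cball 0 r"
            using K(2) r(2) by auto
          have deg: "degree (P n) \<le> n"
            using assms(8)[of n] by (simp add: is_extremal_at_infinity_def poly_class_def)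
          have "?f n (reflect u) = homog n (P n) (- cnj (disc_of_sphere u))"
            using extend_to_infinity_eq_homog[OF complex_Green_function_arc_normalized[OF assms(4,5)] deg disc_of_sphere_reflect(1)[OF u]]
            by (simp add: disc_of_sphere_reflect(2)[OF u])
          moreover have "exp (\<i> * of_real \<phi>) * ?R (z_map \<alpha> u)
            = cnj (lim_fun (- cnj (disc_of_sphere u)))"
            unfolding z_map_disc_of_sphere[OF u] lim[OF norm_disc_of_sphere_less_1[OF u]] \<phi> cnj_lim_fun using \<open>c \<noteq> 0\<close> by simp
          moreover have "dist (cnj x) (cnj y) = dist x y" for x y
            by (simp add: dist_norm flip: complex_cnj_diff)
          ultimately show "dist (cnj (?f n (reflect u)))
            (exp (\<i> * of_real \<phi>) * ?R (z_map \<alpha> u)) < e"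
            using elim disc_of_sphere by metis
        qed
      qed
    qed
  qed
qed

end
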